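(* Let $G$ and $g$ satisfy the standing assumptions (S1)–(S4), and suppose Assumption (M) holds: there exist $\sigma_0$ and $p$ with $\sigma_0,\sigma_0^{-1},p^{-1}$ bounded satisfying (M1) and (M2). Let $u_h$, $h=T/n$, be the approximating solution of the scheme built from such a pair $(\sigma_0,p)$. Then the terminal value problem $$-\partial_t u-G(t,x,u,Du,D^2u)=0 \text{ on } [0,T)\times\mathbb{R}^d,\qquad u(T,\cdot)=g$$ has a unique bounded viscosity solution $u$, and $u_h$ converges to $u$ locally uniformly as $h\to0$ (i.e. as $n\to\infty$).
   Context: Notation. $T>0$, $d\ge1$; $\mathbb{S}^d$ is the set of symmetric $d\times d$ matrices with its usual partial order ($\gamma\le\tilde\gamma$ iff $\tilde\gamma-\gamma$ is nonnegative definite); $\mathbb{R}^{d\times d}_+$ is the set of nondegenerate (invertible) $d\times d$ matrices. $\gamma:\tilde\gamma=\operatorname{tr}(\gamma\tilde\gamma^\top)$, $|\gamma|=\sqrt{\gamma:\gamma}$. For a matrix $\gamma$, $D[\gamma]$ is the diagonal matrix with the same diagonal entries as $\gamma$. $\sigma^{-\top}:=(\sigma^{-1})^\top$. $\mathbf 0$ is the zero of $\mathbb{R}^d$ or $\mathbb{S}^d$. Data: $G:[0,T]\times\mathbb{R}^d\times\mathbb{R}\times\mathbb{R}^d\times\mathbb{S}^d\to\mathbb{R}$, $(t,x,y,z,\gamma)\mapsto G$, and $g:\mathbb{R}^d\to\mathbb{R}$. For notational convenience $G$ is assumed differentiable in $(y,z,\gamma)$; $G_\gamma$ is the ($\mathbb{S}^d$-valued)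 derivative in $\gamma$. Viscosity solutions. An upper (resp. lower) semicontinuous $u$ is a viscosity subsolution (resp. supersolution) of the PDE if $u(T,\cdot)\le g$ (resp. $\ge g$) and for every $(t,x)\in[0,T)\times\mathbb{R}^d$ and smooth $\varphi$ with $[u-\varphi](t,x)=0\ge[u-\varphi](s,y)$ (resp. $\le$) for all $(s,y)\in[0,T]\times\mathbb{R}^d$, one has $[-\partial_t\varphi-G(\cdot,\varphi,D\varphi,D^2\varphi)](t,x)\le0$ (resp. $\ge0$). A viscosity solution is both. Standing assumptions. (S1) $G(\cdot,0,\mathbf 0,\mathbf 0)$ and $g$ are bounded. (S2) $G$ is continuous in $t$ and uniformly Lipschitz continuous in $(x,y,z,\gamma)$; $g$ is uniformly Lipschitz continuous. (S3) $G$ is nondecreasing in $\gamma$. (S4) Comparison holds for the PDE in the class of bounded viscosity solutions: if $u_1,u_2$ are bounded viscosity sub- and supersolutions respectively, then $u_1\le u_2$. Scheme. Given $\sigma_0:[0,T]\times\mathbb{R}^d\to\mathbb{R}^{d\times d}_+$ and $p:[0,T]\times\mathbb{R}^d\to(0,1)$ with $\sigma_0,\sigma_0^{-1},p^{-1}$ bounded, put $a_0=\sigma_0\sigma_0^\top$, $F(t,x,y,z,\gamma)=G(t,x,y,z,\gamma)-\frac12a_0(t,x):\gamma$, and $\widetilde G_\gamma=\sigma_0^{-1}G_\gamma\sigma_0^{-\top}$ (with $\sigma_0=\sigma_0(t,x)$). For each $(t,x)$ let $\xi=\xi^{t,x}$ be an $\mathbb{R}^d$-valued random variable with i.i.d.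 components, $\mathbb{P}(\xi_i=\pm1/\sqrt p)=p/2$ for each sign, $\mathbb{P}(\xi_i=0)=1-p$, $p=p(t,x)$. For $t\in[0,T)$, $h>0$ with $t+h\le T$, and measurable $\varphi:\mathbb{R}^d\to\mathbb{R}$, define (with $\sigma_0,p,\xi$ taken at $(t,x)$) $$\mathcal{D}^{t,i}_h\varphi(x)=\mathbb{E}[\varphi(x+\sqrt h\,\sigma_0\xi)K_i(\xi)],\ i=0,1,2,\quad K_0=1,\quad K_1(\xi)=\frac{\sigma_0^{-\top}\xi}{\sqrt h},$$ $$K_2(\xi)=\frac{\sigma_0^{-\top}\big[(1-p)\xi\xi^\top-(1-3p)D[\xi\xi^\top]-2pI_d\big]\sigma_0^{-1}}{(1-p)h},$$ $$\mathbb{T}^t_h[\varphi](x)=\mathcal{D}^{t,0}_h\varphi(x)+hF\big(t,x,\mathcal{D}^{t,0}_h\varphi(x),\mathcal{D}^{t,1}_h\varphi(x),\mathcal{D}^{t,2}_h\varphi(x)\big).$$ For $n\ge1$, $h=T/n$, $t_i=ih$, set $u_h(t_n,\cdot)=g$ and, for $i=n,\dots,1$, $u_h(t,\cdot)=\mathbb{T}^t_{t_i-t}[u_h(t_i,\cdot)]$ for $t\in[t_{i-1},t_i)$. Assumption (M). Associated to $\sigma_0$ define $\underline\alpha(t,x)=\sup\{\alpha>0:\alpha I_d\le D[\widetilde G_\gamma](t,x,y,z,\gamma)\ \forall(y,z,\gamma)\}$, $\bar\alpha(t,x)=\inf\{\alpha>0:\alpha I_d\ge D[\widetilde G_\gamma](t,x,y,z,\gamma)\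 \forall(y,z,\gamma)\}$, $\Lambda=\bar\alpha/\underline\alpha$, $\theta(t,x)=\inf\{\theta\ge0:D[\widetilde G_\gamma]\le(1+\theta)\widetilde G_\gamma\ \forall (y,z,\gamma)\}$, and for $p\in(0,1)$ $$\alpha_p=\frac{p(2+3\theta)-\theta}{p(1+\theta)},\quad c_p=\sqrt{2p\Lambda+\alpha_p-2p},\quad \lambda_p=\sqrt p\Big[(1-p+pd)c_p-\frac{2pd\Lambda}{c_p}\Big]\frac{\sqrt{\underline\alpha}}{|\sigma_0^{-1}|},$$ $$\lambda^*=\inf_{(t,x)\in[0,T]\times\mathbb{R}^d}\ \sup_{p\in[\frac{\theta}{2(1+\theta)},\frac13]\cap(0,\frac13]}\lambda_p(t,x).$$ (M1) $\theta(t,x)\le2$ for all $(t,x)$ and $\lambda^*>0$. (M2) For all $(t,x)$, with $p=p(t,x)$: $p\in[\frac{\theta}{2(1+\theta)},\frac13]\cap(0,\frac13]$, $\lambda_p\ge\lambda^*/2$, and $\underline\alpha=c_p^{-2}$. *)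

theory Defs
  imports "HOL-Probability.Probability"
begin

section \<open>Symmetric matrices\<close>

text \<open>
  The inner product and norm of \<^typ>\<open>real^'d^'d\<close> are \<open>\<gamma> : \<eta> = tr (\<gamma> \<eta>\<^sup>T)\<close> and the
  Frobenius norm, so \<open>:\<close> and \<open>|\<cdot>|\<close> on matrices are written \<open>\<bullet>\<close> and \<open>norm\<close>.
\<close>

definition Sym :: "(real^'d^'d) set" where
  "Sym = {A. transpose A = A}"

definition mat_le :: "real^'d^'d \<Rightarrow> real^'d^'d \<Rightarrow> bool" where
  "mat_le A B \<longleftrightarrow> B - A \<in> Sym \<and> (\<forall>v. 0 \<le> v \<bullet> ((B - A) *v v))"

definition diag_part :: "real^'d^'d \<Rightarrow> real^'d^'d" where
  "diag_part A = (\<chi> i j. if i = j then A $ i $ j else 0)"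

definition outer :: "real^'d \<Rightarrow> real^'d^'d" where
  "outer v = (\<chi> i j. v $ i * v $ j)"

type_synonym 'd spacetime = "real \<times> (real^'d)"

type_synonym 'd nonlinearity =
  "real \<Rightarrow> real^'d \<Rightarrow> real \<Rightarrow> real^'d \<Rightarrow> real^'d^'d \<Rightarrow> real"

section \<open>Viscosity solutions\<close>

definition usc_on :: "'a::topological_space set \<Rightarrow> ('a \<Rightarrow> real) \<Rightarrow> bool" where
  "usc_on S u \<longleftrightarrow> (\<forall>q\<in>S. \<forall>a. u q < a \<longrightarrow> (\<forall>\<^sub>F r in at q within S. u r < a))"

definition lsc_on :: "'a::topological_space set \<Rightarrow> ('a \<Rightarrow> real) \<Rightarrow> bool" where
  "lsc_on S u \<longleftrightarrow> (\<forall>q\<in>S. \<forall>a. a < u q \<longrightarrow> (\<forall>\<^sub>F r in at q within S. a < u r))"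

text \<open>
  Test functions are \<open>C\<^sup>\<infinity>\<close> on the whole space \<open>\<real> \<times> \<real>\<^sup>d\<close>, so that the derivatives at \<open>t = 0\<close> are two-sided.
\<close>

definition dderiv :: "('a::euclidean_space \<Rightarrow> real) \<Rightarrow> 'a \<Rightarrow> 'a \<Rightarrow> real" where
  "dderiv f v q = frechet_derivative f (at q) v"

primrec Ck :: "nat \<Rightarrow> ('a::euclidean_space \<Rightarrow> real) \<Rightarrow> bool" where
  "Ck 0 f \<longleftrightarrow> continuous_on UNIV f"
| "Ck (Suc k) f \<longleftrightarrow> f differentiable_on UNIV \<and> (\<forall>v. Ck k (dderiv f v))"

definition smooth :: "('a::euclidean_space \<Rightarrow> real) \<Rightarrow> bool" where
  "smooth f \<longleftrightarrow> (\<forall>k. Ck k f)"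

definition dt :: "('d::finite spacetime \<Rightarrow> real) \<Rightarrow> 'd spacetime \<Rightarrow> real" where
  "dt f q = dderiv f (1, 0) q"

definition grad :: "('d::finite spacetime \<Rightarrow> real) \<Rightarrow> 'd spacetime \<Rightarrow> real^'d" where
  "grad f q = (\<chi> i. dderiv f (0, axis i 1) q)"

definition hess :: "('d::finite spacetime \<Rightarrow> real) \<Rightarrow> 'd spacetime \<Rightarrow> real^'d^'d" where
  "hess f q = (\<chi> i j. dderiv (dderiv f (0, axis j 1)) (0, axis i 1) q)"

definition strip :: "real \<Rightarrow> 'd spacetime set" where
  "strip T = {0..T} \<times> UNIV"

definition visc_subsol ::
  "real \<Rightarrow> 'd::finite nonlinearity \<Rightarrow> (real^'d \<Rightarrow> real) \<Rightarrow> ('d spacetime \<Rightarrow> real) \<Rightarrow> bool" where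
  "visc_subsol T G g u \<longleftrightarrow>
     usc_on (strip T) u \<and> (\<forall>x. u (T, x) \<le> g x) \<and>
     (\<forall>t x \<phi>. 0 \<le> t \<and> t < T \<and> smooth \<phi> \<and> u (t, x) - \<phi> (t, x) = 0 \<and>
        (\<forall>q\<in>strip T. u q - \<phi> q \<le> 0) \<longrightarrow>
        - dt \<phi> (t, x) - G t x (\<phi> (t, x)) (grad \<phi> (t, x)) (hess \<phi> (t, x)) \<le> 0)"

definition visc_supersol ::
  "real \<Rightarrow> 'd::finite nonlinearity \<Rightarrow> (real^'d \<Rightarrow> real) \<Rightarrow> ('d spacetime \<Rightarrow> real) \<Rightarrow> bool" where
  "visc_supersol T G g u \<longleftrightarrow>
     lsc_on (strip T) u \<and> (\<forall>x. u (T, x) \<ge> g x) \<and>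
     (\<forall>t x \<phi>. 0 \<le> t \<and> t < T \<and> smooth \<phi> \<and> u (t, x) - \<phi> (t, x) = 0 \<and>
        (\<forall>q\<in>strip T. u q - \<phi> q \<ge> 0) \<longrightarrow>
        - dt \<phi> (t, x) - G t x (\<phi> (t, x)) (grad \<phi> (t, x)) (hess \<phi> (t, x)) \<ge> 0)"

definition visc_sol ::
  "real \<Rightarrow> 'd::finite nonlinearity \<Rightarrow> (real^'d \<Rightarrow> real) \<Rightarrow> ('d spacetime \<Rightarrow> real) \<Rightarrow> bool" where
  "visc_sol T G g u \<longleftrightarrow> visc_subsol T G g u \<and> visc_supersol T G g u"

section \<open>Standing assumptions\<close>

definition nonlinearity_differentiable :: "real \<Rightarrow> 'd::finite nonlinearity \<Rightarrow> bool" where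
  "nonlinearity_differentiable T G \<longleftrightarrow>
     (\<forall>t\<in>{0..T}. \<forall>x y z. \<forall>\<gamma>\<in>Sym.
        (\<lambda>(y, z, \<gamma>). G t x y z \<gamma>) differentiable (at (y, z, \<gamma>) within UNIV \<times> UNIV \<times> Sym))"

text \<open>
  Only symmetric matrices are admissible arguments of \<open>G\<close>, so derivatives in \<open>\<gamma>\<close> are taken
  within \<^const>\<open>Sym\<close>; requiring the representing matrix to be symmetric makes it unique.
\<close>

definition G_gamma ::
  "'d::finite nonlinearity \<Rightarrow> real \<Rightarrow> real^'d \<Rightarrow> real \<Rightarrow> real^'d \<Rightarrow> real^'d^'d \<Rightarrow> real^'d^'d" where
  "G_gamma G t x y z \<gamma> =
     (THE A. A \<in> Sym \<and> ((\<lambda>\<eta>. G t x y z \<eta>) has_derivative (\<lambda>\<eta>. A \<bullet> \<eta>)) (at \<gamma> within Sym))"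

definition S1 :: "real \<Rightarrow> 'd::finite nonlinearity \<Rightarrow> (real^'d \<Rightarrow> real) \<Rightarrow> bool" where
  "S1 T G g \<longleftrightarrow> bounded ((\<lambda>(t, x). G t x 0 0 0) ` strip T) \<and> bounded (range g)"

definition S2 :: "real \<Rightarrow> 'd::finite nonlinearity \<Rightarrow> (real^'d \<Rightarrow> real) \<Rightarrow> bool" where
  "S2 T G g \<longleftrightarrow>
     (\<forall>x y z. \<forall>\<gamma>\<in>Sym. continuous_on {0..T} (\<lambda>t. G t x y z \<gamma>)) \<and>
     (\<exists>L. \<forall>t\<in>{0..T}.
        L-lipschitz_on (UNIV \<times> UNIV \<times> UNIV \<times> Sym) (\<lambda>(x, y, z, \<gamma>). G t x y z \<gamma>)) \<and>
     (\<exists>L. L-lipschitz_on UNIV g)"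

definition S3 :: "real \<Rightarrow> 'd::finite nonlinearity \<Rightarrow> bool" where
  "S3 T G \<longleftrightarrow>
     (\<forall>t\<in>{0..T}. \<forall>x y z. \<forall>\<gamma>\<in>Sym. \<forall>\<eta>\<in>Sym. mat_le \<gamma> \<eta> \<longrightarrow> G t x y z \<gamma> \<le> G t x y z \<eta>)"

definition S4 :: "real \<Rightarrow> 'd::finite nonlinearity \<Rightarrow> (real^'d \<Rightarrow> real) \<Rightarrow> bool" where
  "S4 T G g \<longleftrightarrow>
     (\<forall>u1 u2. bounded (u1 ` strip T) \<and> bounded (u2 ` strip T) \<and>
        visc_subsol T G g u1 \<and> visc_supersol T G g u2 \<longrightarrow> (\<forall>q\<in>strip T. u1 q \<le> u2 q))"

section \<open>The scheme\<close>

text \<open>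
  The scheme depends on the random variables \<open>\<xi>\<close> only through their laws, which have finite support;
  expectations of arbitrary functions of \<open>\<xi>\<close> are therefore finite sums.
\<close>

definition xi_component :: "real \<Rightarrow> real pmf" where
  "xi_component p = pmf_of_list [(1 / sqrt p, p / 2), (- 1 / sqrt p, p / 2), (0, 1 - p)]"

definition xi_law :: "real \<Rightarrow> (real^'d::finite) pmf" where
  "xi_law p = map_pmf vec_lambda (Pi_pmf UNIV 0 (\<lambda>_. xi_component p))"

definition K1 :: "real^'d::finite^'d \<Rightarrow> real \<Rightarrow> real^'d \<Rightarrow> real^'d" where
  "K1 s h \<xi> = (1 / sqrt h) *\<^sub>R (transpose (matrix_inv s) *v \<xi>)"

definition K2 :: "real^'d::finite^'d \<Rightarrow> real \<Rightarrow> real \<Rightarrow> real^'d \<Rightarrow> real^'d^'d" where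
  "K2 s p h \<xi> = (1 / ((1 - p) * h)) *\<^sub>R
     (transpose (matrix_inv s) **
      ((1 - p) *\<^sub>R outer \<xi> - (1 - 3 * p) *\<^sub>R diag_part (outer \<xi>) - (2 * p) *\<^sub>R mat 1) **
      matrix_inv s)"

text \<open>In the following, \<open>s\<close> and \<open>p\<close> stand for the values of \<open>\<sigma>\<^sub>0\<close> and \<open>p\<close> at the point \<open>(t, x)\<close>.\<close>

definition D0 :: "real^'d::finite^'d \<Rightarrow> real \<Rightarrow> real \<Rightarrow> (real^'d \<Rightarrow> real) \<Rightarrow> real^'d \<Rightarrow> real" where
  "D0 s p h \<phi> x = measure_pmf.expectation (xi_law p) (\<lambda>\<xi>. \<phi> (x + sqrt h *\<^sub>R (s *v \<xi>)))"

definition D1 :: "real^'d::finite^'d \<Rightarrow> real \<Rightarrow> real \<Rightarrow> (real^'d \<Rightarrow> real) \<Rightarrow> real^'d \<Rightarrow> real^'d" where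
  "D1 s p h \<phi> x =
     measure_pmf.expectation (xi_law p) (\<lambda>\<xi>. \<phi> (x + sqrt h *\<^sub>R (s *v \<xi>)) *\<^sub>R K1 s h \<xi>)"

definition D2 :: "real^'d::finite^'d \<Rightarrow> real \<Rightarrow> real \<Rightarrow> (real^'d \<Rightarrow> real) \<Rightarrow> real^'d \<Rightarrow> real^'d^'d" where
  "D2 s p h \<phi> x =
     measure_pmf.expectation (xi_law p) (\<lambda>\<xi>. \<phi> (x + sqrt h *\<^sub>R (s *v \<xi>)) *\<^sub>R K2 s p h \<xi>)"

definition F_of :: "'d::finite nonlinearity \<Rightarrow> ('d spacetime \<Rightarrow> real^'d^'d) \<Rightarrow> 'd nonlinearity" where
  "F_of G \<sigma>0 t x y z \<gamma> =
     G t x y z \<gamma> - 1 / 2 * ((\<sigma>0 (t, x) ** transpose (\<sigma>0 (t, x))) \<bullet> \<gamma>)"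

definition T_op ::
  "'d::finite nonlinearity \<Rightarrow> ('d spacetime \<Rightarrow> real^'d^'d) \<Rightarrow> ('d spacetime \<Rightarrow> real) \<Rightarrow>
   real \<Rightarrow> real \<Rightarrow> (real^'d \<Rightarrow> real) \<Rightarrow> real^'d \<Rightarrow> real" where
  "T_op G \<sigma>0 p t h \<phi> x =
     D0 (\<sigma>0 (t, x)) (p (t, x)) h \<phi> x +
     h * F_of G \<sigma>0 t x (D0 (\<sigma>0 (t, x)) (p (t, x)) h \<phi> x)
                       (D1 (\<sigma>0 (t, x)) (p (t, x)) h \<phi> x)
                       (D2 (\<sigma>0 (t, x)) (p (t, x)) h \<phi> x)"

definition grid :: "real \<Rightarrow> nat \<Rightarrow> nat \<Rightarrow> real" where
  "grid T n i = real i * (T / real n)"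

text \<open>
  \<open>is_scheme T G g \<sigma>0 p n u\<close>: \<open>u\<close> is the approximating solution with step \<open>h = T / n\<close>.  The
  backward recursion determines \<open>u\<close> on \<^term>\<open>strip T\<close>; existence is shown below.
\<close>

definition is_scheme ::
  "real \<Rightarrow> 'd::finite nonlinearity \<Rightarrow> (real^'d \<Rightarrow> real) \<Rightarrow> ('d spacetime \<Rightarrow> real^'d^'d) \<Rightarrow>
   ('d spacetime \<Rightarrow> real) \<Rightarrow> nat \<Rightarrow> ('d spacetime \<Rightarrow> real) \<Rightarrow> bool" where
  "is_scheme T G g \<sigma>0 p n u \<longleftrightarrow>
     (\<forall>x. u (T, x) = g x) \<and>
     (\<forall>i\<in>{1..n}. \<forall>t\<in>{grid T n (i - 1)..<grid T n i}. \<forall>x.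
        u (t, x) = T_op G \<sigma>0 p t (grid T n i - t) (\<lambda>y. u (grid T n i, y)) x)"

lemma is_scheme_exists:
  assumes T: "T > 0" and n: "n \<ge> 1"
  shows "\<exists>u. is_scheme T G g \<sigma>0 p n u"
proof -
  let ?t = "grid T n"
  define W where "W = rec_nat g (\<lambda>k w.
    T_op G \<sigma>0 p (?t (n - Suc k)) (?t (n - k) - ?t (n - Suc k)) w)"
  have W0: "W 0 = g" by (simp add: W_def)
  have WS: "W (Suc k) = T_op G \<sigma>0 p (?t (n - Suc k)) (?t (n - k) - ?t (n - Suc k)) (W k)" for k
    by (simp add: W_def)
  define ix where "ix t = nat \<lfloor>t * real n / T\<rfloor> + 1" for t
  define u where "u = (\<lambda>(t, x). if t = T then g x
     else T_op G \<sigma>0 p t (?t (ix t) - t) (W (n - ix t)) x)"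
  have tn: "?t n = T" using n by (simp add: grid_def)
  have tlt: "?t i < ?t j" if "i < j" for i j
    using T n that by (simp add: grid_def divide_strict_right_mono mult_strict_right_mono)
  have ix: "ix t = i" if "1 \<le> i" "?t (i - 1) \<le> t" "t < ?t i" for i t
  proof -
    have "real (i - 1) \<le> t * real n / T" "t * real n / T < real i"
      using that T n by (simp_all add: grid_def field_simps)
    then have "\<lfloor>t * real n / T\<rfloor> = int (i - 1)"
      using that(1) by (intro floor_unique) (auto simp: of_nat_diff)
    then show ?thesis using that(1) by (simp add: ix_def)
  qed
  have node: "u (?t i, x) = W (n - i) x" if "i \<le> n" for i x
  proof (cases "i = n")
    case True
    then show ?thesis by (simp add: u_def tn W0)
  next
    case False
    then have i: "i < n" using that by simp
    have "ix (?t i) = Suc i" using tlt[of i "Suc i"] by (intro ix) auto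
    moreover have "?t i \<noteq> T" using tlt[OF i] tn by simp
    moreover have "n - i = Suc (n - Suc i)" using i by simp
    ultimately show ?thesis using i by (simp add: u_def WS)
  qed
  have "is_scheme T G g \<sigma>0 p n u"
    unfolding is_scheme_def
  proof (intro conjI allI ballI)
    fix x show "u (T, x) = g x" by (simp add: u_def)
  next
    fix i t x
    assume i: "i \<in> {1..n}" and t: "t \<in> {?t (i - 1)..<?t i}"
    have "?t i \<le> T" using tlt[of i n] tn i by (cases "i = n") auto
    then have "t \<noteq> T" using t by auto
    moreover have "ix t = i" using i t by (intro ix) auto
    moreover have "(\<lambda>y. u (?t i, y)) = W (n - i)" using node i by auto
    ultimately show "u (t, x) = T_op G \<sigma>0 p t (?t i - t) (\<lambda>y. u (?t i, y)) x"
      by (simp add: u_def)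
  qed
  then show ?thesis by blast
qed

section \<open>The monotonicity assumption\<close>

definition Gtilde ::
  "'d::finite nonlinearity \<Rightarrow> ('d spacetime \<Rightarrow> real^'d^'d) \<Rightarrow>
   real \<Rightarrow> real^'d \<Rightarrow> real \<Rightarrow> real^'d \<Rightarrow> real^'d^'d \<Rightarrow> real^'d^'d" where
  "Gtilde G \<sigma>0 t x y z \<gamma> =
     matrix_inv (\<sigma>0 (t, x)) ** G_gamma G t x y z \<gamma> ** transpose (matrix_inv (\<sigma>0 (t, x)))"

text \<open>
  Suprema and infima are extended reals, so that \<open>inf \<emptyset> = \<infinity>\<close> and no bound is met through an
  unspecified real value.  The assumptions \<open>M1\<close> and \<open>M2\<close> force \<open>alpha_lo\<close> to be positive and finite and \<open>theta\<close> to be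
  finite at every point, so the conversions to reals below do not discard an infinite value.
\<close>

definition alpha_lo ::
  "'d::finite nonlinearity \<Rightarrow> ('d spacetime \<Rightarrow> real^'d^'d) \<Rightarrow> real \<Rightarrow> real^'d \<Rightarrow> ereal" where
  "alpha_lo G \<sigma>0 t x = Sup (ereal ` {\<alpha>. 0 < \<alpha> \<and>
     (\<forall>y z. \<forall>\<gamma>\<in>Sym. mat_le (\<alpha> *\<^sub>R mat 1) (diag_part (Gtilde G \<sigma>0 t x y z \<gamma>)))})"

definition alpha_hi ::
  "'d::finite nonlinearity \<Rightarrow> ('d spacetime \<Rightarrow> real^'d^'d) \<Rightarrow> real \<Rightarrow> real^'d \<Rightarrow> ereal" where
  "alpha_hi G \<sigma>0 t x = Inf (ereal ` {\<alpha>. 0 < \<alpha> \<and>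
     (\<forall>y z. \<forall>\<gamma>\<in>Sym. mat_le (diag_part (Gtilde G \<sigma>0 t x y z \<gamma>)) (\<alpha> *\<^sub>R mat 1))})"

definition Lam ::
  "'d::finite nonlinearity \<Rightarrow> ('d spacetime \<Rightarrow> real^'d^'d) \<Rightarrow> real \<Rightarrow> real^'d \<Rightarrow> real" where
  "Lam G \<sigma>0 t x = real_of_ereal (alpha_hi G \<sigma>0 t x / alpha_lo G \<sigma>0 t x)"

definition theta ::
  "'d::finite nonlinearity \<Rightarrow> ('d spacetime \<Rightarrow> real^'d^'d) \<Rightarrow> real \<Rightarrow> real^'d \<Rightarrow> ereal" where
  "theta G \<sigma>0 t x = Inf (ereal ` {\<theta>. 0 \<le> \<theta> \<and>
     (\<forall>y z. \<forall>\<gamma>\<in>Sym. mat_le (diag_part (Gtilde G \<sigma>0 t x y z \<gamma>))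
                              ((1 + \<theta>) *\<^sub>R Gtilde G \<sigma>0 t x y z \<gamma>))})"

definition alpha_p ::
  "'d::finite nonlinearity \<Rightarrow> ('d spacetime \<Rightarrow> real^'d^'d) \<Rightarrow> real \<Rightarrow> real \<Rightarrow> real^'d \<Rightarrow> real" where
  "alpha_p G \<sigma>0 p t x = (let \<theta> = real_of_ereal (theta G \<sigma>0 t x) in
     (p * (2 + 3 * \<theta>) - \<theta>) / (p * (1 + \<theta>)))"

definition c_p ::
  "'d::finite nonlinearity \<Rightarrow> ('d spacetime \<Rightarrow> real^'d^'d) \<Rightarrow> real \<Rightarrow> real \<Rightarrow> real^'d \<Rightarrow> real" where
  "c_p G \<sigma>0 p t x = sqrt (2 * p * Lam G \<sigma>0 t x + alpha_p G \<sigma>0 p t x - 2 * p)"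

definition lambda_p ::
  "'d::finite nonlinearity \<Rightarrow> ('d spacetime \<Rightarrow> real^'d^'d) \<Rightarrow> real \<Rightarrow> real \<Rightarrow> real^'d \<Rightarrow> real" where
  "lambda_p G \<sigma>0 p t x = (let d = real CARD('d); c = c_p G \<sigma>0 p t x in
     sqrt p * ((1 - p + p * d) * c - 2 * p * d * Lam G \<sigma>0 t x / c) *
     (sqrt (real_of_ereal (alpha_lo G \<sigma>0 t x)) / norm (matrix_inv (\<sigma>0 (t, x)))))"

definition p_range ::
  "'d::finite nonlinearity \<Rightarrow> ('d spacetime \<Rightarrow> real^'d^'d) \<Rightarrow> real \<Rightarrow> real^'d \<Rightarrow> real set" where
  "p_range G \<sigma>0 t x = (let \<theta> = real_of_ereal (theta G \<sigma>0 t x) in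
     {\<theta> / (2 * (1 + \<theta>))..1 / 3} \<inter> {0<..1 / 3})"

definition lambda_star ::
  "real \<Rightarrow> 'd::finite nonlinearity \<Rightarrow> ('d spacetime \<Rightarrow> real^'d^'d) \<Rightarrow> ereal" where
  "lambda_star T G \<sigma>0 =
     (INF (t, x)\<in>strip T. SUP p\<in>p_range G \<sigma>0 t x. ereal (lambda_p G \<sigma>0 p t x))"

definition admissible_pair ::
  "real \<Rightarrow> ('d::finite spacetime \<Rightarrow> real^'d^'d) \<Rightarrow> ('d spacetime \<Rightarrow> real) \<Rightarrow> bool" where
  "admissible_pair T \<sigma>0 p \<longleftrightarrow>
     (\<forall>q\<in>strip T. invertible (\<sigma>0 q) \<and> 0 < p q \<and> p q < 1) \<and>
     bounded (\<sigma>0 ` strip T) \<and>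
     bounded ((\<lambda>q. matrix_inv (\<sigma>0 q)) ` strip T) \<and>
     bounded ((\<lambda>q. 1 / p q) ` strip T)"

definition M1 ::
  "real \<Rightarrow> 'd::finite nonlinearity \<Rightarrow> ('d spacetime \<Rightarrow> real^'d^'d) \<Rightarrow> bool" where
  "M1 T G \<sigma>0 \<longleftrightarrow> (\<forall>(t, x)\<in>strip T. theta G \<sigma>0 t x \<le> 2) \<and> 0 < lambda_star T G \<sigma>0"

definition M2 ::
  "real \<Rightarrow> 'd::finite nonlinearity \<Rightarrow> ('d spacetime \<Rightarrow> real^'d^'d) \<Rightarrow>
   ('d spacetime \<Rightarrow> real) \<Rightarrow> bool" where
  "M2 T G \<sigma>0 p \<longleftrightarrow> (\<forall>(t, x)\<in>strip T.
     p (t, x) \<in> p_range G \<sigma>0 t x \<and>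
     lambda_star T G \<sigma>0 / 2 \<le> ereal (lambda_p G \<sigma>0 (p (t, x)) t x) \<and>
     alpha_lo G \<sigma>0 t x = ereal (1 / (c_p G \<sigma>0 (p (t, x)) t x)\<^sup>2))"

end

theory Submission
  imports Defs
begin

text \<open>
  The convergence follows the method of Barles and Souganidis: the upper and lower half-relaxed
  limits of a monotone, stable and consistent scheme are a viscosity sub- and supersolution, and
  comparison forces them to coincide.

  Monotonicity is where Assumption (M) enters.  By the mean value theorem applied to \<open>G\<close>, the increment of
  \<open>T_op\<close> between two functions is the mean of their difference at \<open>x + \<surd>h \<sigma>\<^sub>0 \<xi>\<close> against the weight
  \<open>1 + h (G\<^sub>y + G\<^sub>z \<bullet> K\<^sub>1(\<xi>) + F\<^sub>\<gamma> \<bullet> K\<^sub>2(\<xi>))\<close>.  The second-order part of the weight is bounded below coordinate by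
  coordinate by \<open>\<lambda>\<^sub>p |\<sigma>\<^sub>0\<^sup>-\<^sup>1| / \<surd>p\<close>, up to the factor \<open>1 - p\<close>, and the lower-order terms are \<open>O(\<surd>h)\<close>.
  Consistency rests on the moments of \<open>\<xi>\<close>, for which \<open>K\<^sub>1\<close> and \<open>K\<^sub>2\<close> reproduce gradient and Hessian of
  quadratic functions exactly.
\<close>

section \<open>Smooth functions\<close>

text \<open>No regularity in (t, x) is available for \<open>\<sigma>0\<close> and \<open>p\<close>,
  so an approximating solution need not be semicontinuous and its gap to a test function need not
  attain its supremum. The limit argument therefore works with the supremum itself and needs a
  decrease that is uniform over a compact neighbourhood. A single step supplies a decrease
  proportional to its length, which can be arbitrarily small off the time grid; pairing it with the
  following full step repairs this. The support of \<xi> is bounded, so one step only sees values at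
  distance of order \<surd>h. Monotonicity is kept in this local form, and test functions are
  compared with the scheme on a small ball only, whatever their growth elsewhere. Since
  \<open>K2\<close> divides by h, consistency requires a Taylor remainder that is a small multiple
  of h, uniformly over bounded sets of base points and directions. The terminal inequality belongs
  to the notion of sub- and supersolution and is not inherited from \<open>g\<close> by a
  half-relaxed limit without further argument; a barrier provides it. Only upper limits are studied:
  lower ones are upper limits of the negated scheme.\<close>

lemma Ck_continuous: "Ck k f \<Longrightarrow> continuous_on UNIV f"
  by (cases k) (auto intro: differentiable_imp_continuous_on)

lemma smooth_continuous: "smooth f \<Longrightarrow> continuous_on UNIV f"
  using Ck_continuous unfolding smooth_def by blast

lemma smooth_has_derivative:
  assumes "smooth f"
  shows "(f has_derivative (\<lambda>v. dderiv f v q)) (at q)"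
proof -
  have "Ck (Suc 0) f" using assms unfolding smooth_def by blast
  then have "f differentiable (at q)" by (simp add: differentiable_on_def)
  then show ?thesis unfolding dderiv_def by (simp flip: frechet_derivative_works)
qed

lemma smooth_dderiv: "smooth f \<Longrightarrow> smooth (dderiv f v)"
  unfolding smooth_def by (metis Ck.simps(2))

lemma dderiv_eqI: "(f has_derivative D) (at q) \<Longrightarrow> dderiv f v q = D v"
  unfolding dderiv_def by (metis frechet_derivative_at)

lemma smooth_dderiv_linear: "smooth f \<Longrightarrow> linear (\<lambda>v. dderiv f v q)"
  using smooth_has_derivative has_derivative_linear by blast

lemma Ck_differentiable: "Ck (Suc k) f \<Longrightarrow> f differentiable (at q)"
  by (simp add: differentiable_on_def)

lemma Ck_has_derivative: "Ck (Suc k) f \<Longrightarrow> (f has_derivative (\<lambda>v. dderiv f v q)) (at q)"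
  using Ck_differentiable[of k f q] unfolding dderiv_def by (simp add: frechet_derivative_works)

text \<open>\<open>dderiv\<close> rests on a choice of derivative. Closure proofs exhibit a
  candidate family \<open>D\<close>, which uniqueness of the Frechet derivative identifies with
  \<open>dderiv\<close>.\<close>

lemma Ck_SucI:
  assumes "\<And>q. (f has_derivative D q) (at q)" "\<And>v. Ck k (\<lambda>q. D q v)"
  shows "Ck (Suc k) f"
proof -
  have "dderiv f v = (\<lambda>q. D q v)" for v using dderiv_eqI[OF assms(1)] by blast
  then show ?thesis using assms by (auto simp: differentiable_on_def differentiable_def)
qed

lemma Ck_add: "Ck k f \<Longrightarrow> Ck k g \<Longrightarrow> Ck k (\<lambda>q. f q + g q)"
proof (induction k arbitrary: f g)
  case (Suc k)
  show ?case
  proof (rule Ck_SucI)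
    show "((\<lambda>q. f q + g q) has_derivative (\<lambda>v. dderiv f v q + dderiv g v q)) (at q)" for q
      using Ck_has_derivative Suc.prems by (intro has_derivative_add) blast+
  qed (use Suc in auto)
qed (auto intro: continuous_intros)

lemma Ck_minus: "Ck k f \<Longrightarrow> Ck k (\<lambda>q. - f q)"
proof (induction k arbitrary: f)
  case (Suc k)
  show ?case
  proof (rule Ck_SucI)
    show "((\<lambda>q. - f q) has_derivative (\<lambda>v. - dderiv f v q)) (at q)" for q
      using Ck_has_derivative Suc.prems by (intro has_derivative_minus) blast
  qed (use Suc in auto)
qed (auto intro: continuous_intros)

lemma smooth_add: "smooth f \<Longrightarrow> smooth g \<Longrightarrow> smooth (\<lambda>q. f q + g q)"
  unfolding smooth_def using Ck_add by blast

lemma smooth_minus: "smooth f \<Longrightarrow> smooth (\<lambda>q. - f q)"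
  unfolding smooth_def using Ck_minus by blast

lemma dderiv_add:
  "smooth f \<Longrightarrow> smooth g \<Longrightarrow> dderiv (\<lambda>q. f q + g q) v = (\<lambda>q. dderiv f v q + dderiv g v q)"
  by (intro ext dderiv_eqI has_derivative_add smooth_has_derivative)

lemma dderiv_minus: "smooth f \<Longrightarrow> dderiv (\<lambda>q. - f q) v = (\<lambda>q. - dderiv f v q)"
  by (intro ext dderiv_eqI has_derivative_minus smooth_has_derivative)

lemma smooth_const: "smooth (\<lambda>q. c)"
proof -
  have "Ck k (\<lambda>q::'a. c)" for k c
  proof (induction k arbitrary: c)
    case (Suc k)
    show ?case by (rule Ck_SucI[where D = "\<lambda>_ _. 0"]) (use Suc in auto)
  qed (auto intro: continuous_intros)
  then show ?thesis unfolding smooth_def by blast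
qed

text \<open>A coinductive principle: differentiating once must lead back to smooth functions.
  \<open>Ck (Suc k)\<close> speaks of derivatives only, so its inclusion in \<open>Ck k\<close>
  needs an induction of its own.\<close>

lemma smoothI:
  assumes "\<And>q. (f has_derivative D q) (at q)" "\<And>v. smooth (\<lambda>q. D q v)"
  shows "smooth f"
  unfolding smooth_def
proof
  fix k
  have "Ck (Suc k) f" using assms unfolding smooth_def by (intro Ck_SucI) auto
  then show "Ck k f"
  proof (induction k arbitrary: f)
    case 0
    then show ?case using Ck_continuous Ck.simps(1) by blast
  qed (metis Ck.simps(2))
qed

lemma smooth_bounded_linear:
  assumes "bounded_linear l" shows "smooth (\<lambda>q. l q)"
  by (rule smoothI[where D = "\<lambda>_. l"])
    (auto intro: smooth_const bounded_linear_imp_has_derivative assms)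

text \<open>The second-order equality of mixed partials follows from applying the mean value theorem
  to the double difference in both orders.\<close>

lemma double_difference_mvt:
  fixes f :: "'a::euclidean_space \<Rightarrow> real"
  assumes "smooth f" "s > 0"
  obtains a b where "0 < a" "a < s" "0 < b" "b < s"
    "f (q + s *\<^sub>R u + s *\<^sub>R v) - f (q + s *\<^sub>R u) - f (q + s *\<^sub>R v) + f q
       = s * s * dderiv (dderiv f u) v (q + a *\<^sub>R u + b *\<^sub>R v)"
proof -
  define g where "g = (\<lambda>a. f (q + a *\<^sub>R u + s *\<^sub>R v) - f (q + a *\<^sub>R u))"
  have d: "((\<lambda>a. F (r + a *\<^sub>R w)) has_real_derivative dderiv F w (r + a *\<^sub>R w)) (at a)"
    if "smooth F" for F a r and w :: 'a
  proof -
    have "((\<lambda>a. F (r + a *\<^sub>R w)) has_derivative (\<lambda>h. dderiv F (h *\<^sub>R w) (r + a *\<^sub>R w))) (at a)"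
      by (rule has_derivative_compose[OF _ smooth_has_derivative[OF that]])
        (auto intro!: derivative_eq_intros)
    moreover have "(\<lambda>h. dderiv F (h *\<^sub>R w) (r + a *\<^sub>R w)) = (*) (dderiv F w (r + a *\<^sub>R w))"
      using linear_scale[OF smooth_dderiv_linear[OF that]] by (auto simp: fun_eq_iff)
    ultimately show ?thesis by (simp add: has_field_derivative_def)
  qed
  have dg: "(g has_real_derivative
      dderiv f u (q + a *\<^sub>R u + s *\<^sub>R v) - dderiv f u (q + a *\<^sub>R u)) (at a)" for a
  proof -
    have "((\<lambda>a. f ((q + s *\<^sub>R v) + a *\<^sub>R u)) has_real_derivative
       dderiv f u ((q + s *\<^sub>R v) + a *\<^sub>R u)) (at a)"
      by (rule d[OF assms(1)])
    moreover have "(q + s *\<^sub>R v) + a *\<^sub>R u = q + a *\<^sub>R u + s *\<^sub>R v" for a by simp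
    ultimately show ?thesis unfolding g_def
      by (intro derivative_intros d[OF assms(1)]) simp
  qed
  obtain a where a: "0 < a" "a < s"
    "g s - g 0 = (s - 0) * (dderiv f u (q + a *\<^sub>R u + s *\<^sub>R v) - dderiv f u (q + a *\<^sub>R u))"
    using MVT2[OF assms(2) dg] by blast
  obtain b where b: "0 < b" "b < s"
    "dderiv f u (q + a *\<^sub>R u + s *\<^sub>R v) - dderiv f u (q + a *\<^sub>R u + 0 *\<^sub>R v)
      = (s - 0) * dderiv (dderiv f u) v (q + a *\<^sub>R u + b *\<^sub>R v)"
    using MVT2[OF assms(2), of "\<lambda>b. dderiv f u (q + a *\<^sub>R u + b *\<^sub>R v)"
        "\<lambda>b. dderiv (dderiv f u) v (q + a *\<^sub>R u + b *\<^sub>R v)"]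
      d[OF smooth_dderiv[OF assms(1)]] by blast
  show thesis
  proof (rule that[OF a(1,2) b(1,2)])
    show "f (q + s *\<^sub>R u + s *\<^sub>R v) - f (q + s *\<^sub>R u) - f (q + s *\<^sub>R v) + f q
       = s * s * dderiv (dderiv f u) v (q + a *\<^sub>R u + b *\<^sub>R v)"
      using a(3) b(3) by (simp add: g_def algebra_simps)
  qed
qed

lemma dderiv_commute:
  fixes f :: "'a::euclidean_space \<Rightarrow> real"
  assumes "smooth f"
  shows "dderiv (dderiv f u) v q = dderiv (dderiv f v) u q"
proof -
  define S where "S n = 1 / real (Suc n)" for n
  have S: "S n > 0" for n by (simp add: S_def)
  have S0: "S \<longlonglongrightarrow> 0" unfolding S_def by (rule LIMSEQ_Suc[OF lim_1_over_n])
  let ?R = "\<lambda>u v n. (f (q + S n *\<^sub>R u + S n *\<^sub>R v) - f (q + S n *\<^sub>R u) - f (q + S n *\<^sub>R v) + f q) / (S n * S n)"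
  have lim: "?R u v \<longlonglongrightarrow> dderiv (dderiv f u) v q" for u v
  proof -
    have "\<exists>a b. 0 < a \<and> a < S n \<and> 0 < b \<and> b < S n \<and>
        ?R u v n = dderiv (dderiv f u) v (q + a *\<^sub>R u + b *\<^sub>R v)" for n
    proof -
      obtain a b where "0 < a" "a < S n" "0 < b" "b < S n" "f (q + S n *\<^sub>R u + S n *\<^sub>R v) - f (q + S n *\<^sub>R u) - f (q + S n *\<^sub>R v) + f q
       = S n * S n * dderiv (dderiv f u) v (q + a *\<^sub>R u + b *\<^sub>R v)"
        using double_difference_mvt[OF assms S[of n]] by metis
      then show ?thesis using S[of n] by (intro exI[of _ a] exI[of _ b]) simp
    qed
    then obtain a b where ab: "\<And>n. 0 < a n" "\<And>n. a n < S n" "\<And>n. 0 < b n" "\<And>n. b n < S n"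
        "\<And>n. ?R u v n = dderiv (dderiv f u) v (q + a n *\<^sub>R u + b n *\<^sub>R v)" by metis
    have "a \<longlonglongrightarrow> 0" "b \<longlonglongrightarrow> 0"
      using ab by (auto intro!: tendsto_sandwich[OF _ _ tendsto_const S0] always_eventually
        less_imp_le)
    then have "(\<lambda>n. q + a n *\<^sub>R u + b n *\<^sub>R v) \<longlonglongrightarrow> q + 0 *\<^sub>R u + 0 *\<^sub>R v"
      by (intro tendsto_intros)
    moreover have "isCont (dderiv (dderiv f u) v) q"
      using smooth_continuous[OF smooth_dderiv[OF smooth_dderiv[OF assms]]]
      by (simp add: continuous_on_eq_continuous_at)
    ultimately show ?thesis unfolding ab(5)
      using isCont_tendsto_compose[where g = "dderiv (dderiv f u) v"] by fastforce
  qed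
  \<comment> \<open>The double difference is symmetric in \<open>u\<close> and \<open>v\<close>, so
    both mixed derivatives are limits of one sequence.\<close>
  have "?R u v = ?R v u" by (intro ext) (simp add: algebra_simps)
  with lim[of v u] have "?R u v \<longlonglongrightarrow> dderiv (dderiv f v) u q" by (simp only:)
  with lim[of u v] show ?thesis by (rule LIMSEQ_unique)
qed

lemma hess_Sym: "smooth f \<Longrightarrow> hess f q \<in> Sym"
  by (simp add: Sym_def hess_def transpose_def vec_eq_iff dderiv_commute)

lemma dt_eq_dderiv: "dt f = dderiv f (1, 0)"
  by (simp add: fun_eq_iff dt_def)

lemma smooth_dt: "smooth f \<Longrightarrow> smooth (dt f)"
  by (simp add: dt_eq_dderiv smooth_dderiv)

lemma continuous_on_grad: "smooth f \<Longrightarrow> continuous_on UNIV (grad f)"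
  unfolding grad_def by (intro continuous_on_vec_lambda smooth_continuous smooth_dderiv)

lemma continuous_on_hess: "smooth f \<Longrightarrow> continuous_on UNIV (hess f)"
  unfolding hess_def by (intro continuous_on_vec_lambda smooth_continuous smooth_dderiv)

lemma dderiv_spacetime:
  fixes f :: "'d::finite spacetime \<Rightarrow> real"
  assumes "smooth f"
  shows "dderiv f (s, w) q = s * dt f q + grad f q \<bullet> w"
proof -
  note l = smooth_dderiv_linear[OF assms, of q]
  have "(s, w) = s *\<^sub>R (1, 0) + (\<Sum>i\<in>UNIV. (w $ i) *\<^sub>R (0, axis i 1))"
    by (auto simp: prod_eq_iff fst_sum snd_sum vec_eq_iff axis_def if_distrib cong: if_cong)
  then have "dderiv f (s, w) q = dderiv f (s *\<^sub>R (1, 0) + (\<Sum>i\<in>UNIV. (w $ i) *\<^sub>R (0, axis i 1))) q"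
    by (rule arg_cong)
  also have "\<dots> = s * dt f q + (\<Sum>i\<in>UNIV. w $ i * dderiv f (0, axis i 1) q)"
    by (simp only: linear_add[OF l] linear_sum[OF l] linear_scale[OF l] real_scaleR_def dt_def)
  also have "(\<Sum>i\<in>UNIV. w $ i * dderiv f (0, axis i 1) q) = grad f q \<bullet> w"
    by (simp add: grad_def inner_vec_def mult.commute)
  finally show ?thesis .
qed

lemma dderiv_dderiv_hess:
  fixes f :: "'d::finite spacetime \<Rightarrow> real"
  assumes "smooth f"
  shows "dderiv (dderiv f (0, w)) (0, w) q = w \<bullet> (hess f q *v w)"
proof -
  have "dderiv (dderiv f (0, w)) (0, w) q = (\<Sum>i\<in>UNIV. dderiv (dderiv f (0, w)) (0, axis i 1) q * w $ i)"
    by (subst dderiv_spacetime[OF smooth_dderiv[OF assms]]) (simp add: grad_def inner_vec_def)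
  also have "\<dots> = (\<Sum>i\<in>UNIV. w $ i * (\<Sum>j\<in>UNIV. hess f q $ i $ j * w $ j))"
  proof (rule sum.cong)
    fix i :: 'd
    \<comment> \<open>Only the outer direction of an iterated derivative can be expanded by
      linearity; the exchange makes \<open>w\<close> the outer one.\<close>
    have "dderiv (dderiv f (0, w)) (0, axis i 1) q = dderiv (dderiv f (0, axis i 1)) (0, w) q"
      by (rule dderiv_commute[OF assms])
    also have "\<dots> = (\<Sum>j\<in>UNIV. dderiv (dderiv f (0, axis i 1)) (0, axis j 1) q * w $ j)"
      by (subst dderiv_spacetime[OF smooth_dderiv[OF assms]]) (simp add: grad_def inner_vec_def)
    also have "\<dots> = (\<Sum>j\<in>UNIV. hess f q $ i $ j * w $ j)"
      unfolding hess_def by (simp only: vec_lambda_beta dderiv_commute[OF assms, of "(0, axis i 1)"])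
    finally show "dderiv (dderiv f (0, w)) (0, axis i 1) q * w $ i =
        w $ i * (\<Sum>j\<in>UNIV. hess f q $ i $ j * w $ j)" by simp
  qed simp
  also have "\<dots> = w \<bullet> (hess f q *v w)"
    by (simp add: inner_vec_def matrix_vector_mult_def)
  finally show ?thesis .
qed

text \<open>On the parabola \<open>s \<mapsto> (t + s\<^sup>2, x + s w)\<close> the time increment \<open>h = s\<^sup>2\<close> is of second order, so
  the ordinary Taylor formula of order two yields the parabolic expansion.\<close>

lemma parabolic_taylor:
  fixes f :: "'d::finite spacetime \<Rightarrow> real"
  assumes f: "smooth f" and "\<delta> > 0"
  obtains h1 where "h1 > 0"
    "\<And>t x w h. \<bar>t\<bar> \<le> R \<Longrightarrow> norm x \<le> R \<Longrightarrow> norm w \<le> C \<Longrightarrow> 0 < h \<Longrightarrow> h < h1 \<Longrightarrow>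
      \<bar>f (t + h, x + sqrt h *\<^sub>R w) - (f (t, x) + sqrt h * (grad f (t, x) \<bullet> w) +
         h * (dt f (t, x) + (w \<bullet> (hess f (t, x) *v w)) / 2))\<bar> \<le> \<delta> * h"
proof -
  define \<gamma> where "\<gamma> q w s = q + (s\<^sup>2, s *\<^sub>R w)" for q :: "'d spacetime" and w s
  \<comment> \<open>The second derivative of \<open>f\<close> along the parabola.\<close>
  define H where "H = (\<lambda>(q, w, s). 2 * dt f (\<gamma> q w s) + 4 * s\<^sup>2 * dt (dt f) (\<gamma> q w s) +
     4 * s * (grad (dt f) (\<gamma> q w s) \<bullet> w) + w \<bullet> (hess f (\<gamma> q w s) *v w))"
  \<comment> \<open>Uniform continuity of \<open>H\<close> on this compact set makes the threshold
    for h independent of the base point and of \<open>w\<close>; s stays in [0,1] because h <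
    1.\<close>
  define K where "K = (cball (0::real) R \<times> cball (0::real^'d) R) \<times> cball (0::real^'d) C \<times> {0..(1::real)}"
  have d\<gamma>: "(\<gamma> q w has_derivative (\<lambda>r. (2 * s * r, r *\<^sub>R w))) (at s)" for q w s
    unfolding \<gamma>_def by (auto intro!: derivative_eq_intros ext simp: prod_eq_iff)
  have d1: "((\<lambda>s. F (\<gamma> q w s)) has_real_derivative (2 * s * dt F (\<gamma> q w s) + grad F (\<gamma> q w s) \<bullet> w)) (at s)"
    if "smooth F" for F q w s
  proof -
    have "((\<lambda>s. F (\<gamma> q w s)) has_derivative (\<lambda>r. dderiv F (2 * s * r, r *\<^sub>R w) (\<gamma> q w s))) (at s)"
      by (rule has_derivative_compose[OF d\<gamma> smooth_has_derivative[OF that]])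
    moreover have "(\<lambda>r. dderiv F (2 * s * r, r *\<^sub>R w) (\<gamma> q w s)) =
        (*) (2 * s * dt F (\<gamma> q w s) + grad F (\<gamma> q w s) \<bullet> w)"
      by (simp add: fun_eq_iff dderiv_spacetime[OF that] algebra_simps)
    ultimately show ?thesis by (simp add: has_field_derivative_def)
  qed
  have gw: "grad f q \<bullet> w = dderiv f (0, w) q" for q w
    by (simp add: dderiv_spacetime[OF f])
  have d2: "((\<lambda>s. 2 * s * dt f (\<gamma> q w s) + grad f (\<gamma> q w s) \<bullet> w) has_real_derivative H (q, w, s)) (at s)"
    for q w s
  proof -
    have cm: "dt (dderiv f (0, w)) r = grad (dt f) r \<bullet> w" for r
      using dderiv_commute[OF f] dderiv_spacetime[OF smooth_dt[OF f], of 0 w r]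
      by (simp add: dt_eq_dderiv)
    have hs: "grad (dderiv f (0, w)) r \<bullet> w = w \<bullet> (hess f r *v w)" for r
      using dderiv_dderiv_hess[OF f, of w r] dderiv_spacetime[OF smooth_dderiv[OF f], of "(0,w)" 0 w r]
      by simp
    show ?thesis unfolding gw
      by (rule derivative_eq_intros d1[OF smooth_dt[OF f]] d1[OF smooth_dderiv[OF f]] refl)+
        (simp add: H_def cm hs algebra_simps power2_eq_square)
  qed
  have "continuous_on UNIV H"
  proof -
    have c\<gamma>: "continuous_on UNIV (\<lambda>(q, w, s). \<gamma> q w s)"
      unfolding \<gamma>_def case_prod_unfold by (intro continuous_intros)
    have c: "continuous_on UNIV (\<lambda>(q, w, s). F (\<gamma> q w s))"
      if "continuous_on UNIV F" for F :: "'d spacetime \<Rightarrow> 'z::topological_space"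
      using continuous_on_compose2[OF that c\<gamma>] by (simp add: case_prod_unfold)
    note cs = c[OF smooth_continuous[OF smooth_dt[OF f]]]
      c[OF smooth_continuous[OF smooth_dt[OF smooth_dt[OF f]]]]
      c[OF continuous_on_grad[OF smooth_dt[OF f]]]
      c[OF continuous_on_hess[OF f], unfolded case_prod_unfold]
    have "continuous_on UNIV (\<lambda>y. fst (snd y) \<bullet>
        (hess f (\<gamma> (fst y) (fst (snd y)) (snd (snd y))) *v fst (snd y)))"
      unfolding inner_vec_def matrix_vector_mult_def vec_lambda_beta inner_real_def
      by (intro continuous_intros cs(4))
    moreover have "continuous_on UNIV (\<lambda>y. 2 * dt f (\<gamma> (fst y) (fst (snd y)) (snd (snd y))) +
        4 * (snd (snd y))\<^sup>2 * dt (dt f) (\<gamma> (fst y) (fst (snd y)) (snd (snd y))) +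
        4 * snd (snd y) * (grad (dt f) (\<gamma> (fst y) (fst (snd y)) (snd (snd y))) \<bullet> fst (snd y)))"
      using cs(1-3) unfolding case_prod_unfold by (intro continuous_intros)
    ultimately show ?thesis
      unfolding H_def case_prod_unfold by (rule continuous_on_add[rotated])
  qed
  then have "continuous_on K H" by (rule continuous_on_subset) simp
  moreover have "compact K" unfolding K_def by (intro compact_Times) auto
  ultimately have "uniformly_continuous_on K H" by (rule compact_uniformly_continuous)
  then obtain d where d: "d > 0" "\<And>k k'. k \<in> K \<Longrightarrow> k' \<in> K \<Longrightarrow> dist k' k < d \<Longrightarrow> dist (H k') (H k) < \<delta>"
    using \<open>\<delta> > 0\<close> unfolding uniformly_continuous_on_def by meson
  show thesis
  proof
    show "min 1 (d\<^sup>2) > 0" using d by simp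
    fix t :: real and x w :: "real^'d" and h :: real
    assume a: "\<bar>t\<bar> \<le> R" "norm x \<le> R" "norm w \<le> C" "0 < h" "h < min 1 (d\<^sup>2)"
    let ?q = "(t, x)"
    define diff where "diff m = (if m = 0 then (\<lambda>s. f (\<gamma> ?q w s)) else
       if m = Suc 0 then (\<lambda>s. 2 * s * dt f (\<gamma> ?q w s) + grad f (\<gamma> ?q w s) \<bullet> w)
       else (\<lambda>s. H (?q, w, s)))" for m
    have sq: "0 < sqrt h" "sqrt h < 1" "sqrt h < d"
      using a d(1) by (auto simp: real_less_lsqrt)
    have "\<exists>s. 0 < s \<and> s < sqrt h \<and> f (\<gamma> ?q w (sqrt h)) =
       sum (\<lambda>m. (diff m 0 / fact m) * sqrt h ^ m) {..<2} + (diff 2 s / fact 2) * sqrt h ^ 2"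
      by (rule Maclaurin[where f = "\<lambda>s. f (\<gamma> ?q w s)"])
        (auto simp: a(4) sq diff_def less_Suc_eq numeral_2_eq_2 intro: d1[OF f] d2)
    then obtain s where s: "0 < s" "s < sqrt h" "f (\<gamma> ?q w (sqrt h)) =
       sum (\<lambda>m. (diff m 0 / fact m) * sqrt h ^ m) {..<2} + (diff 2 s / fact 2) * sqrt h ^ 2"
      by blast
    have e: "f (t + h, x + sqrt h *\<^sub>R w) = f ?q + sqrt h * (grad f ?q \<bullet> w) + H (?q, w, s) / 2 * h"
      using s(3) a(4) by (simp add: diff_def numeral_2_eq_2 \<gamma>_def zero_prod_def[symmetric])
    have "s \<le> 1" "s < d" using s sq by linarith+
    then have "dist (H (?q, w, s)) (H (?q, w, 0)) < \<delta>"
      by (intro d(2)) (use a s(1) in \<open>auto simp: K_def dist_Pair_Pair dist_norm\<close>)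
    moreover have "H (?q, w, 0) = 2 * dt f ?q + w \<bullet> (hess f ?q *v w)"
      by (simp add: H_def \<gamma>_def zero_prod_def[symmetric])
    ultimately have b: "\<bar>H (?q, w, s) - (2 * dt f ?q + w \<bullet> (hess f ?q *v w))\<bar> \<le> 2 * \<delta>"
      using \<open>\<delta> > 0\<close> by (simp add: dist_real_def)
    have e': "f (t + h, x + sqrt h *\<^sub>R w) - (f (t, x) + sqrt h * (grad f (t, x) \<bullet> w) +
         h * (dt f (t, x) + (w \<bullet> (hess f (t, x) *v w)) / 2))
        = (H (?q, w, s) - (2 * dt f ?q + w \<bullet> (hess f ?q *v w))) / 2 * h"
      unfolding e by (simp add: algebra_simps)
    show "\<bar>f (t + h, x + sqrt h *\<^sub>R w) - (f (t, x) + sqrt h * (grad f (t, x) \<bullet> w) +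
         h * (dt f (t, x) + (w \<bullet> (hess f (t, x) *v w)) / 2))\<bar> \<le> \<delta> * h"
      unfolding e' abs_mult using mult_right_mono[OF b, of h] a(4) by simp
  qed
qed

text \<open>One family for both auxiliary functions: the penalty around a touching point
  (\<open>b = 0\<close>, \<open>\<beta> = A = \<epsilon>\<close>) and the terminal barrier
  (\<open>b = - c\<close>, \<open>\<beta> = 0\<close>). The linear time term is not centred, so the
  barrier absorbs c T into \<open>a\<close>.\<close>

definition quad :: "real \<Rightarrow> real \<Rightarrow> real \<Rightarrow> real \<Rightarrow> 'd::finite spacetime \<Rightarrow> 'd spacetime \<Rightarrow> real" where
  "quad a b \<beta> A q0 q = a + b * fst q + \<beta> * (fst q - fst q0)\<^sup>2 + A * (norm (snd q - snd q0))\<^sup>2"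

lemma quad_has_derivative:
  "(quad a b \<beta> A q0 has_derivative
     (\<lambda>v. (b + 2 * \<beta> * (fst q - fst q0)) * fst v + 2 * A * ((snd q - snd q0) \<bullet> snd v))) (at q)"
  unfolding quad_def[abs_def] power2_norm_eq_inner
  by (auto intro!: derivative_eq_intros ext simp: algebra_simps inner_commute)

text \<open>Written as a constant plus a bounded linear map of \<open>q\<close>, the form from which
  smoothness and second derivatives are read off.\<close>

lemma dderiv_quad: "dderiv (quad a b \<beta> A q0) v =
    (\<lambda>q. ((b - 2 * \<beta> * fst q0) * fst v - 2 * A * (snd q0 \<bullet> snd v)) +
      (2 * \<beta> * fst v * fst q + 2 * A * (snd v \<bullet> snd q)))"
  by (rule ext, subst dderiv_eqI[OF quad_has_derivative])
    (simp add: algebra_simps inner_commute)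

lemma bounded_linear_spacetime:
  "bounded_linear (\<lambda>q::'d::finite spacetime. c * fst q + e * (w \<bullet> snd q))"
  by (intro bounded_linear_add bounded_linear_const_mult
      bounded_linear_compose[OF bounded_linear_inner_right bounded_linear_snd]
      bounded_linear_fst)

lemma smooth_quad: "smooth (quad a b \<beta> A q0)"
proof (rule smoothI)
  show "(quad a b \<beta> A q0 has_derivative (\<lambda>v. dderiv (quad a b \<beta> A q0) v q)) (at q)" for q
    using quad_has_derivative[of a b \<beta> A q0 q] unfolding dderiv_eqI[OF quad_has_derivative] .
  show "smooth (\<lambda>q. dderiv (quad a b \<beta> A q0) v q)" for v
    unfolding dderiv_quad by (intro smooth_add smooth_const smooth_bounded_linear bounded_linear_spacetime)
qed

lemma dt_quad: "dt (quad a b \<beta> A q0) q = b + 2 * \<beta> * (fst q - fst q0)"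
  by (simp add: dt_def dderiv_quad algebra_simps)

lemma grad_quad: "grad (quad a b \<beta> A q0) q = (2 * A) *\<^sub>R (snd q - snd q0)"
  by (simp add: grad_def dderiv_quad vec_eq_iff inner_axis inner_axis' algebra_simps)

lemma hess_quad: "hess (quad a b \<beta> A q0) q = (2 * A) *\<^sub>R mat 1"
proof -
  have d: "dderiv (\<lambda>q. c + (k * fst q + l * (v \<bullet> snd q))) u q = k * fst u + l * (v \<bullet> snd u)"
    for c k l and v :: "real^'d" and u q
    by (rule dderiv_eqI) (auto intro!: derivative_eq_intros)
  show ?thesis
    unfolding hess_def dderiv_quad d by (simp add: vec_eq_iff mat_def inner_axis_axis)
qed

lemma dt_add: "smooth f \<Longrightarrow> smooth g \<Longrightarrow> dt (\<lambda>q. f q + g q) q = dt f q + dt g q"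
  by (simp add: dt_def dderiv_add)

lemma grad_add: "smooth f \<Longrightarrow> smooth g \<Longrightarrow> grad (\<lambda>q. f q + g q) q = grad f q + grad g q"
  by (simp add: grad_def dderiv_add vec_eq_iff)

lemma hess_add: "smooth f \<Longrightarrow> smooth g \<Longrightarrow> hess (\<lambda>q. f q + g q) q = hess f q + hess g q"
  by (simp add: hess_def dderiv_add smooth_dderiv vec_eq_iff)

lemma dt_minus: "smooth f \<Longrightarrow> dt (\<lambda>q. - f q) q = - dt f q"
  by (simp add: dt_def dderiv_minus)

lemma grad_minus: "smooth f \<Longrightarrow> grad (\<lambda>q. - f q) q = - grad f q"
  by (simp add: grad_def dderiv_minus vec_eq_iff)

lemma hess_minus: "smooth f \<Longrightarrow> hess (\<lambda>q. - f q) q = - hess f q"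
  by (simp add: hess_def dderiv_minus smooth_dderiv vec_eq_iff)

section \<open>Frobenius norm and trace identities for matrices\<close>

lemma norm_matrix_vector_mult:
  fixes A :: "real^'n^'m"
  shows "norm (A *v x) \<le> norm A * norm x"
proof (rule power2_le_imp_le)
  have "(norm (A *v x))\<^sup>2 = (\<Sum>i\<in>UNIV. (A $ i \<bullet> x)\<^sup>2)"
    unfolding power2_norm_eq_inner inner_vec_def[of "A *v x"]
    by (simp add: matrix_mult_dot power2_eq_square)
  also have "\<dots> \<le> (\<Sum>i\<in>UNIV. (norm (A $ i))\<^sup>2 * (norm x)\<^sup>2)"
    by (intro sum_mono) (metis Cauchy_Schwarz_ineq2 power_mult_distrib power2_le_iff_abs_le norm_ge_zero
        mult_nonneg_nonneg)
  also have "\<dots> = (norm A * norm x)\<^sup>2"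
    by (simp add: power_mult_distrib power2_norm_eq_inner[of A] inner_vec_def[of A]
        flip: sum_distrib_right) (simp add: power2_norm_eq_inner)
  finally show "(norm (A *v x))\<^sup>2 \<le> (norm A * norm x)\<^sup>2" .
qed simp

lemma norm_transpose: "norm (transpose A) = norm (A :: real^'n^'m)"
  unfolding norm_eq_sqrt_inner inner_vec_def transpose_def by (simp, rule sum.swap)

text \<open>Each row of the product is \<open>transpose B\<close> applied to a row of
  \<open>A\<close>, so the vector estimate applies row by row.\<close>

lemma norm_matrix_mult:
  fixes A :: "real^'n^'m" and B :: "real^'k^'n"
  shows "norm (A ** B) \<le> norm A * norm B"
proof (rule power2_le_imp_le)
  have "(A ** B) $ i = transpose B *v (A $ i)" for i
    by (simp add: vec_eq_iff matrix_matrix_mult_def matrix_vector_mult_def transpose_def mult.commute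
        del: transpose_matrix_vector)
  then have "norm ((A ** B) $ i) \<le> norm B * norm (A $ i)" for i
    by (metis norm_matrix_vector_mult norm_transpose)
  then have "(\<Sum>i\<in>UNIV. (norm ((A ** B) $ i))\<^sup>2) \<le> (\<Sum>i\<in>UNIV. (norm B * norm (A $ i))\<^sup>2)"
    by (intro sum_mono power_mono) auto
  then show "(norm (A ** B))\<^sup>2 \<le> (norm A * norm B)\<^sup>2"
    by (simp add: power_mult_distrib power2_norm_eq_inner inner_vec_def[of "A ** B"]
        inner_vec_def[of A] mult.commute flip: sum_distrib_left)
qed simp

text \<open>Cyclicity of the trace. Together with its right-hand version it moves the factors of
  \<open>\<sigma>0\<close> and its inverse from one side of the inner product to the other.\<close>

lemma inner_matrix_mult_left:
  fixes A :: "real^'n^'m"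
  shows "(A ** B) \<bullet> C = B \<bullet> (transpose A ** C)"
  by (simp add: inner_vec_def matrix_matrix_mult_def transpose_def sum_distrib_left sum_distrib_right)
    (subst sum.swap, subst (2) sum.swap, subst sum.swap, simp add: algebra_simps)

lemma inner_transpose: "transpose A \<bullet> transpose B = A \<bullet> (B :: real^'n^'m)"
  unfolding inner_vec_def transpose_def by (simp, rule sum.swap)

lemma inner_matrix_mult_right:
  fixes A :: "real^'n^'m"
  shows "(A ** B) \<bullet> C = A \<bullet> (C ** transpose B)"
  by (subst inner_transpose[symmetric]) (simp add: matrix_transpose_mul inner_matrix_mult_left,
    subst inner_transpose[symmetric], simp add: matrix_transpose_mul)

lemma inner_outer: "outer v \<bullet> M = v \<bullet> (M *v v)"
  by (simp add: inner_vec_def outer_def matrix_vector_mult_def sum_distrib_left sum_distrib_right algebra_simps)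

lemma inner_mat_1: "mat 1 \<bullet> M = (\<Sum>i\<in>UNIV. M $ i $ i)" for M :: "real^'n^'n"
  by (simp add: inner_vec_def mat_def if_distrib if_distribR cong: if_cong)

lemma inner_diag_part: "diag_part N \<bullet> M = (\<Sum>i\<in>UNIV. N $ i $ i * M $ i $ i)" for M :: "real^'n^'n"
  by (simp add: inner_vec_def diag_part_def if_distrib if_distribR cong: if_cong)

lemma Sym_component: "A \<in> Sym \<Longrightarrow> A $ i $ j = A $ j $ i"
  by (simp add: Sym_def transpose_def vec_eq_iff)

section \<open>Moments of the law of \<open>\<xi>\<close>\<close>

abbreviation xi_mean :: "real \<Rightarrow> (real^'d::finite \<Rightarrow> 'b::{banach, second_countable_topology}) \<Rightarrow> 'b" where
  "xi_mean p f \<equiv> measure_pmf.expectation (xi_law p) f"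

lemma xi_component_wf:
  assumes "0 < p" "p < 1"
  shows "pmf_of_list_wf [(1 / sqrt p, p / 2), (- 1 / sqrt p, p / 2), (0, 1 - p)]"
  using assms by (intro pmf_of_list_wfI) auto

lemma set_xi_component:
  assumes "0 < p" "p < 1"
  shows "set_pmf (xi_component p) \<subseteq> {1 / sqrt p, - 1 / sqrt p, 0}"
  using set_pmf_of_list[OF xi_component_wf[OF assms]] by (auto simp: xi_component_def)

lemma xi_component_mean:
  assumes "0 < p" "p < 1"
  shows "measure_pmf.expectation (xi_component p) f =
    p / 2 * f (1 / sqrt p) + p / 2 * f (- 1 / sqrt p) + (1 - p) * (f 0 :: real)"
proof -
  have ne: "1 / sqrt p \<noteq> - 1 / sqrt p" using assms by (simp add: field_simps)
  have "measure_pmf.expectation (xi_component p) f =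
      (\<Sum>a\<in>{1 / sqrt p, - 1 / sqrt p, 0}. f a * pmf (xi_component p) a)"
    using set_xi_component[OF assms] by (intro integral_measure_pmf_real) auto
  then show ?thesis
    using assms ne unfolding xi_component_def pmf_pmf_of_list[OF xi_component_wf[OF assms]]
    by (simp add: algebra_simps)
qed

lemma set_xi_law:
  assumes "0 < p" "p < 1" "\<xi> \<in> set_pmf (xi_law p)"
  shows "\<xi> $ i \<in> {1 / sqrt p, - 1 / sqrt p, 0}"
  using assms set_xi_component[OF assms(1,2)]
  by (fastforce simp: xi_law_def set_Pi_pmf PiE_dflt_def)

lemma finite_set_xi_law:
  assumes "0 < p" "p < 1"
  shows "finite (set_pmf (xi_law p :: (real^'d::finite) pmf))"
proof -
  have "set_pmf (Pi_pmf (UNIV::'d set) 0 (\<lambda>_. xi_component p)) \<subseteq>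
      PiE UNIV (\<lambda>_. {1 / sqrt p, - 1 / sqrt p, 0})"
    using set_xi_component[OF assms] by (fastforce simp: set_Pi_pmf PiE_dflt_def PiE_def)
  then have "finite (set_pmf (Pi_pmf (UNIV::'d set) 0 (\<lambda>_. xi_component p)))"
    by (rule finite_subset) (intro finite_PiE, auto)
  then show ?thesis by (simp add: xi_law_def)
qed

text \<open>Finite support makes every function of \<xi> integrable, so means can be split linearly
  for arbitrary arguments of the scheme.\<close>

lemma xi_integrable:
  fixes f :: "real^'d::finite \<Rightarrow> 'b::{banach, second_countable_topology}"
  assumes "0 < p" "p < 1"
  shows "integrable (measure_pmf (xi_law p)) f"
  by (rule integrable_measure_pmf_finite[OF finite_set_xi_law[OF assms]])

lemma norm_xi_mean_le:
  fixes f :: "real^'d::finite \<Rightarrow> 'b::{banach, second_countable_topology}"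
  assumes "0 < p" "p < 1" "\<And>\<xi>. \<xi> \<in> set_pmf (xi_law p) \<Longrightarrow> norm (f \<xi>) \<le> c"
  shows "norm (xi_mean p f) \<le> c"
proof -
  have "norm (xi_mean p f) \<le> xi_mean p (\<lambda>\<xi>. norm (f \<xi>))"
    by (rule integral_norm_bound)
  also have "\<dots> \<le> xi_mean p (\<lambda>\<xi>::real^'d. c)"
    by (rule integral_mono_AE) (use assms xi_integrable[OF assms(1,2)] in \<open>auto intro: AE_pmfI\<close>)
  finally show ?thesis by simp
qed

lemma norm_xi_le:
  fixes \<xi> :: "real^'d::finite"
  assumes "0 < p" "p < 1" "\<xi> \<in> set_pmf (xi_law p)"
  shows "norm \<xi> \<le> sqrt (real CARD('d) / p)"
proof (rule real_le_rsqrt)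
  have "(\<xi> $ i)\<^sup>2 \<le> 1 / p" for i
    using set_xi_law[OF assms, of i] assms(1) by (auto simp: power_divide)
  then have "(\<Sum>i\<in>UNIV. (\<xi> $ i)\<^sup>2) \<le> (\<Sum>i\<in>(UNIV::'d set). 1 / p)" by (intro sum_mono) auto
  then show "(norm \<xi>)\<^sup>2 \<le> real CARD('d) / p"
    unfolding power2_norm_eq_inner inner_vec_def by (simp add: power2_eq_square)
qed

lemma xi_mean_prod:
  fixes f :: "'d::finite \<Rightarrow> real \<Rightarrow> real"
  assumes "0 < p" "p < 1"
  shows "xi_mean p (\<lambda>\<xi>. \<Prod>i\<in>UNIV. f i (\<xi> $ i)) =
    (\<Prod>i\<in>UNIV. measure_pmf.expectation (xi_component p) (f i))"
proof -
  let ?P = "Pi_pmf (UNIV::'d set) 0 (\<lambda>_. xi_component p)"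
  have fin: "finite (set_pmf ?P)"
    using finite_set_xi_law[OF assms, where 'd='d] unfolding xi_law_def set_map_pmf
    by (rule finite_imageD) (simp add: inj_on_def vec_lambda_inject)
  have "prob_space.indep_vars (measure_pmf ?P) (\<lambda>_. count_space UNIV) (\<lambda>x f. f x) UNIV"
    by (rule indep_vars_Pi_pmf) simp
  then have "prob_space.indep_vars (measure_pmf ?P) (\<lambda>_. borel) (\<lambda>i y. f i (y i)) UNIV"
    by (rule prob_space.indep_vars_compose2[OF prob_space_measure_pmf]) simp
  then have "measure_pmf.expectation ?P (\<lambda>y. \<Prod>i\<in>UNIV. f i (y i)) =
     (\<Prod>i\<in>UNIV. measure_pmf.expectation ?P (\<lambda>y. f i (y i)))"
    by (intro prob_space.indep_vars_lebesgue_integral[OF prob_space_measure_pmf])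
      (auto intro: integrable_measure_pmf_finite fin)
  also have "\<dots> = (\<Prod>i\<in>UNIV. measure_pmf.expectation (map_pmf (\<lambda>y. y i) ?P) (f i))"
    by simp
  also have "\<dots> = (\<Prod>i\<in>UNIV. measure_pmf.expectation (xi_component p) (f i))"
    by (simp add: Pi_pmf_component)
  finally show ?thesis by (simp add: xi_law_def)
qed

text \<open>The k-th moment of one component of \<xi>. Since 0 ^ 0 = 1, the last term completes the
  total mass at k = 0.\<close>

definition xi_moment :: "real \<Rightarrow> nat \<Rightarrow> real" where
  "xi_moment p k = p / 2 * (1 / sqrt p) ^ k + p / 2 * (- 1 / sqrt p) ^ k + (1 - p) * 0 ^ k"

lemma xi_moment_simps:
  assumes "0 < p"
  shows "xi_moment p 0 = 1" "xi_moment p (Suc 0) = 0" "xi_moment p 2 = 1" "xi_moment p 3 = 0"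
    "xi_moment p 4 = 1 / p"
  using assms
  by (simp_all add: xi_moment_def power_divide power2_eq_square power3_eq_cube power4_eq_xxxx
      mult.assoc)

lemma xi_moment_odd: "odd k \<Longrightarrow> xi_moment p k = 0"
  by (cases k) (auto simp: xi_moment_def power_divide)

text \<open>A monomial is encoded by the list of its indices and the multiplicity of an index is its
  exponent. Coincidences between indices are thereby handled by counting; absent coordinates
  contribute \<open>xi_moment p 0 = 1\<close>.\<close>

lemma xi_mean_prod_list:
  fixes L :: "'d::finite list"
  assumes "0 < p" "p < 1"
  shows "xi_mean p (\<lambda>\<xi>. \<Prod>i\<leftarrow>L. \<xi> $ i) = (\<Prod>i\<in>UNIV. xi_moment p (count_list L i))"
proof -
  have "(\<Prod>i\<leftarrow>L. \<xi> $ i) = (\<Prod>i\<in>UNIV. (\<xi> $ i) ^ count_list L i)" for \<xi> :: "real^'d"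
  proof (induction L)
    case (Cons j js)
    have "(\<Prod>i\<in>UNIV. (\<xi> $ i) ^ count_list (j # js) i) =
       (\<Prod>i\<in>UNIV. (if i = j then \<xi> $ i else 1) * (\<xi> $ i) ^ count_list js i)"
      by (intro prod.cong) auto
    then show ?case using Cons by (simp add: prod.distrib)
  qed simp
  then show ?thesis
    using xi_mean_prod[OF assms, of "\<lambda>i v. v ^ count_list L i"]
    by (simp add: xi_component_mean[OF assms] xi_moment_def)
qed

lemma xi_mean_odd:
  fixes L :: "'d::finite list"
  assumes "0 < p" "p < 1" "odd (count_list L i)"
  shows "xi_mean p (\<lambda>\<xi>. \<Prod>i\<leftarrow>L. \<xi> $ i) = 0"
  unfolding xi_mean_prod_list[OF assms(1,2)]
  by (rule prod_zero) (use assms(3) xi_moment_odd in auto)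

lemma xi_mean_1: "0 < p \<Longrightarrow> p < 1 \<Longrightarrow> xi_mean p (\<lambda>\<xi>. \<xi> $ i) = 0"
  using xi_mean_odd[of p "[i]" i] by simp

lemma xi_mean_2:
  fixes i j :: "'d::finite"
  assumes "0 < p" "p < 1"
  shows "xi_mean p (\<lambda>\<xi>. \<xi> $ i * \<xi> $ j) = of_bool (i = j)"
proof (cases "i = j")
  case True
  have "xi_mean p (\<lambda>\<xi>. \<xi> $ i * \<xi> $ j) = (\<Prod>k\<in>UNIV. xi_moment p (count_list [i, j] k))"
    using xi_mean_prod_list[OF assms, of "[i, j]"] by simp
  also have "\<dots> = 1"
    by (rule prod.neutral) (use True assms in \<open>auto simp: xi_moment_simps numeral_2_eq_2[symmetric]\<close>)
  finally show ?thesis using True by simp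
next
  case False
  then show ?thesis using xi_mean_odd[OF assms, of "[i, j]" i] by simp
qed

lemma xi_mean_3:
  fixes i j k :: "'d::finite"
  assumes "0 < p" "p < 1"
  shows "xi_mean p (\<lambda>\<xi>. \<xi> $ i * (\<xi> $ j * \<xi> $ k)) = 0"
proof -
  have "odd (count_list [i, j, k] i) \<or> odd (count_list [i, j, k] j) \<or> odd (count_list [i, j, k] k)"
    by auto
  then obtain m where "odd (count_list [i, j, k] m)" by blast
  from xi_mean_odd[OF assms this] show ?thesis by simp
qed

text \<open>An index of odd multiplicity makes the moment vanish, so the indices must pair up: 1 / p
  if all four agree, 1 for two distinct pairs. The split on \<open>i = j\<close> mirrors the
  diagonal and off-diagonal entries of \<open>xi_matrix\<close>.\<close>

lemma xi_mean_4:
  fixes i j k l :: "'d::finite"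
  assumes "0 < p" "p < 1"
  shows "xi_mean p (\<lambda>\<xi>. \<xi> $ i * (\<xi> $ j * (\<xi> $ k * \<xi> $ l))) =
    (if i = j then (if k = l then (if k = i then 1 / p else 1) else 0)
     else of_bool (k = i \<and> l = j) + of_bool (k = j \<and> l = i))"
proof -
  have *: "xi_mean p (\<lambda>\<xi>. \<xi> $ i * (\<xi> $ j * (\<xi> $ k * \<xi> $ l))) =
    (\<Prod>m\<in>UNIV. xi_moment p (count_list [i, j, k, l] m))"
    using xi_mean_prod_list[OF assms, of "[i, j, k, l]"] by (simp add: mult.assoc)
  note ms = xi_moment_simps[OF assms(1)]
  have "(\<exists>m. odd (count_list [i, j, k, l] m)) \<or> (i = j \<and> k = l) \<or> (i = k \<and> j = l) \<or> (i = l \<and> j = k)"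
  proof (rule ccontr)
    assume a: "\<not> ?thesis"
    then have "even (count_list [i, j, k, l] m)" for m by blast
    from this[of i] this[of j] this[of k] this[of l]
    have "i = j \<and> k = l \<or> i = k \<and> j = l \<or> i = l \<and> j = k"
      by (simp split: if_splits)
    with a show False by blast
  qed
  moreover define P where "P = (\<exists>m. odd (count_list [i, j, k, l] m))"
  ultimately have "P \<or> (i = j \<and> k = l) \<or> (i = k \<and> j = l) \<or> (i = l \<and> j = k)" by (simp only:)
  then consider "i = j" "k = l" "k = i" | P | 
    "i = j" "k = l" "k \<noteq> i" | "i \<noteq> j" "(k = i \<and> l = j) \<or> (k = j \<and> l = i)"
    by (cases "i = j"; cases "k = l"; cases "k = i") auto
  then show ?thesis
  proof cases
    case 1
    have e: "(\<Prod>m\<in>UNIV. xi_moment p (count_list [i, j, k, l] m)) = (\<Prod>m\<in>UNIV. if m = i then 1 / p else 1)"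
      using 1 ms by (intro prod.cong) (auto simp: numeral_eq_Suc)
    show ?thesis unfolding * e using 1 by auto
  next
    case 2
    then obtain m where m: "odd (count_list [i, j, k, l] m)" unfolding P_def by blast
    have n: "\<not> (i = j \<and> k = l)" "\<not> (i = k \<and> j = l)" "\<not> (i = l \<and> j = k)"
    proof -
      have ev: "even (count_list [a, a, b, b] m)" "even (count_list [a, b, a, b] m)"
        "even (count_list [a, b, b, a] m)" for a b :: 'd by simp_all
      show "\<not> (i = j \<and> k = l)"
      proof
        assume a: "i = j \<and> k = l"
        from m ev(1)[of j l] show False by (simp only: a not_True_eq_False)
      qed
      show "\<not> (i = k \<and> j = l)"
      proof
        assume a: "i = k \<and> j = l"
        from m ev(2)[of k l] show False by (simp only: a not_True_eq_False)
      qed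
      show "\<not> (i = l \<and> j = k)"
      proof
        assume a: "i = l \<and> j = k"
        from m ev(3)[of l k] show False by (simp only: a not_True_eq_False)
      qed
    qed
    have z: "xi_mean p (\<lambda>\<xi>. \<xi> $ i * (\<xi> $ j * (\<xi> $ k * \<xi> $ l))) = 0"
      using xi_mean_odd[OF assms m] by simp
    show ?thesis
    proof (cases "i = j")
      case True
      then have "k \<noteq> l" using n by blast
      then show ?thesis using True z by simp
    next
      case False
      have "\<not> (k = i \<and> l = j)" "\<not> (k = j \<and> l = i)" using n by blast+
      then show ?thesis
        unfolding z by (simp only: False if_False of_bool_eq add_0_left)
    qed
  next
    case 3
    have e: "(\<Prod>m\<in>UNIV. xi_moment p (count_list [i, j, k, l] m)) = 1"
      using 3 ms by (intro prod.neutral) (auto simp: numeral_eq_Suc)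
    show ?thesis unfolding * e using 3 by auto
  next
    case 4
    have e: "(\<Prod>m\<in>UNIV. xi_moment p (count_list [i, j, k, l] m)) = 1"
      using 4 ms by (intro prod.neutral) (auto simp: numeral_eq_Suc)
    show ?thesis unfolding * e using 4 by auto
  qed
qed

section \<open>Expansion of the difference operators\<close>

lemma xi_mean_linear:
  fixes L :: "'a::euclidean_space \<Rightarrow> 'b::euclidean_space" and f :: "real^'d::finite \<Rightarrow> 'a"
  assumes "0 < p" "p < 1" "linear L"
  shows "xi_mean p (\<lambda>\<xi>. L (f \<xi>)) = L (xi_mean p f)"
  using assms by (intro integral_bounded_linear xi_integrable) (simp_all add: linear_conv_bounded_linear)

lemma linear_transpose: "linear (transpose :: real^'n^'m \<Rightarrow> real^'m^'n)"
  by (auto simp: linear_iff transpose_def vec_eq_iff)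

lemma linear_congruence: "linear (\<lambda>M :: real^'d^'d. c *\<^sub>R (A ** M ** B))"
  by (auto simp: linear_iff matrix_matrix_mult_def vec_eq_iff sum_distrib_left sum_distrib_right
      sum.distrib algebra_simps)

text \<open>The kernel of \<open>K2\<close> stripped of the factors of the inverse of
  \<open>\<sigma>0\<close> and of (1 - p) h. It is orthogonal in the mean to 1 and to \<xi>, and
  dual to the products of two components of \<xi>.\<close>

definition xi_matrix :: "real \<Rightarrow> real^'d::finite \<Rightarrow> real^'d^'d" where
  "xi_matrix p \<xi> = (1 - p) *\<^sub>R outer \<xi> - (1 - 3 * p) *\<^sub>R diag_part (outer \<xi>) - (2 * p) *\<^sub>R mat 1"

lemma K2_xi_matrix:
  "K2 s p h \<xi> = (1 / ((1 - p) * h)) *\<^sub>R (transpose (matrix_inv s) ** xi_matrix p \<xi> ** matrix_inv s)"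
  by (simp add: K2_def xi_matrix_def)

lemma xi_matrix_component:
  "xi_matrix p \<xi> $ i $ j = (if i = j then 2 * p * (\<xi> $ i * \<xi> $ i) - 2 * p else (1 - p) * (\<xi> $ i * \<xi> $ j))"
  by (simp add: xi_matrix_def outer_def diag_part_def mat_def algebra_simps)

lemma transpose_xi_matrix: "transpose (xi_matrix p \<xi>) = xi_matrix p \<xi>"
  by (auto simp: transpose_def vec_eq_iff xi_matrix_component mult.commute)

lemma xi_mean_xi_matrix:
  fixes i j :: "'d::finite"
  assumes "0 < p" "p < 1"
  shows "xi_mean p (\<lambda>\<xi>. xi_matrix p \<xi> $ i $ j) = 0"
  unfolding xi_matrix_component
  by (cases "i = j") (simp_all add: xi_integrable[OF assms] xi_mean_2[OF assms])

lemma xi_mean_xi_xi_matrix: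
  fixes i j k :: "'d::finite"
  assumes "0 < p" "p < 1"
  shows "xi_mean p (\<lambda>\<xi>. \<xi> $ k * xi_matrix p \<xi> $ i $ j) = 0"
proof -
  have "\<xi> $ k * xi_matrix p \<xi> $ i $ j = (if i = j then 2 * p * (\<xi> $ k * (\<xi> $ i * \<xi> $ i)) - 2 * p * \<xi> $ k
      else (1 - p) * (\<xi> $ k * (\<xi> $ i * \<xi> $ j)))" for \<xi> :: "real^'d"
    by (simp add: xi_matrix_component algebra_simps)
  note e = this
  show ?thesis
    unfolding e by (cases "i = j") (simp_all add: xi_integrable[OF assms] xi_mean_1[OF assms] xi_mean_3[OF assms])
qed

text \<open>This duality explains the coefficients of the kernel. On the diagonal the weight 2 p,
  left from (1 - p) - (1 - 3 p), gives 2 p (1 / p - 1) = 2 (1 - p) for k = l = i, and subtracting 2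
  p cancels the case k = l different from i. Off the diagonal the value is 1 - p for each of the two
  matchings.\<close>

lemma xi_mean_xi_xi_xi_matrix:
  fixes i j k l :: "'d::finite"
  assumes "0 < p" "p < 1"
  shows "xi_mean p (\<lambda>\<xi>. \<xi> $ k * \<xi> $ l * xi_matrix p \<xi> $ i $ j) =
     (1 - p) * (of_bool (k = i \<and> l = j) + of_bool (k = j \<and> l = i))"
proof -
  have "\<xi> $ k * \<xi> $ l * xi_matrix p \<xi> $ i $ j =
     (if i = j then 2 * p * (\<xi> $ i * (\<xi> $ i * (\<xi> $ k * \<xi> $ l))) - 2 * p * (\<xi> $ k * \<xi> $ l)
      else (1 - p) * (\<xi> $ i * (\<xi> $ j * (\<xi> $ k * \<xi> $ l))))" for \<xi> :: "real^'d"
    by (simp add: xi_matrix_component algebra_simps)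
  note e = this
  show ?thesis
  proof (cases "i = j")
    case True
    have "xi_mean p (\<lambda>\<xi>. \<xi> $ k * \<xi> $ l * xi_matrix p \<xi> $ i $ j) =
      2 * p * (if k = l then (if k = i then 1 / p else 1) else 0) - 2 * p * of_bool (k = l)"
      unfolding e unfolding True by (simp only: if_True xi_integrable[OF assms] xi_mean_2[OF assms]
        xi_mean_4[OF assms] Bochner_Integration.integral_diff integral_mult_right_zero refl)
    then show ?thesis using assms(1) True by (cases "k = l"; cases "k = i") (simp_all add: field_simps)
  next
    case False
    have "xi_mean p (\<lambda>\<xi>. \<xi> $ k * \<xi> $ l * xi_matrix p \<xi> $ i $ j) =
      (1 - p) * (of_bool (k = i \<and> l = j) + of_bool (k = j \<and> l = i))"
      unfolding e using False assms by (simp only: if_False xi_mean_4 integral_mult_right_zero)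
    then show ?thesis .
  qed
qed

text \<open>The kernel \<open>f\<close> is left free: 1, the components of \<xi> and the entries of
  \<open>xi_matrix\<close> yield the three difference operators from the same identity.\<close>

lemma xi_mean_expansion:
  fixes R f :: "real^'d::finite \<Rightarrow> real"
  assumes p: "0 < p" "p < 1"
  shows "xi_mean p (\<lambda>\<xi>. (a + r * (c \<bullet> \<xi>) + e * (\<xi> \<bullet> (B *v \<xi>)) + h * R \<xi>) * f \<xi>) =
     a * xi_mean p f + r * (\<Sum>k\<in>UNIV. c $ k * xi_mean p (\<lambda>\<xi>. \<xi> $ k * f \<xi>)) +
     e * (\<Sum>k\<in>UNIV. \<Sum>l\<in>UNIV. B $ k $ l * xi_mean p (\<lambda>\<xi>. \<xi> $ k * \<xi> $ l * f \<xi>)) +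
     h * xi_mean p (\<lambda>\<xi>. R \<xi> * f \<xi>)"
proof -
  have "(a + r * (c \<bullet> \<xi>) + e * (\<xi> \<bullet> (B *v \<xi>)) + h * R \<xi>) * f \<xi> =
     a * f \<xi> + r * (\<Sum>k\<in>UNIV. c $ k * (\<xi> $ k * f \<xi>)) +
     e * (\<Sum>k\<in>UNIV. \<Sum>l\<in>UNIV. B $ k $ l * (\<xi> $ k * \<xi> $ l * f \<xi>)) + h * (R \<xi> * f \<xi>)" for \<xi>
    by (simp add: inner_vec_def matrix_vector_mult_def sum_distrib_left sum_distrib_right algebra_simps)
  then show ?thesis
    by (simp add: xi_integrable[OF p])
qed

lemma Sym_congruence: "B \<in> Sym \<Longrightarrow> transpose A ** B ** A \<in> Sym"
  by (simp add: Sym_def matrix_transpose_mul matrix_mul_assoc)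

section \<open>Means of a second-order polynomial with remainder against the three kernels\<close>

context
  fixes p :: real and a r e h :: real and c :: "real^'d::finite" and B :: "real^'d^'d"
    and R Q :: "real^'d \<Rightarrow> real"
  assumes p: "0 < p" "p < 1" and B: "B \<in> Sym"
    and Q: "\<And>\<xi>. Q \<xi> = a + r * (c \<bullet> \<xi>) + e * (\<xi> \<bullet> (B *v \<xi>)) + h * R \<xi>"
begin

lemma xi_mean_expansion_0: "xi_mean p Q = a + e * (\<Sum>i\<in>UNIV. B $ i $ i) + h * xi_mean p R"
  using xi_mean_expansion[OF p, of a r c e B h R "\<lambda>_. 1"]
  by (simp add: Q[abs_def] xi_mean_1 xi_mean_2 p if_distrib cong: if_cong)

lemma xi_mean_expansion_1:
  "xi_mean p (\<lambda>\<xi>. Q \<xi> *\<^sub>R \<xi>) = r *\<^sub>R c + h *\<^sub>R xi_mean p (\<lambda>\<xi>. R \<xi> *\<^sub>R \<xi>)"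
proof -
  have nth: "xi_mean p f $ i = xi_mean p (\<lambda>\<xi>. f \<xi> $ i)" for f :: "real^'d \<Rightarrow> real^'d" and i
    using xi_mean_linear[OF p, of "\<lambda>v. v $ i" f] by (simp add: linear_iff)
  have "xi_mean p (\<lambda>\<xi>. Q \<xi> * \<xi> $ i) = r * c $ i + h * xi_mean p (\<lambda>\<xi>. R \<xi> * \<xi> $ i)" for i
    unfolding Q xi_mean_expansion[OF p] mult.assoc[of "_ $ _" "_ $ _"] xi_mean_3[OF p]
    by (simp add: xi_mean_1 xi_mean_2 p if_distrib cong: if_cong)
  then show ?thesis by (simp add: vec_eq_iff nth)
qed

lemma xi_mean_expansion_2:
  "xi_mean p (\<lambda>\<xi>. Q \<xi> *\<^sub>R xi_matrix p \<xi>) =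
     (2 * e * (1 - p)) *\<^sub>R B + h *\<^sub>R xi_mean p (\<lambda>\<xi>. R \<xi> *\<^sub>R xi_matrix p \<xi>)"
proof -
  have nth: "xi_mean p f $ i $ j = xi_mean p (\<lambda>\<xi>. f \<xi> $ i $ j)" for f :: "real^'d \<Rightarrow> real^'d^'d" and i j
    using xi_mean_linear[OF p, of "\<lambda>v. v $ i $ j" f] by (simp add: linear_iff)
  have "xi_mean p (\<lambda>\<xi>. Q \<xi> * xi_matrix p \<xi> $ i $ j) =
      2 * e * (1 - p) * B $ i $ j + h * xi_mean p (\<lambda>\<xi>. R \<xi> * xi_matrix p \<xi> $ i $ j)" for i j
  proof -
    have d: "(\<Sum>k\<in>UNIV. \<Sum>l\<in>UNIV. B $ k $ l * of_bool (k = m \<and> l = n)) = B $ m $ n" for m n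
    proof -
      have "(\<Sum>l\<in>UNIV. B $ k $ l * of_bool (k = m \<and> l = n)) = (if k = m then B $ m $ n else 0)" for k
        by (cases "k = m") (simp_all add: of_bool_def if_distrib[of "\<lambda>x. _ * x"] cong: if_cong)
      then show ?thesis by simp
    qed
    have "(\<Sum>k\<in>UNIV. \<Sum>l\<in>UNIV. B $ k $ l * (of_bool (k = i \<and> l = j) + of_bool (k = j \<and> l = i))) =
       B $ i $ j + B $ j $ i"
      by (simp only: distrib_left sum.distrib d)
    \<comment> \<open>The kernel only sees the sum of \<open>B\<close> and its transpose; symmetry
      of \<open>B\<close> turns this into the factor 2.\<close>
    also have "\<dots> = 2 * B $ i $ j" by (simp add: Sym_component[OF B, of j i])
    finally have s: "(\<Sum>k\<in>UNIV. \<Sum>l\<in>UNIV. B $ k $ l * ((1 - p) * (of_bool (k = i \<and> l = j) + of_bool (k = j \<and> l = i))))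
        = (1 - p) * (2 * B $ i $ j)"
      by (simp only: mult.left_commute[of _ "1 - p"] flip: sum_distrib_left)
    show ?thesis
      unfolding Q xi_mean_expansion[OF p] xi_mean_xi_matrix[OF p] xi_mean_xi_xi_matrix[OF p]
        xi_mean_xi_xi_xi_matrix[OF p] s by simp
  qed
  then show ?thesis by (simp add: vec_eq_iff nth)
qed

end

lemma norm_outer: "norm (outer v) = (norm v)\<^sup>2"
proof -
  have "(norm (outer v))\<^sup>2 = ((norm v)\<^sup>2)\<^sup>2"
    unfolding power2_norm_eq_inner inner_outer
    by (simp add: inner_vec_def outer_def matrix_vector_mult_def power2_eq_square
        sum_distrib_left sum_distrib_right algebra_simps)
  then show ?thesis by (simp only: power2_eq_iff_nonneg[OF norm_ge_zero zero_le_power2])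
qed

lemma norm_diag_part: "norm (diag_part A) \<le> norm A"
proof (rule power2_le_imp_le)
  show "(norm (diag_part A))\<^sup>2 \<le> (norm A)\<^sup>2"
    unfolding power2_norm_eq_inner inner_vec_def diag_part_def
    by (auto intro!: sum_mono)
qed simp

lemma norm_mat_1: "norm (mat 1 :: real^'d^'d) = sqrt (real CARD('d))"
  by (simp add: norm_eq_sqrt_inner inner_mat_1) (simp add: mat_def)

text \<open>For p at most 1/3 the three coefficients 1 - p, 1 - 3 p and 2 p all lie in [0,1], so
  each is replaced by 1.\<close>

lemma norm_xi_matrix:
  fixes \<xi> :: "real^'d::finite"
  assumes p: "0 < p" "p \<le> 1 / 3" and \<xi>: "\<xi> \<in> set_pmf (xi_law p)"
  shows "norm (xi_matrix p \<xi>) \<le> 2 * real CARD('d) / p + real CARD('d)"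
proof -
  have o: "norm (outer \<xi>) \<le> real CARD('d) / p"
    using power_mono[OF norm_xi_le[OF _ _ \<xi>] norm_ge_zero, of 2] p by (simp add: norm_outer)
  have "norm (xi_matrix p \<xi>) \<le> norm ((1 - p) *\<^sub>R outer \<xi>) + norm ((1 - 3 * p) *\<^sub>R diag_part (outer \<xi>))
      + norm ((2 * p) *\<^sub>R (mat 1 :: real^'d^'d))"
    unfolding xi_matrix_def by (intro norm_triangle_ineq4 order_trans[OF norm_triangle_ineq4] add_mono) auto
  also have "\<dots> \<le> 1 * (real CARD('d) / p) + 1 * (real CARD('d) / p) + 1 * real CARD('d)"
  proof (intro add_mono)
    show "norm ((1 - p) *\<^sub>R outer \<xi>) \<le> 1 * (real CARD('d) / p)"
      unfolding norm_scaleR by (intro mult_mono o) (use p in auto)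
    show "norm ((1 - 3 * p) *\<^sub>R diag_part (outer \<xi>)) \<le> 1 * (real CARD('d) / p)"
      unfolding norm_scaleR by (intro mult_mono order_trans[OF norm_diag_part o]) (use p in auto)
    have "sqrt (real CARD('d)) \<le> real CARD('d)"
      by (rule real_le_lsqrt) (auto simp: power2_eq_square Suc_leI)
    then show "norm ((2 * p) *\<^sub>R (mat 1 :: real^'d^'d)) \<le> 1 * real CARD('d)"
      unfolding norm_scaleR norm_mat_1 by (intro mult_mono) (use p in auto)
  qed
  finally show ?thesis by simp
qed

section \<open>Consistency of the scheme\<close>

lemma matrix_inv_mult:
  fixes s :: "real^'d^'d"
  assumes "invertible s"
  shows "s ** matrix_inv s = mat 1" "matrix_inv s ** s = mat 1"
  using someI_ex[of "\<lambda>B. s ** B = mat 1 \<and> B ** s = mat 1"] assms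
  unfolding matrix_inv_def invertible_def by auto

text \<open>The simplifier turns \<open>transpose A *v v\<close> into \<open>v v* A\<close>, so
  \<open>K1\<close> is met in this form.\<close>

lemma linear_vector_matrix_mult: "linear (\<lambda>v. c *\<^sub>R (v v* A))" for A :: "real^'n^'m"
proof -
  have "linear (\<lambda>v. transpose A *v v)" by (rule matrix_vector_mul_linear)
  then show ?thesis by (simp add: linear_iff scaleR_right_distrib scaleR_left_commute)
qed

lemma norm_vector_matrix_mult: "norm (v v* A) \<le> norm v * norm A" for A :: "real^'n^'m"
  using norm_matrix_vector_mult[of "transpose A" v] by (simp add: norm_transpose mult.commute)

lemma D2_Sym: "0 < p \<Longrightarrow> p < 1 \<Longrightarrow> D2 s p h \<phi> x \<in> Sym"
proof -
  assume p: "0 < p" "p < 1"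
  have t: "transpose (K2 s p h \<xi>) = K2 s p h \<xi>" for \<xi>
    by (simp add: K2_xi_matrix transpose_scalar matrix_transpose_mul transpose_xi_matrix matrix_mul_assoc)
  have "transpose (D2 s p h \<phi> x) = D2 s p h \<phi> x"
    unfolding D2_def xi_mean_linear[OF p linear_transpose, symmetric] transpose_scalar t ..
  then show ?thesis by (simp add: Sym_def)
qed

section \<open>Difference operators of a function close to a quadratic polynomial\<close>

context
  fixes s :: "real^'d::finite^'d" and p h \<delta> k a \<tau> :: real and b x :: "real^'d" and M :: "real^'d^'d"
    and \<phi> :: "real^'d \<Rightarrow> real"
  assumes p: "0 < p" "p \<le> 1 / 3" and s: "invertible s" and M: "M \<in> Sym" and h: "0 < h"
    and k: "norm (matrix_inv s) \<le> k" "1 / p \<le> k"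
    and near: "\<And>\<xi>. \<xi> \<in> set_pmf (xi_law p) \<Longrightarrow>
      \<bar>\<phi> (x + sqrt h *\<^sub>R (s *v \<xi>)) - (a + sqrt h * (b \<bullet> (s *v \<xi>)) +
         h * (\<tau> + ((s *v \<xi>) \<bullet> (M *v (s *v \<xi>))) / 2))\<bar> \<le> \<delta> * h"
begin

private definition "Q = (\<lambda>\<xi>. \<phi> (x + sqrt h *\<^sub>R (s *v \<xi>)))"
private definition "B = transpose s ** M ** s"
text \<open>The Taylor remainder divided by h, so that it is bounded by \<delta> on the support of
  \<xi>.\<close>

private definition "R = (\<lambda>\<xi>. (Q \<xi> - (a + sqrt h * (b \<bullet> (s *v \<xi>)) +
         h * (\<tau> + ((s *v \<xi>) \<bullet> (M *v (s *v \<xi>))) / 2))) / h)"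

private lemma p1: "p < 1" using p by simp

private lemma B_Sym: "B \<in> Sym" unfolding B_def by (rule Sym_congruence[OF M])

private lemma Q_eq: "Q \<xi> = (a + h * \<tau>) + sqrt h * ((b v* s) \<bullet> \<xi>) + h / 2 * (\<xi> \<bullet> (B *v \<xi>)) + h * R \<xi>"
proof -
  have "\<xi> \<bullet> (B *v \<xi>) = (s *v \<xi>) \<bullet> (M *v (s *v \<xi>))"
    unfolding B_def matrix_vector_mul_assoc[symmetric]
    by (simp add: inner_commute[of \<xi>] dot_lmul_matrix) (simp add: inner_commute)
  then show ?thesis using h by (simp add: R_def dot_lmul_matrix field_simps)
qed

private lemma R_le: "\<xi> \<in> set_pmf (xi_law p) \<Longrightarrow> \<bar>R \<xi>\<bar> \<le> \<delta>"
  using near[of \<xi>] h by (simp add: R_def Q_def field_simps)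

private lemma pos: "0 \<le> \<delta>" "0 \<le> k"
proof -
  obtain \<xi> :: "real^'d" where "\<xi> \<in> set_pmf (xi_law p)"
    using set_pmf_not_empty[of "xi_law p :: (real^'d) pmf"] by blast
  then show "0 \<le> \<delta>" using R_le by fastforce
  show "0 \<le> k" using k(1) norm_ge_zero order_trans by blast
qed

text \<open>The components of \<xi> are uncorrelated with unit variance, so the quadratic term
  averages to the trace of \<open>B\<close>, which is \<open>(s ** transpose s) \<bullet> M\<close>
  by cyclicity. This is the diffusion that \<open>F_of\<close> subtracts again.\<close>

lemma D0_expansion: "\<bar>D0 s p h \<phi> x - (a + h * \<tau> + h / 2 * ((s ** transpose s) \<bullet> M))\<bar> \<le> \<delta> * h"
proof -
  have "(\<Sum>i\<in>UNIV. B $ i $ i) = (s ** transpose s) \<bullet> M"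
  proof -
    have "(transpose s ** M ** s) \<bullet> mat 1 = M \<bullet> (s ** transpose s)"
      by (subst inner_matrix_mult_right, subst inner_matrix_mult_left) simp
    then show ?thesis by (simp add: B_def inner_mat_1[symmetric] inner_commute)
  qed
  then have "D0 s p h \<phi> x - (a + h * \<tau> + h / 2 * ((s ** transpose s) \<bullet> M)) = h * xi_mean p R"
    using xi_mean_expansion_0[OF p(1) p1 B_Sym Q_eq] by (simp add: D0_def Q_def[symmetric])
  moreover have "\<bar>xi_mean p R\<bar> \<le> \<delta>"
    using norm_xi_mean_le[OF p(1) p1, of R \<delta>] R_le by simp
  ultimately show ?thesis
    using h by (simp add: abs_mult mult.commute)
qed

text \<open>\<open>K1\<close> divides by the square root of h, so the remainder of size \<delta> h
  still leaves a factor \<surd>h. The constant bounds the inverse of \<open>s\<close> by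
  \<open>k\<close> and |\<xi>| by the root of d k.\<close>

lemma D1_expansion: "norm (D1 s p h \<phi> x - b) \<le> \<delta> * (k * sqrt (real CARD('d) * k)) * sqrt h"
proof -
  let ?L = "\<lambda>v. (1 / sqrt h) *\<^sub>R (v v* matrix_inv s)"
  have "D1 s p h \<phi> x = xi_mean p (\<lambda>\<xi>. ?L (Q \<xi> *\<^sub>R \<xi>))"
    by (simp add: D1_def K1_def Q_def scaleR_vector_matrix_assoc[symmetric] mult.commute)
  also have "\<dots> = ?L (xi_mean p (\<lambda>\<xi>. Q \<xi> *\<^sub>R \<xi>))"
    by (rule xi_mean_linear[OF p(1) p1 linear_vector_matrix_mult])
  also have "\<dots> = ?L (sqrt h *\<^sub>R (b v* s)) + ?L (h *\<^sub>R xi_mean p (\<lambda>\<xi>. R \<xi> *\<^sub>R \<xi>))"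
    unfolding xi_mean_expansion_1[OF p(1) p1 B_Sym Q_eq]
    by (rule linear_add[OF linear_vector_matrix_mult])
  also have "?L (sqrt h *\<^sub>R (b v* s)) = b"
    using h by (simp add: scaleR_vector_matrix_assoc[symmetric] vector_matrix_mul_assoc matrix_inv_mult(1)[OF s])
  also have "?L (h *\<^sub>R xi_mean p (\<lambda>\<xi>. R \<xi> *\<^sub>R \<xi>)) = sqrt h *\<^sub>R (xi_mean p (\<lambda>\<xi>. R \<xi> *\<^sub>R \<xi>) v* matrix_inv s)"
    using h by (simp add: scaleR_vector_matrix_assoc[symmetric] real_div_sqrt)
  finally have e: "D1 s p h \<phi> x - b = sqrt h *\<^sub>R (xi_mean p (\<lambda>\<xi>. R \<xi> *\<^sub>R \<xi>) v* matrix_inv s)" by simp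
  have "norm (xi_mean p (\<lambda>\<xi>. R \<xi> *\<^sub>R \<xi>)) \<le> \<delta> * sqrt (real CARD('d) * k)"
  proof (rule norm_xi_mean_le[OF p(1) p1])
    fix \<xi> :: "real^'d" assume \<xi>: "\<xi> \<in> set_pmf (xi_law p)"
    have "real CARD('d) / p \<le> real CARD('d) * k"
      using mult_left_mono[OF k(2), of "real CARD('d)"] by simp
    then have "norm \<xi> \<le> sqrt (real CARD('d) * k)"
      using norm_xi_le[OF p(1) p1 \<xi>] real_sqrt_le_mono order_trans by blast
    then show "norm (R \<xi> *\<^sub>R \<xi>) \<le> \<delta> * sqrt (real CARD('d) * k)"
      unfolding norm_scaleR real_norm_def using pos by (intro mult_mono R_le \<xi>) auto
  qed
  then have "norm (xi_mean p (\<lambda>\<xi>. R \<xi> *\<^sub>R \<xi>) v* matrix_inv s) \<le> (\<delta> * sqrt (real CARD('d) * k)) * k"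
    using pos by (intro order_trans[OF norm_vector_matrix_mult] mult_mono k(1)) auto
  then show ?thesis
    unfolding e using h by (simp add: mult.commute mult.left_commute mult_left_mono)
qed

text \<open>Here the division by h consumes the whole factor of the remainder, and only \<delta>
  makes the error small. The constant collects 1 / (1 - p) \<le> 3/2, two factors of the inverse of
  \<open>s\<close>, and the bound on \<open>xi_matrix\<close>.\<close>

lemma D2_expansion: "norm (D2 s p h \<phi> x - M) \<le> \<delta> * (3 / 2 * k\<^sup>2 * (2 * real CARD('d) * k + real CARD('d)))"
proof -
  let ?S = "matrix_inv s"
  let ?L = "\<lambda>N. (1 / ((1 - p) * h)) *\<^sub>R (transpose ?S ** N ** ?S)"
  let ?E = "xi_mean p (\<lambda>\<xi>. R \<xi> *\<^sub>R xi_matrix p \<xi>)"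
  have "D2 s p h \<phi> x = xi_mean p (\<lambda>\<xi>. ?L (Q \<xi> *\<^sub>R xi_matrix p \<xi>))"
    by (simp add: D2_def K2_xi_matrix Q_def matrix_scalar_ac mult.commute flip: scalar_matrix_assoc)
  also have "\<dots> = ?L (xi_mean p (\<lambda>\<xi>. Q \<xi> *\<^sub>R xi_matrix p \<xi>))"
    by (rule xi_mean_linear[OF p(1) p1 linear_congruence])
  also have "\<dots> = ?L ((2 * (h / 2) * (1 - p)) *\<^sub>R B) + ?L (h *\<^sub>R ?E)"
    unfolding xi_mean_expansion_2[OF p(1) p1 B_Sym Q_eq]
    by (rule linear_add[OF linear_congruence])
  also have "?L ((2 * (h / 2) * (1 - p)) *\<^sub>R B) = M"
  proof -
    have "transpose ?S ** B ** ?S = transpose (s ** ?S) ** M ** (s ** ?S)"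
      by (simp add: B_def matrix_transpose_mul matrix_mul_assoc)
    then show ?thesis
      using h p by (simp add: matrix_scalar_ac matrix_inv_mult(1)[OF s] flip: scalar_matrix_assoc)
  qed
  also have "?L (h *\<^sub>R ?E) = (1 / (1 - p)) *\<^sub>R (transpose ?S ** ?E ** ?S)"
    using h by (simp add: matrix_scalar_ac flip: scalar_matrix_assoc)
  finally have e: "D2 s p h \<phi> x - M = (1 / (1 - p)) *\<^sub>R (transpose ?S ** ?E ** ?S)" by simp
  let ?C = "2 * real CARD('d) * k + real CARD('d)"
  have "norm ?E \<le> \<delta> * ?C"
  proof (rule norm_xi_mean_le[OF p(1) p1])
    fix \<xi> :: "real^'d" assume \<xi>: "\<xi> \<in> set_pmf (xi_law p)"
    have "2 * real CARD('d) / p \<le> 2 * real CARD('d) * k"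
      using mult_left_mono[OF k(2), of "2 * real CARD('d)"] by simp
    then have "norm (xi_matrix p \<xi>) \<le> ?C"
      using norm_xi_matrix[OF p \<xi>] by linarith
    then show "norm (R \<xi> *\<^sub>R xi_matrix p \<xi>) \<le> \<delta> * ?C"
      unfolding norm_scaleR real_norm_def using pos by (intro mult_mono R_le \<xi>) auto
  qed
  then have "norm (transpose ?S ** ?E ** ?S) \<le> (k * (\<delta> * ?C)) * k"
    using k(1) pos
    by (intro order_trans[OF norm_matrix_mult] mult_mono) (auto simp: norm_transpose)
  moreover have "1 / (1 - p) \<le> 3 / 2" using p by (simp add: field_simps)
  ultimately have "norm (D2 s p h \<phi> x - M) \<le> 3 / 2 * ((k * (\<delta> * ?C)) * k)"
    unfolding e norm_scaleR using p by (intro mult_mono) auto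
  then show ?thesis by (simp add: power2_eq_square mult_ac)
qed

end

text \<open>A constant equals its Taylor polynomial, so the expansions apply with \<delta> = 0 and
  become exact.\<close>

lemma difference_operators_const:
  assumes "0 < p" "p \<le> 1 / 3" "invertible s" "0 < h"
  shows "D0 s p h (\<lambda>_. c) x = c" "D1 s p h (\<lambda>_. c) x = 0" "D2 s p h (\<lambda>_. c) x = 0"
proof -
  have S: "(0 :: real^'a^'a) \<in> Sym" by (simp add: Sym_def transpose_def vec_eq_iff)
  have k: "norm (matrix_inv s) \<le> max (norm (matrix_inv s)) (1 / p)"
      "1 / p \<le> max (norm (matrix_inv s)) (1 / p)" by auto
  show "D0 s p h (\<lambda>_. c) x = c" by (simp add: D0_def)
  show "D1 s p h (\<lambda>_. c) x = 0"
    using D1_expansion[OF assms(1-3) S assms(4) k, of "\<lambda>_. c" x c 0 0 0] by simp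
  show "D2 s p h (\<lambda>_. c) x = 0"
    using D2_expansion[OF assms(1-3) S assms(4) k, of "\<lambda>_. c" x c 0 0 0] by simp
qed

definition nonlinearity_lipschitz :: "real \<Rightarrow> 'd::finite nonlinearity \<Rightarrow> real \<Rightarrow> bool" where
  "nonlinearity_lipschitz T G L \<longleftrightarrow> 0 \<le> L \<and> (\<forall>t\<in>{0..T}. \<forall>x y z x' y' z'. \<forall>\<gamma>\<in>Sym. \<forall>\<gamma>'\<in>Sym.
     \<bar>G t x y z \<gamma> - G t x' y' z' \<gamma>'\<bar> \<le> L * (norm (x - x') + \<bar>y - y'\<bar> + norm (z - z') + norm (\<gamma> - \<gamma>')))"

lemma nonlinearity_lipschitzD:
  assumes "nonlinearity_lipschitz T G L" "0 \<le> t" "t \<le> T" "\<gamma> \<in> Sym" "\<gamma>' \<in> Sym"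
  shows "\<bar>G t x y z \<gamma> - G t x' y' z' \<gamma>'\<bar> \<le> L * (norm (x - x') + \<bar>y - y'\<bar> + norm (z - z') + norm (\<gamma> - \<gamma>'))"
  using assms by (auto simp: nonlinearity_lipschitz_def)

text \<open>One constant for all coefficient bounds, uniform over the strip, so that later estimates
  depend on (t, x) only through \<open>k\<close>.\<close>

definition scheme_bound :: "real \<Rightarrow> ('d::finite spacetime \<Rightarrow> real^'d^'d) \<Rightarrow> ('d spacetime \<Rightarrow> real) \<Rightarrow> real \<Rightarrow> bool" where
  "scheme_bound T \<sigma>0 p k \<longleftrightarrow> (\<forall>q\<in>strip T. invertible (\<sigma>0 q) \<and> 0 < p q \<and> p q \<le> 1 / 3 \<and>
     norm (\<sigma>0 q) \<le> k \<and> norm (matrix_inv (\<sigma>0 q)) \<le> k \<and> 1 / p q \<le> k)"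

lemma T_op_const:
  assumes "scheme_bound T \<sigma>0 p k" "0 \<le> t" "t \<le> T" "0 < h"
  shows "T_op G \<sigma>0 p t h (\<lambda>_. c) x = c + h * G t x c 0 0"
proof -
  have "(t, x) \<in> strip T" using assms by (simp add: strip_def)
  then show ?thesis
    using assms by (simp add: scheme_bound_def T_op_def difference_operators_const F_of_def)
qed

lemma smooth_locally_bounded:
  fixes f :: "'d::finite spacetime \<Rightarrow> 'b::real_normed_vector"
  assumes "continuous_on UNIV f"
  obtains m where "\<And>t x. 0 \<le> t \<Longrightarrow> t \<le> T \<Longrightarrow> norm x \<le> R \<Longrightarrow> norm (f (t, x)) \<le> m"
proof -
  have "compact (f ` ({0..T} \<times> cball 0 R))"
    by (intro compact_continuous_image compact_Times continuous_on_subset[OF assms]) auto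
  then obtain m where "\<forall>y \<in> f ` ({0..T} \<times> cball 0 R). norm y \<le> m"
    using compact_imp_bounded bounded_iff by metis
  then show thesis by (intro that[of m]) auto
qed

text \<open>The threshold \<open>h1\<close> is chosen before the additive constant \<open>c\<close>.
  The limit argument shifts the test function by a gap depending on the number of steps; such a
  shift changes neither the derivatives nor the remainder, and enters only the y argument of
  \<open>G\<close>.\<close>

lemma T_op_consistent:
  fixes G :: "'d::finite nonlinearity"
  assumes sb: "scheme_bound T \<sigma>0 p k" and lip: "nonlinearity_lipschitz T G L"
    and f: "smooth f" and \<delta>: "\<delta> > 0"
  obtains h1 where "h1 > 0" "\<And>t x h c. 0 \<le> t \<Longrightarrow> t \<le> T \<Longrightarrow> norm x \<le> R \<Longrightarrow> 0 < h \<Longrightarrow> h < h1 \<Longrightarrow>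
      \<bar>T_op G \<sigma>0 p t h (\<lambda>y. f (t + h, y) + c) x -
        (f (t, x) + c + h * (dt f (t, x) + G t x (f (t, x) + c) (grad f (t, x)) (hess f (t, x))))\<bar> \<le> \<delta> * h"
proof -
  obtain m1 where m1: "\<And>t x. 0 \<le> t \<Longrightarrow> t \<le> T \<Longrightarrow> norm x \<le> R \<Longrightarrow> norm (dt f (t, x)) \<le> m1"
    using smooth_locally_bounded[OF smooth_continuous[OF smooth_dt[OF f]]] by metis
  obtain m2 where m2: "\<And>t x. 0 \<le> t \<Longrightarrow> t \<le> T \<Longrightarrow> norm x \<le> R \<Longrightarrow> norm (hess f (t, x)) \<le> m2"
    using smooth_locally_bounded[OF continuous_on_hess[OF f]] by metis
  let ?d = "real CARD('d)"
  define C1 where "C1 = \<bar>k\<bar> * sqrt (?d * \<bar>k\<bar>)"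
  define C2 where "C2 = 3 / 2 * k\<^sup>2 * (2 * ?d * \<bar>k\<bar> + ?d)"
  \<comment> \<open>All errors proportional to \<open>\<delta>'\<close>: 1 from \<open>D0\<close>,
    \<open>L * (C1 + C2)\<close> from \<open>G\<close>, and \<open>k\<^sup>2 * C2\<close> from the
    subtracted diffusion.\<close>
  define C where "C = 1 + L * (C1 + C2) + k\<^sup>2 * C2"
  \<comment> \<open>\<open>D0\<close> differs from the value at (t, x) by at most h m; the summand 1
    absorbs the remainder, as \<open>\<delta>'\<close> is at most 1.\<close>
  define m where "m = \<bar>m1\<bar> + k\<^sup>2 * \<bar>m2\<bar> + 1"
  have L: "0 \<le> L" using lip by (simp add: nonlinearity_lipschitz_def)
  have C: "C1 \<ge> 0" "C2 \<ge> 0" "C \<ge> 1" using L by (auto simp: C_def C1_def C2_def)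
  \<comment> \<open>Half of the tolerance is reserved for the errors collected in \<open>C\<close>;
    the other half covers h L m through the choice of \<open>h1\<close>.\<close>
  define \<delta>' where "\<delta>' = min 1 (\<delta> / (2 * C))"
  have \<delta>': "0 < \<delta>'" "\<delta>' \<le> 1" "\<delta>' * C \<le> \<delta> / 2"
    using C \<delta> by (auto simp: \<delta>'_def min_def field_simps)
  have m: "m \<ge> 1" by (simp add: m_def)
  obtain h0 where h0: "h0 > 0"
    "\<And>t x w h. \<bar>t\<bar> \<le> max R T \<Longrightarrow> norm x \<le> max R T \<Longrightarrow> norm w \<le> \<bar>k\<bar> * sqrt (?d * \<bar>k\<bar>) \<Longrightarrow> 0 < h \<Longrightarrow> h < h0 \<Longrightarrow>
      \<bar>f (t + h, x + sqrt h *\<^sub>R w) - (f (t, x) + sqrt h * (grad f (t, x) \<bullet> w) +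
         h * (dt f (t, x) + (w \<bullet> (hess f (t, x) *v w)) / 2))\<bar> \<le> \<delta>' * h"
    using parabolic_taylor[OF f \<delta>'(1)] by metis
  define h1 where "h1 = min (min 1 h0) (\<delta> / (2 * (L * m + 1)))"
  have Lm: "0 < 2 * (L * m + 1)" using L m by (simp add: add_nonneg_pos)
  show thesis
  proof
    from Lm show "h1 > 0" using h0 \<delta> unfolding h1_def by (intro min_less_iff_conj[THEN iffD2] conjI divide_pos_pos) auto
    fix t h c :: real and x :: "real^'d"
    assume t: "0 \<le> t" "t \<le> T" and x: "norm x \<le> R" and h: "0 < h" "h < h1"
    have h': "h \<le> 1" "h < h0" "h * (L * m) \<le> \<delta> / 2"
    proof -
      have "h * (2 * (L * m + 1)) \<le> \<delta>"
        using h pos_less_divide_eq[OF Lm, of h \<delta>] by (simp add: h1_def)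
      then show "h * (L * m) \<le> \<delta> / 2" using h by (simp add: algebra_simps)
    qed (use h in \<open>auto simp: h1_def\<close>)
    define s where "s = \<sigma>0 (t, x)"
    define P where "P = p (t, x)"
    have "(t, x) \<in> strip T" using t by (simp add: strip_def)
    then have b: "invertible s" "0 < P" "P \<le> 1 / 3" "norm s \<le> k" "norm (matrix_inv s) \<le> k" "1 / P \<le> k"
      using sb by (auto simp: scheme_bound_def s_def P_def)
    have k: "0 \<le> k" using b(4) norm_ge_zero order_trans by blast
    let ?M = "hess f (t, x)" and ?\<phi> = "\<lambda>y. f (t + h, y) + c"
    have M: "?M \<in> Sym" by (rule hess_Sym[OF f])
    have near: "\<bar>?\<phi> (x + sqrt h *\<^sub>R (s *v \<xi>)) - ((f (t, x) + c) + sqrt h * (grad f (t, x) \<bullet> (s *v \<xi>)) +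
         h * (dt f (t, x) + ((s *v \<xi>) \<bullet> (?M *v (s *v \<xi>))) / 2))\<bar> \<le> \<delta>' * h"
      if \<xi>: "\<xi> \<in> set_pmf (xi_law P)" for \<xi>
    proof -
      have "?d / P \<le> ?d * k" using mult_left_mono[OF b(6), of ?d] by simp
      then have "norm \<xi> \<le> sqrt (?d * k)"
        using norm_xi_le[OF b(2) _ \<xi>] b(3) real_sqrt_le_mono order_trans by fastforce
      then have "norm (s *v \<xi>) \<le> k * sqrt (?d * k)"
        using k b(4) by (intro order_trans[OF norm_matrix_vector_mult] mult_mono) auto
      then have "\<bar>f (t + h, x + sqrt h *\<^sub>R (s *v \<xi>)) - (f (t, x) + sqrt h * (grad f (t, x) \<bullet> (s *v \<xi>)) +
         h * (dt f (t, x) + ((s *v \<xi>) \<bullet> (?M *v (s *v \<xi>))) / 2))\<bar> \<le> \<delta>' * h"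
        using t x h h' k by (intro h0(2)) auto
      then show ?thesis by (simp add: algebra_simps)
    qed
    note D = D0_expansion[OF b(2,3,1) M h(1) b(5,6) near] D1_expansion[OF b(2,3,1) M h(1) b(5,6) near]
      D2_expansion[OF b(2,3,1) M h(1) b(5,6) near]
    define E0 where "E0 = D0 s P h ?\<phi> x"
    define E1 where "E1 = D1 s P h ?\<phi> x"
    define E2 where "E2 = D2 s P h ?\<phi> x"
    define A where "A = s ** transpose s"
    have E2S: "E2 \<in> Sym" unfolding E2_def using b by (intro D2_Sym) auto
    have e0: "\<bar>E0 - (f (t, x) + c + h * dt f (t, x) + h / 2 * (A \<bullet> ?M))\<bar> \<le> \<delta>' * h"
      using D(1) by (simp add: E0_def A_def)
    have "\<delta>' * C1 * sqrt h \<le> \<delta>' * C1 * 1" using h' \<delta>' C by (intro mult_left_mono) auto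
    then have e1: "norm (E1 - grad f (t, x)) \<le> \<delta>' * C1"
      using D(2) k by (simp add: E1_def C1_def)
    have e2: "norm (E2 - ?M) \<le> \<delta>' * C2"
      using D(3) k by (simp add: E2_def C2_def)
    have A: "norm A \<le> k\<^sup>2"
      unfolding A_def power2_eq_square using b(4) k
      by (intro order_trans[OF norm_matrix_mult] mult_mono) (auto simp: norm_transpose)
    have AM: "\<bar>A \<bullet> N\<bar> \<le> k\<^sup>2 * norm N" for N
      using A by (intro order_trans[OF Cauchy_Schwarz_ineq2] mult_right_mono) auto
    have e0': "\<bar>E0 - (f (t, x) + c)\<bar> \<le> h * m"
    proof -
      have "\<bar>A \<bullet> ?M\<bar> \<le> k\<^sup>2 * \<bar>m2\<bar>"
        using m2[OF t x] by (intro order_trans[OF AM] mult_left_mono) auto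
      moreover have "\<bar>dt f (t, x)\<bar> \<le> \<bar>m1\<bar>" using m1[OF t x] by simp
      ultimately have "\<bar>dt f (t, x) + (A \<bullet> ?M) / 2\<bar> \<le> \<bar>m1\<bar> + k\<^sup>2 * \<bar>m2\<bar>" by linarith
      then have "h * \<bar>dt f (t, x) + (A \<bullet> ?M) / 2\<bar> \<le> h * (m - 1)"
        using h by (intro mult_left_mono) (auto simp: m_def)
      moreover have "h * dt f (t, x) + h / 2 * (A \<bullet> ?M) = h * (dt f (t, x) + (A \<bullet> ?M) / 2)"
        by (simp add: algebra_simps)
      ultimately have "\<bar>h * dt f (t, x) + h / 2 * (A \<bullet> ?M)\<bar> \<le> h * (m - 1)"
        using h by (simp only: abs_mult abs_of_pos)
      moreover have "\<delta>' * h \<le> h" using \<delta>' h by simp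
      moreover have "h * (m - 1) = h * m - h" by (simp add: algebra_simps)
      ultimately show ?thesis using e0 by arith
    qed
    define g where "g = G t x (f (t, x) + c) (grad f (t, x)) ?M"
    have "\<bar>G t x E0 E1 E2 - g\<bar> \<le> L * (norm (x - x) + \<bar>E0 - (f (t, x) + c)\<bar> +
        norm (E1 - grad f (t, x)) + norm (E2 - ?M))"
      unfolding g_def using t E2S M by (intro nonlinearity_lipschitzD[OF lip])
    also have "\<dots> \<le> L * (0 + h * m + \<delta>' * C1 + \<delta>' * C2)"
      using e0' e1 e2 L by (intro mult_left_mono add_mono) auto
    finally have eG: "\<bar>G t x E0 E1 E2 - g\<bar> \<le> L * (h * m + \<delta>' * C1 + \<delta>' * C2)" by simp
    have half: "\<bar>u + v / 2\<bar> \<le> c1 + c2" if "\<bar>u\<bar> \<le> c1" "\<bar>v\<bar> \<le> c2" for u v c1 c2 :: real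
      using that by linarith
    have "\<bar>A \<bullet> ?M - A \<bullet> E2\<bar> \<le> k\<^sup>2 * (\<delta>' * C2)"
      unfolding inner_diff_right[symmetric] using e2
      by (intro order_trans[OF AM] mult_left_mono) (auto simp: norm_minus_commute)
    then have "\<bar>G t x E0 E1 E2 - g + (A \<bullet> ?M - A \<bullet> E2) / 2\<bar> \<le> L * (h * m + \<delta>' * C1 + \<delta>' * C2) + k\<^sup>2 * (\<delta>' * C2)"
      using eG half[of "G t x E0 E1 E2 - g" _ "A \<bullet> ?M - A \<bullet> E2"] by blast
    then have eh: "h * \<bar>G t x E0 E1 E2 - g + (A \<bullet> ?M - A \<bullet> E2) / 2\<bar>
        \<le> h * (L * (h * m + \<delta>' * C1 + \<delta>' * C2) + k\<^sup>2 * (\<delta>' * C2))"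
      using h by (intro mult_left_mono) auto
    \<comment> \<open>The diffusion produced by \<open>D0\<close> cancels the one subtracted in
      \<open>F_of\<close>, up to \<open>A\<close> paired with the error of
      \<open>D2\<close>.\<close>
    have "T_op G \<sigma>0 p t h ?\<phi> x - (f (t, x) + c + h * (dt f (t, x) + g))
       = (E0 - (f (t, x) + c + h * dt f (t, x) + h / 2 * (A \<bullet> ?M)))
         + h * (G t x E0 E1 E2 - g + (A \<bullet> ?M - A \<bullet> E2) / 2)"
      unfolding T_op_def F_of_def s_def[symmetric] P_def[symmetric] A_def[symmetric]
        E0_def[symmetric] E1_def[symmetric] E2_def[symmetric]
      by (simp add: algebra_simps add_divide_distrib diff_divide_distrib)
    moreover have "\<bar>u + h * v\<bar> \<le> \<bar>u\<bar> + h * \<bar>v\<bar>" for u v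
      using h abs_triangle_ineq[of u "h * v"] by (simp add: abs_mult)
    ultimately have "\<bar>T_op G \<sigma>0 p t h ?\<phi> x - (f (t, x) + c + h * (dt f (t, x) + g))\<bar>
       \<le> \<bar>E0 - (f (t, x) + c + h * dt f (t, x) + h / 2 * (A \<bullet> ?M))\<bar>
         + h * \<bar>G t x E0 E1 E2 - g + (A \<bullet> ?M - A \<bullet> E2) / 2\<bar>"
      by (simp only:)
    also have "\<dots> \<le> \<delta>' * h + h * (L * (h * m + \<delta>' * C1 + \<delta>' * C2) + k\<^sup>2 * (\<delta>' * C2))"
      by (intro add_mono e0 eh)
    also have "\<dots> = h * (\<delta>' * C + h * (L * m))" by (simp add: C_def algebra_simps)
    also have "\<dots> \<le> h * \<delta>" using \<delta>' h' h by (intro mult_left_mono) auto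
    finally show "\<bar>T_op G \<sigma>0 p t h ?\<phi> x -
        (f (t, x) + c + h * (dt f (t, x) + G t x (f (t, x) + c) (grad f (t, x)) ?M))\<bar> \<le> \<delta> * h"
      by (simp add: g_def mult.commute)
  qed
qed

section \<open>Derivatives of the nonlinearity\<close>

text \<open>For a derivative within a set, only directions along a segment inside the set can be
  tested. The difference quotients along that segment converge to \<open>f' v\<close> and inherit
  the bound.\<close>

lemma directional_derivative_bound:
  fixes f :: "'a::real_normed_vector \<Rightarrow> real"
  assumes f: "(f has_derivative f') (at a within S)"
    and S: "\<And>r. 0 \<le> r \<Longrightarrow> r \<le> 1 \<Longrightarrow> a + r *\<^sub>R v \<in> S"
    and le: "\<And>r. 0 \<le> r \<Longrightarrow> r \<le> 1 \<Longrightarrow> \<bar>f (a + r *\<^sub>R v) - f a\<bar> \<le> c * r"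
  shows "\<bar>f' v\<bar> \<le> c"
proof -
  let ?F = "at 0 within {0..1::real}"
  have "((\<lambda>r. a + r *\<^sub>R v) has_derivative (\<lambda>r. r *\<^sub>R v)) ?F"
    by (auto intro!: derivative_eq_intros)
  moreover have "(f has_derivative f') (at (a + 0 *\<^sub>R v) within (\<lambda>r. a + r *\<^sub>R v) ` {0..1})"
    using S by (auto intro: has_derivative_subset[OF f])
  ultimately have "((\<lambda>r. f (a + r *\<^sub>R v)) has_derivative (\<lambda>r. f' (r *\<^sub>R v))) ?F"
    by (rule has_derivative_in_compose)
  moreover have "(\<lambda>r. f' (r *\<^sub>R v)) = (*) (f' v)"
    using linear_scale[OF has_derivative_linear[OF f]] by (auto simp: fun_eq_iff)
  ultimately have "((\<lambda>r. f (a + r *\<^sub>R v)) has_real_derivative f' v) ?F"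
    by (simp add: has_field_derivative_def)
  then have "((\<lambda>r. (f (a + r *\<^sub>R v) - f a) / r) \<longlongrightarrow> f' v) ?F"
    by (simp add: has_field_derivative_iff)
  then have lim: "((\<lambda>r. \<bar>(f (a + r *\<^sub>R v) - f a) / r\<bar>) \<longlongrightarrow> \<bar>f' v\<bar>) ?F"
    by (rule tendsto_rabs)
  have "eventually (\<lambda>r. \<bar>(f (a + r *\<^sub>R v) - f a) / r\<bar> \<le> c) ?F"
    unfolding eventually_at_filter
    by (rule always_eventually) (use le in \<open>auto simp: abs_divide divide_le_eq\<close>)
  moreover have "?F \<noteq> bot" by (simp add: at_within_Icc_at_right)
  ultimately show ?thesis using tendsto_upperbound[OF lim] by blast
qed

lemma Sym_add: "A \<in> Sym \<Longrightarrow> B \<in> Sym \<Longrightarrow> A + B \<in> Sym"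
  by (simp add: Sym_def transpose_def vec_eq_iff)

lemma Sym_diff: "A \<in> Sym \<Longrightarrow> B \<in> Sym \<Longrightarrow> A - B \<in> Sym"
  by (simp add: Sym_def transpose_def vec_eq_iff)

lemma Sym_scaleR: "A \<in> Sym \<Longrightarrow> c *\<^sub>R A \<in> Sym"
  by (simp add: Sym_def transpose_scalar)

lemma Sym_0: "0 \<in> Sym"
  by (simp add: Sym_def transpose_def vec_eq_iff)

text \<open>The difference \<open>B - A\<close> of two symmetric representatives is itself an
  admissible direction. Testing with it gives a vanishing squared norm.\<close>

lemma G_gamma_eq:
  assumes A: "A \<in> Sym" "((\<lambda>\<eta>. G t x y z \<eta>) has_derivative (\<lambda>\<eta>. A \<bullet> \<eta>)) (at \<gamma> within Sym)"
    and \<gamma>: "\<gamma> \<in> Sym"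
  shows "G_gamma G t x y z \<gamma> = A"
  unfolding G_gamma_def
proof (rule the_equality)
  fix B assume B: "B \<in> Sym \<and> ((\<lambda>\<eta>. G t x y z \<eta>) has_derivative (\<lambda>\<eta>. B \<bullet> \<eta>)) (at \<gamma> within Sym)"
  have "((\<lambda>\<eta>. G t x y z \<eta> - G t x y z \<eta>) has_derivative (\<lambda>\<eta>. B \<bullet> \<eta> - A \<bullet> \<eta>)) (at \<gamma> within Sym)"
    using A B by (intro has_derivative_diff) auto
  then have "\<bar>B \<bullet> (B - A) - A \<bullet> (B - A)\<bar> \<le> 0"
    by (rule directional_derivative_bound) (use A B \<gamma> in \<open>auto intro!: Sym_add Sym_scaleR Sym_diff\<close>)
  then have "(B - A) \<bullet> (B - A) \<le> 0" by (simp add: inner_diff_left)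
  then have "(B - A) \<bullet> (B - A) = 0" by (intro antisym inner_ge_zero)
  then show "B = A" by simp
qed (use A in auto)

text \<open>Only the action of the \<open>\<gamma>\<close>-derivative on \<open>Sym\<close> is determined, so its representing matrix has
  to be symmetrised before it can be identified with \<open>G_gamma\<close>.\<close>

lemma nonlinearity_derivative:
  fixes G :: "'d::finite nonlinearity"
  assumes diff: "nonlinearity_differentiable T G" and lip: "nonlinearity_lipschitz T G L"
    and t: "0 \<le> t" "t \<le> T" and \<gamma>0: "\<gamma>0 \<in> Sym"
  obtains f' \<alpha> \<beta> where "\<bar>\<alpha>\<bar> \<le> L" "norm \<beta> \<le> L" "norm (G_gamma G t x y0 z0 \<gamma>0) \<le> L"
    "((\<lambda>(y, z, \<gamma>). G t x y z \<gamma>) has_derivative f') (at (y0, z0, \<gamma>0) within UNIV \<times> UNIV \<times> Sym)"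
    "\<And>b c \<eta>. \<eta> \<in> Sym \<Longrightarrow> f' (b, c, \<eta>) = \<alpha> * b + \<beta> \<bullet> c + G_gamma G t x y0 z0 \<gamma>0 \<bullet> \<eta>"
proof -
  let ?U = "UNIV \<times> UNIV \<times> (Sym :: (real^'d^'d) set)"
  define g where "g = (\<lambda>(y, z, \<gamma>). G t x y z \<gamma>)"
  have "g differentiable (at (y0, z0, \<gamma>0) within ?U)"
    using diff t \<gamma>0 unfolding nonlinearity_differentiable_def g_def by auto
  then obtain f' where f': "(g has_derivative f') (at (y0, z0, \<gamma>0) within ?U)"
    unfolding differentiable_def by blast
  have lin: "linear f'" by (rule has_derivative_linear[OF f'])
  have bound: "\<bar>f' (b, c, \<eta>)\<bar> \<le> L * (\<bar>b\<bar> + norm c + norm \<eta>)" if \<eta>: "\<eta> \<in> Sym" for b c \<eta>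
  proof (rule directional_derivative_bound[OF f'])
    fix s :: real assume s: "0 \<le> s" "s \<le> 1"
    show "(y0, z0, \<gamma>0) + s *\<^sub>R (b, c, \<eta>) \<in> ?U"
      using \<gamma>0 \<eta> by (auto intro!: Sym_add Sym_scaleR)
    have "\<bar>g ((y0, z0, \<gamma>0) + s *\<^sub>R (b, c, \<eta>)) - g (y0, z0, \<gamma>0)\<bar>
      \<le> L * (norm (x - x) + \<bar>(y0 + s * b) - y0\<bar> + norm ((z0 + s *\<^sub>R c) - z0) + norm ((\<gamma>0 + s *\<^sub>R \<eta>) - \<gamma>0))"
      using nonlinearity_lipschitzD[OF lip t Sym_add[OF \<gamma>0 Sym_scaleR[OF \<eta>]] \<gamma>0,
          where x = x and x' = x and y = "y0 + s * b" and y' = y0 and z = "z0 + s *\<^sub>R c" and z' = z0]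
      by (simp add: g_def)
    also have "\<dots> = L * (\<bar>b\<bar> + norm c + norm \<eta>) * s"
      using s by (simp add: abs_mult algebra_simps)
    finally show "\<bar>g ((y0, z0, \<gamma>0) + s *\<^sub>R (b, c, \<eta>)) - g (y0, z0, \<gamma>0)\<bar> \<le> L * (\<bar>b\<bar> + norm c + norm \<eta>) * s" .
  qed
  have split: "f' (b, c, \<eta>) = b * f' (1, 0, 0) + f' (0, c, 0) + f' (0, 0, \<eta>)" for b c \<eta>
  proof -
    have "f' (b, c, \<eta>) = f' (b *\<^sub>R (1, 0, 0) + ((0, c, 0) + (0, 0, \<eta>)))" by simp
    then show ?thesis by (simp only: linear_add[OF lin] linear_scale[OF lin] real_scaleR_def)
  qed
  have l2: "linear (\<lambda>c. f' (0, c, 0))"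
    by (rule linear_compose[OF _ lin, unfolded o_def]) (auto intro: linearI)
  have l3: "linear (\<lambda>\<eta>. f' (0, 0, \<eta>))"
    by (rule linear_compose[OF _ lin, unfolded o_def]) (auto intro: linearI)
  define \<alpha> where "\<alpha> = f' (1, 0, 0)"
  define \<beta> where "\<beta> = adjoint (\<lambda>c. f' (0, c, 0)) 1"
  define A0 where "A0 = adjoint (\<lambda>\<eta>. f' (0, 0, \<eta>)) 1"
  define A where "A = (1 / 2) *\<^sub>R (A0 + transpose A0)"
  have \<beta>: "f' (0, c, 0) = \<beta> \<bullet> c" for c
    using adjoint_works[OF l2, of c 1] by (simp add: \<beta>_def inner_commute)
  have A0: "f' (0, 0, \<eta>) = A0 \<bullet> \<eta>" for \<eta>
    using adjoint_works[OF l3, of \<eta> 1] by (simp add: A0_def inner_commute)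
  have AS: "A \<in> Sym" by (simp add: A_def Sym_def transpose_def vec_eq_iff add.commute)
  have A: "f' (0, 0, \<eta>) = A \<bullet> \<eta>" if "\<eta> \<in> Sym" for \<eta>
  proof -
    have "transpose A0 \<bullet> \<eta> = A0 \<bullet> \<eta>"
      using inner_transpose[of A0 \<eta>] that by (simp add: Sym_def)
    then show ?thesis by (simp add: A0 A_def inner_add_left)
  qed
  have "((\<lambda>\<eta>. g (y0, z0, \<eta>)) has_derivative (\<lambda>\<eta>. f' (0, 0, \<eta>))) (at \<gamma>0 within Sym)"
  proof (rule has_derivative_in_compose[where f = "\<lambda>\<eta>. (y0, z0, \<eta>)"])
    show "((\<lambda>\<eta>. (y0, z0, \<eta>)) has_derivative (\<lambda>\<eta>. (0, 0, \<eta>))) (at \<gamma>0 within Sym)"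
      by (auto intro!: derivative_eq_intros)
    show "(g has_derivative f') (at (y0, z0, \<gamma>0) within (\<lambda>\<eta>. (y0, z0, \<eta>)) ` Sym)"
      by (rule has_derivative_subset[OF f']) auto
  qed
  then have "((\<lambda>\<eta>. G t x y0 z0 \<eta>) has_derivative (\<lambda>\<eta>. A0 \<bullet> \<eta>)) (at \<gamma>0 within Sym)"
    by (simp add: g_def A0)
  then have "((\<lambda>\<eta>. G t x y0 z0 \<eta>) has_derivative (\<lambda>\<eta>. A \<bullet> \<eta>)) (at \<gamma>0 within Sym)"
    unfolding has_derivative_within
  proof (safe)
    assume lim: "((\<lambda>y. (1 / norm (y - \<gamma>0)) *\<^sub>R (G t x y0 z0 y - (G t x y0 z0 \<gamma>0 + A0 \<bullet> (y - \<gamma>0)))) \<longlongrightarrow> 0) (at \<gamma>0 within Sym)"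
    \<comment> \<open>Increments between symmetric matrices are symmetric, and there
      \<open>A0\<close> and its symmetrisation act alike.\<close>
    have "A0 \<bullet> (y - \<gamma>0) = A \<bullet> (y - \<gamma>0)" if "y \<in> Sym" for y
      using A[of "y - \<gamma>0"] A0[of "y - \<gamma>0"] Sym_diff[OF that \<gamma>0] by simp
    then show "((\<lambda>y. (1 / norm (y - \<gamma>0)) *\<^sub>R (G t x y0 z0 y - (G t x y0 z0 \<gamma>0 + A \<bullet> (y - \<gamma>0)))) \<longlongrightarrow> 0) (at \<gamma>0 within Sym)"
      by (intro Lim_transform_eventually[OF lim]) (auto simp: eventually_at_filter)
  qed (rule bounded_linear_inner_right)
  then have GA: "G_gamma G t x y0 z0 \<gamma>0 = A" by (intro G_gamma_eq AS \<gamma>0)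
  have L: "0 \<le> L" using lip by (simp add: nonlinearity_lipschitz_def)
  \<comment> \<open>Testing the functional with its own representing vector \<open>w\<close> yields
    |w|^2 \<le> L |w|.\<close>
  have cancel: "norm w \<le> L" if "w \<bullet> w \<le> L * norm w" for w :: "'e::real_inner"
  proof (cases "w = 0")
    case False
    then show ?thesis using that by (simp add: dot_square_norm power2_eq_square)
  qed (use L in simp)
  show thesis
  proof (rule that[of \<alpha> \<beta> f'])
    show "\<bar>\<alpha>\<bar> \<le> L" using bound[OF Sym_0, of 1 0] by (simp add: \<alpha>_def)
    show "norm \<beta> \<le> L" using bound[OF Sym_0, of 0 \<beta>] by (intro cancel) (simp add: \<beta>)
    show "norm (G_gamma G t x y0 z0 \<gamma>0) \<le> L"
      using bound[OF AS, of 0 0] A[OF AS] by (intro cancel) (simp add: GA)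
    show "((\<lambda>(y, z, \<gamma>). G t x y z \<gamma>) has_derivative f') (at (y0, z0, \<gamma>0) within ?U)"
      using f' by (simp add: g_def)
    show "f' (b, c, \<eta>) = \<alpha> * b + \<beta> \<bullet> c + G_gamma G t x y0 z0 \<gamma>0 \<bullet> \<eta>" if "\<eta> \<in> Sym" for b c \<eta>
      by (simp add: split[of b] \<alpha>_def \<beta> GA A[OF that] mult.commute)
  qed
qed

text \<open>The segment stays in the convex set of admissible arguments, and one intermediate point
  serves all variables. The second-order coefficient is thus a genuine value of
  \<open>G_gamma\<close>, to which the bounds in Assumption (M) apply directly.\<close>

lemma nonlinearity_mean_value:
  fixes G :: "'d::finite nonlinearity"
  assumes diff: "nonlinearity_differentiable T G" and lip: "nonlinearity_lipschitz T G L"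
    and t: "0 \<le> t" "t \<le> T" and S: "\<gamma> \<in> Sym" "\<gamma>' \<in> Sym"
  obtains \<alpha> \<beta> y0 z0 \<gamma>0 where "\<gamma>0 \<in> Sym" "\<bar>\<alpha>\<bar> \<le> L" "norm \<beta> \<le> L"
    "G t x y' z' \<gamma>' - G t x y z \<gamma> = \<alpha> * (y' - y) + \<beta> \<bullet> (z' - z) + G_gamma G t x y0 z0 \<gamma>0 \<bullet> (\<gamma>' - \<gamma>)"
proof -
  let ?U = "UNIV \<times> UNIV \<times> (Sym :: (real^'d^'d) set)"
  define g where "g = (\<lambda>(y, z, \<gamma>). G t x y z \<gamma>)"
  define a where "a = (y, z, \<gamma>)"
  define v where "v = (y' - y, z' - z, \<gamma>' - \<gamma>)"
  have av: "a + r *\<^sub>R v \<in> ?U" for r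
    using S by (auto simp: a_def v_def intro!: Sym_add Sym_scaleR Sym_diff)
  have "\<exists>f' \<alpha> \<beta>. \<bar>\<alpha>\<bar> \<le> L \<and> norm \<beta> \<le> L \<and> (g has_derivative f') (at u within ?U) \<and>
      f' v = \<alpha> * (y' - y) + \<beta> \<bullet> (z' - z) + G_gamma G t x (fst u) (fst (snd u)) (snd (snd u)) \<bullet> (\<gamma>' - \<gamma>)"
    if u: "u \<in> ?U" for u
  proof -
    have "(fst u, fst (snd u), snd (snd u)) = u" "snd (snd u) \<in> Sym" using u by auto
    then show ?thesis
      using nonlinearity_derivative[OF diff lip t, of "snd (snd u)" x "fst u" "fst (snd u)"]
        Sym_diff[OF S(2,1)] unfolding g_def v_def by metis
  qed
  then obtain D \<alpha> \<beta> where D: "\<And>u. u \<in> ?U \<Longrightarrow> \<bar>\<alpha> u\<bar> \<le> L \<and> norm (\<beta> u) \<le> L \<and>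
      (g has_derivative D u) (at u within ?U) \<and>
      D u v = \<alpha> u * (y' - y) + \<beta> u \<bullet> (z' - z) + G_gamma G t x (fst u) (fst (snd u)) (snd (snd u)) \<bullet> (\<gamma>' - \<gamma>)"
    by metis
  have "\<exists>r\<in>{0<..<1}. g (a + 1 *\<^sub>R v) - g (a + 0 *\<^sub>R v) = D (a + r *\<^sub>R v) ((1 - 0) *\<^sub>R v)"
  proof (rule mvt_simple)
    fix r :: real assume r: "0 \<le> r" "r \<le> 1"
    have "((\<lambda>r. a + r *\<^sub>R v) has_derivative (\<lambda>r. r *\<^sub>R v)) (at r within {0..1})"
      by (auto intro!: derivative_eq_intros)
    moreover have "(g has_derivative D (a + r *\<^sub>R v)) (at (a + r *\<^sub>R v) within (\<lambda>r. a + r *\<^sub>R v) ` {0..1})"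
    proof (rule has_derivative_subset)
      show "(g has_derivative D (a + r *\<^sub>R v)) (at (a + r *\<^sub>R v) within ?U)"
        using D[OF av[of r]] by blast
    qed (rule image_subsetI, rule av)
    ultimately show "((\<lambda>r. g (a + r *\<^sub>R v)) has_derivative (\<lambda>s. D (a + r *\<^sub>R v) (s *\<^sub>R v))) (at r within {0..1})"
      by (rule has_derivative_in_compose)
  qed auto
  then obtain r where r: "g (a + v) - g a = D (a + r *\<^sub>R v) v" by auto
  obtain y0 z0 \<gamma>0 where u: "a + r *\<^sub>R v = (y0, z0, \<gamma>0)" by (cases "a + r *\<^sub>R v") auto
  show thesis
  proof (rule that)
    have "g (a + v) - g a = G t x y' z' \<gamma>' - G t x y z \<gamma>" by (simp add: a_def v_def g_def)
    then show "G t x y' z' \<gamma>' - G t x y z \<gamma> = \<alpha> (y0, z0, \<gamma>0) * (y' - y) + \<beta> (y0, z0, \<gamma>0) \<bullet> (z' - z) +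
        G_gamma G t x y0 z0 \<gamma>0 \<bullet> (\<gamma>' - \<gamma>)"
      using r D[OF av[of r]] unfolding u by simp
  qed (use D[OF av[of r]] av[of r] in \<open>auto simp: u\<close>)
qed

section \<open>Monotonicity of the scheme\<close>

lemma mat_le_D: "mat_le A B \<Longrightarrow> v \<bullet> (A *v v) \<le> v \<bullet> (B *v v)"
  by (auto simp: mat_le_def matrix_vector_mult_diff_rdistrib inner_diff_right)

lemma diag_part_quadratic: "v \<bullet> (diag_part A *v v) = (\<Sum>i\<in>UNIV. A $ i $ i * (v $ i)\<^sup>2)"
proof -
  have "(\<Sum>j\<in>UNIV. (if i = j then A $ i $ j else 0) * v $ j) = A $ i $ i * v $ i" for i
    by (simp add: if_distribR if_distrib cong: if_cong)
  then show ?thesis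
    by (simp add: inner_vec_def matrix_vector_mult_def diag_part_def power2_eq_square mult_ac)
qed

lemma mat_1_quadratic:
  fixes v :: "real^'d"
  shows "v \<bullet> ((\<alpha> *\<^sub>R mat 1) *v v) = \<alpha> * (v \<bullet> v)"
  by (simp flip: scaleR_matrix_vector_assoc)

lemma mat_le_scaleR_mat_1_diag_part: "mat_le (\<alpha> *\<^sub>R mat 1) (diag_part A) \<longleftrightarrow> (\<forall>i. \<alpha> \<le> A $ i $ i)"
proof
  assume l: "mat_le (\<alpha> *\<^sub>R mat 1) (diag_part A)"
  show "\<forall>i. \<alpha> \<le> A $ i $ i"
  proof
    fix i
    have "(\<Sum>j\<in>UNIV. A $ j $ j * (axis i 1 $ j)\<^sup>2) = A $ i $ i"
      by (simp add: axis_def if_distrib[of "\<lambda>x. x\<^sup>2"] if_distrib[of "\<lambda>x. _ * x"] cong: if_cong)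
    then show "\<alpha> \<le> A $ i $ i"
      using mat_le_D[OF l, of "axis i 1"]
      unfolding mat_1_quadratic diag_part_quadratic by (simp add: inner_axis_axis)
  qed
next
  assume "\<forall>i. \<alpha> \<le> A $ i $ i"
  then have "(\<Sum>i\<in>UNIV. \<alpha> * (v $ i)\<^sup>2) \<le> (\<Sum>i\<in>UNIV. A $ i $ i * (v $ i)\<^sup>2)" for v :: "real^'a"
    by (intro sum_mono mult_right_mono) auto
  then have "\<alpha> * (v \<bullet> v) \<le> (\<Sum>i\<in>UNIV. A $ i $ i * (v $ i)\<^sup>2)" for v :: "real^'a"
    by (simp add: inner_vec_def power2_eq_square sum_distrib_left)
  then show "mat_le (\<alpha> *\<^sub>R mat 1) (diag_part A)"
    unfolding mat_le_def matrix_vector_mult_diff_rdistrib inner_diff_right diag_part_quadratic mat_1_quadratic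
    by (auto simp: Sym_def transpose_def diag_part_def mat_def vec_eq_iff)
qed

lemma mat_le_diag_part_scaleR_mat_1: "mat_le (diag_part A) (\<alpha> *\<^sub>R mat 1) \<longleftrightarrow> (\<forall>i. A $ i $ i \<le> \<alpha>)"
proof -
  have "diag_part (- A) = - diag_part A" by (simp add: diag_part_def vec_eq_iff)
  then have "mat_le (diag_part A) (\<alpha> *\<^sub>R mat 1) \<longleftrightarrow> mat_le ((- \<alpha>) *\<^sub>R mat 1) (diag_part (- A))"
    by (simp add: mat_le_def)
  then show ?thesis unfolding mat_le_scaleR_mat_1_diag_part by simp
qed

text \<open>The claim factors as (2 (1 + \<theta>) p - \<theta>) (1 - p) \<ge> 0, with the lower end
  of the range of p in the first factor. It provides the sign of \<alpha> - 2 p, needed to insert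
  the lower bound on the diagonal entries, and makes the radicand of \<open>c_p\<close>
  nonnegative.\<close>

lemma alpha_p_ge:
  fixes p \<theta> :: real
  assumes "0 \<le> \<theta>" "\<theta> / (2 * (1 + \<theta>)) \<le> p" "0 < p" "p \<le> 1 / 3"
  shows "2 * p \<le> (p * (2 + 3 * \<theta>) - \<theta>) / (p * (1 + \<theta>))"
proof -
  have "\<theta> \<le> 2 * (1 + \<theta>) * p" using assms by (simp add: field_simps)
  then have "0 \<le> (2 * (1 + \<theta>) * p - \<theta>) * (1 - p)" using assms by simp
  then have "2 * p * (p * (1 + \<theta>)) \<le> p * (2 + 3 * \<theta>) - \<theta>" by (simp add: algebra_simps)
  then show ?thesis using assms by (simp add: le_divide_eq)
qed

lemma inner_xi_matrix:
  "xi_matrix p \<xi> \<bullet> H = (1 - p) * (\<xi> \<bullet> (H *v \<xi>)) - (1 - 3 * p) * (\<Sum>i\<in>UNIV. H $ i $ i * (\<xi> $ i)\<^sup>2)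
     - 2 * p * (\<Sum>i\<in>UNIV. H $ i $ i)"
  unfolding xi_matrix_def inner_diff_left inner_scaleR_left inner_outer inner_diag_part inner_mat_1
  by (simp add: outer_def power2_eq_square mult.commute)

text \<open>Here \<open>H\<close> stands for \<open>Gtilde\<close>, and \<open>a\<close> and \<open>\<Lambda> a\<close> for \<open>alpha_lo\<close> and \<open>alpha_hi\<close>.  Each coordinate with \<open>\<xi>\<^sub>i = 0\<close> contributes at least \<open>p - 2 p \<Lambda> a\<close> because \<open>H\<^sub>i\<^sub>i \<le> \<Lambda> a\<close>, and each
  coordinate with \<open>\<xi>\<^sub>i \<noteq> 0\<close> contributes at least the same amount because \<open>H\<^sub>i\<^sub>i \<ge> a\<close>: the choice
  \<open>a = 1 / c\<^sub>p\<^sup>2\<close> balances the two cases.\<close>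

lemma xi_weight_bound:
  fixes H :: "real^'d::finite^'d" and p \<theta> a \<Lambda> :: real
  defines "\<alpha> \<equiv> (p * (2 + 3 * \<theta>) - \<theta>) / (p * (1 + \<theta>))"
  assumes p: "0 < p" "p \<le> 1 / 3" and \<theta>: "0 \<le> \<theta>" "\<theta> / (2 * (1 + \<theta>)) \<le> p"
    and a: "(2 * p * \<Lambda> + \<alpha> - 2 * p) * a = 1"
    and lo: "\<And>i. a \<le> H $ i $ i" and hi: "\<And>i. H $ i $ i \<le> \<Lambda> * a"
    and th: "(\<Sum>i\<in>UNIV. H $ i $ i * (\<xi> $ i)\<^sup>2) \<le> (1 + \<theta>) * (\<xi> \<bullet> (H *v \<xi>))"
    and supp: "\<And>i. (\<xi> $ i)\<^sup>2 = 0 \<or> (\<xi> $ i)\<^sup>2 = 1 / p"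
  shows "1 - p + p * real CARD('d) - 2 * p * real CARD('d) * \<Lambda> * a
    \<le> (1 - p) + (H - (1 / 2) *\<^sub>R mat 1) \<bullet> xi_matrix p \<xi>"
proof -
  let ?X = "\<Sum>i\<in>UNIV. H $ i $ i * (\<xi> $ i)\<^sup>2"
  have \<alpha>: "2 * p \<le> \<alpha>" unfolding \<alpha>_def using p \<theta> by (intro alpha_p_ge) auto
  have "(\<Sum>i\<in>(UNIV::'d set). p - 2 * p * \<Lambda> * a) \<le>
      (\<Sum>i\<in>UNIV. p - p * (\<xi> $ i)\<^sup>2 + p * \<alpha> * (H $ i $ i * (\<xi> $ i)\<^sup>2) - 2 * p * H $ i $ i)"
  proof (rule sum_mono)
    fix i
    show "p - 2 * p * \<Lambda> * a \<le> p - p * (\<xi> $ i)\<^sup>2 + p * \<alpha> * (H $ i $ i * (\<xi> $ i)\<^sup>2) - 2 * p * H $ i $ i"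
      using supp[of i]
    proof
      assume z: "(\<xi> $ i)\<^sup>2 = 0"
      have "2 * p * H $ i $ i \<le> 2 * p * (\<Lambda> * a)" using p hi by (intro mult_left_mono) auto
      then show ?thesis using z by simp
    next
      assume z: "(\<xi> $ i)\<^sup>2 = 1 / p"
      have "(\<alpha> - 2 * p) * a \<le> (\<alpha> - 2 * p) * H $ i $ i" using \<alpha> lo by (intro mult_left_mono) auto
      then have "p - 2 * p * \<Lambda> * a \<le> p - 1 + \<alpha> * H $ i $ i - 2 * p * H $ i $ i"
        using a by (simp add: algebra_simps)
      then show ?thesis unfolding z using p by simp
    qed
  qed
  also have "\<dots> = p * real CARD('d) - p * (\<xi> \<bullet> \<xi>) + p * \<alpha> * ?X - 2 * p * (\<Sum>i\<in>UNIV. H $ i $ i)"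
    by (simp add: sum_subtractf sum.distrib sum_distrib_left inner_vec_def power2_eq_square)
  also have "p * \<alpha> * ?X \<le> (1 - p) * (\<xi> \<bullet> (H *v \<xi>)) - (1 - 3 * p) * ?X"
  proof -
    \<comment> \<open>This is the origin of \<open>alpha_p\<close>: bounding the full form of
      \<open>H\<close> below by its diagonal form over 1 + \<theta>, and then subtracting the term
      with 1 - 3 p, leaves p \<alpha> times the diagonal form.\<close>
    have "p * \<alpha> = (p * (2 + 3 * \<theta>) - \<theta>) / (1 + \<theta>)" using p by (simp add: \<alpha>_def)
    also have "\<dots> = (1 - p) / (1 + \<theta>) - (1 - 3 * p)"
      using \<theta>(1) by (simp add: field_simps)
    finally have "p * \<alpha> = (1 - p) / (1 + \<theta>) - (1 - 3 * p)" .
    then have "p * \<alpha> * ?X = (1 - p) / (1 + \<theta>) * ?X - (1 - 3 * p) * ?X" by (simp add: left_diff_distrib)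
    moreover have "(1 - p) / (1 + \<theta>) * ?X \<le> (1 - p) / (1 + \<theta>) * ((1 + \<theta>) * (\<xi> \<bullet> (H *v \<xi>)))"
      using p \<theta>(1) by (intro mult_left_mono th) auto
    moreover have "(1 - p) / (1 + \<theta>) * ((1 + \<theta>) * (\<xi> \<bullet> (H *v \<xi>))) = (1 - p) * (\<xi> \<bullet> (H *v \<xi>))"
      using \<theta>(1) by simp
    ultimately show ?thesis by linarith
  qed
  finally have main: "(\<Sum>i\<in>(UNIV::'d set). p - 2 * p * \<Lambda> * a) \<le>
     p * real CARD('d) - p * (\<xi> \<bullet> \<xi>) + ((1 - p) * (\<xi> \<bullet> (H *v \<xi>)) - (1 - 3 * p) * ?X) -
     2 * p * (\<Sum>i\<in>UNIV. H $ i $ i)" by simp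
  have N1: "mat 1 \<bullet> xi_matrix p \<xi> = 2 * p * (\<xi> \<bullet> \<xi>) - 2 * p * real CARD('d)"
  proof -
    have "mat 1 \<bullet> xi_matrix p \<xi> = xi_matrix p \<xi> \<bullet> mat 1" by (rule inner_commute)
    also have "\<dots> = (1 - p) * (\<xi> \<bullet> \<xi>) - (1 - 3 * p) * (\<xi> \<bullet> \<xi>) - 2 * p * real CARD('d)"
      unfolding inner_xi_matrix matrix_vector_mul_lid by (simp add: mat_def inner_vec_def power2_eq_square)
    finally show ?thesis by (simp add: algebra_simps)
  qed
  have "(H - (1 / 2) *\<^sub>R mat 1) \<bullet> xi_matrix p \<xi> = (1 - p) * (\<xi> \<bullet> (H *v \<xi>)) - (1 - 3 * p) * ?X
     - 2 * p * (\<Sum>i\<in>UNIV. H $ i $ i) - p * (\<xi> \<bullet> \<xi>) + p * real CARD('d)"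
    unfolding inner_diff_left inner_scaleR_left N1 inner_commute[of H] inner_xi_matrix
    by (simp add: diff_divide_distrib)
  then show ?thesis using main by (simp add: algebra_simps)
qed

text \<open>As an infimum, \<open>theta\<close> need not be visibly admissible itself. Nearby
  admissible values suffice because the form ?Y is nonnegative, which follows from the nonnegative
  diagonal form below it.\<close>

lemma theta_quadratic:
  assumes \<theta>: "theta G \<sigma>0 t x = ereal \<theta>" and \<gamma>: "\<gamma> \<in> Sym"
    and pos: "\<And>i. 0 \<le> Gtilde G \<sigma>0 t x y z \<gamma> $ i $ i"
  defines "H \<equiv> Gtilde G \<sigma>0 t x y z \<gamma>"
  shows "(\<Sum>i\<in>UNIV. H $ i $ i * (v $ i)\<^sup>2) \<le> (1 + \<theta>) * (v \<bullet> (H *v v))"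
proof -
  let ?X = "\<Sum>i\<in>UNIV. H $ i $ i * (v $ i)\<^sup>2" and ?Y = "v \<bullet> (H *v v)"
  have X: "0 \<le> ?X" using pos by (intro sum_nonneg) (simp add: H_def)
  have near: "\<exists>\<theta>'. 0 \<le> \<theta>' \<and> \<theta>' < \<theta> + e \<and> ?X \<le> (1 + \<theta>') * ?Y" if "e > 0" for e
  proof -
    have "theta G \<sigma>0 t x < ereal (\<theta> + e)" using \<theta> that by simp
    then obtain \<theta>' where \<theta>': "0 \<le> \<theta>'" "\<theta>' < \<theta> + e"
        "mat_le (diag_part H) ((1 + \<theta>') *\<^sub>R H)"
      unfolding theta_def Inf_less_iff H_def using \<gamma> by auto
    have "?X \<le> (1 + \<theta>') * ?Y"
      using mat_le_D[OF \<theta>'(3), of v] unfolding diag_part_quadratic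
      by (simp flip: scaleR_matrix_vector_assoc)
    then show ?thesis using \<theta>' by blast
  qed
  have Y: "0 \<le> ?Y"
  proof -
    obtain \<theta>' where "0 \<le> \<theta>'" "?X \<le> (1 + \<theta>') * ?Y" using near[of 1] by auto
    then have "0 \<le> (1 + \<theta>') * ?Y" using X by linarith
    then show ?thesis using \<open>0 \<le> \<theta>'\<close> by (simp add: zero_le_mult_iff)
  qed
  have "?X \<le> (1 + \<theta>) * ?Y + e" if "e > 0" for e
  proof -
    \<comment> \<open>The slack is scaled by ?Y + 1 so that multiplication by ?Y costs at most
      \<open>e\<close>.\<close>
    have "e / (?Y + 1) > 0" using that Y by simp
    then obtain \<theta>' where "\<theta>' < \<theta> + e / (?Y + 1)" "?X \<le> (1 + \<theta>') * ?Y" using near by blast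
    then have "?X \<le> (1 + (\<theta> + e / (?Y + 1))) * ?Y"
      using Y by (intro order_trans[OF \<open>?X \<le> (1 + \<theta>') * ?Y\<close>] mult_right_mono) auto
    also have "\<dots> = (1 + \<theta>) * ?Y + e * (?Y / (?Y + 1))" by (simp add: algebra_simps)
    also have "\<dots> \<le> (1 + \<theta>) * ?Y + e * 1"
      using that Y by (intro add_left_mono mult_left_mono) auto
    finally show ?thesis by simp
  qed
  then show ?thesis by (rule field_le_epsilon)
qed

text \<open>The bound \<open>K\<close> makes \<open>alpha_hi\<close> finite; if \<open>alpha_hi\<close> were infinite, \<open>Lam\<close> would be the junk value 0.\<close>

lemma weight_bound:
  fixes G :: "'d::finite nonlinearity"
  assumes M1: "theta G \<sigma>0 t x \<le> 2"
    and P: "P \<in> p_range G \<sigma>0 t x"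
    and lam: "0 < lambda_p G \<sigma>0 P t x"
    and alo: "alpha_lo G \<sigma>0 t x = ereal (1 / (c_p G \<sigma>0 P t x)\<^sup>2)"
    and K: "\<And>y z \<gamma>. \<gamma> \<in> Sym \<Longrightarrow> norm (Gtilde G \<sigma>0 t x y z \<gamma>) \<le> K"
    and \<gamma>: "\<gamma> \<in> Sym" and \<xi>: "\<xi> \<in> set_pmf (xi_law P)"
  shows "lambda_p G \<sigma>0 P t x * norm (matrix_inv (\<sigma>0 (t, x)))
    \<le> (1 - P) + (Gtilde G \<sigma>0 t x y z \<gamma> - (1 / 2) *\<^sub>R mat 1) \<bullet> xi_matrix P \<xi>"
proof -
  define \<theta> where "\<theta> = real_of_ereal (theta G \<sigma>0 t x)"
  define c where "c = c_p G \<sigma>0 P t x"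
  define a where "a = 1 / c\<^sup>2"
  define \<Lambda> where "\<Lambda> = Lam G \<sigma>0 t x"
  define \<alpha> where "\<alpha> = (P * (2 + 3 * \<theta>) - \<theta>) / (P * (1 + \<theta>))"
  let ?H = "Gtilde G \<sigma>0 t x"
  have "0 \<le> theta G \<sigma>0 t x" unfolding theta_def by (rule Inf_greatest) auto
  then have \<theta>: "theta G \<sigma>0 t x = ereal \<theta>" "0 \<le> \<theta>"
    using M1 unfolding \<theta>_def by (cases "theta G \<sigma>0 t x"; simp)+
  have p: "0 < P" "P \<le> 1 / 3" "\<theta> / (2 * (1 + \<theta>)) \<le> P"
    using P by (auto simp: p_range_def \<theta>_def Let_def)
  \<comment> \<open>If c were 0, division by zero would make \<open>alpha_lo\<close> equal to 0 and
    hence \<open>lambda_p\<close> equal to 0.\<close>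
  have c0: "c \<noteq> 0" using lam alo by (auto simp: c_def lambda_p_def Let_def)
  then have a0: "0 < a" by (simp add: a_def)
  have alo': "alpha_lo G \<sigma>0 t x = ereal a" by (simp add: alo a_def c_def)
  have lo: "a \<le> ?H y z \<gamma> $ i $ i" if "\<gamma> \<in> Sym" for y z \<gamma> i
  proof -
    have "alpha_lo G \<sigma>0 t x \<le> ereal (?H y z \<gamma> $ i $ i)"
      unfolding alpha_lo_def mat_le_scaleR_mat_1_diag_part using that by (intro Sup_least) auto
    then show ?thesis by (simp add: alo')
  qed
  define b where "b = real_of_ereal (alpha_hi G \<sigma>0 t x)"
  have K_comp: "?H y z \<gamma> $ i $ i \<le> K" if "\<gamma> \<in> Sym" for y z \<gamma> i
    using K[OF that, of y z] Finite_Cartesian_Product.norm_nth_le[of "?H y z \<gamma>" i]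
      component_le_norm_cart[of "?H y z \<gamma> $ i" i] by linarith
  have "0 < K" using a0 lo[OF Sym_0] K_comp[OF Sym_0] by (meson less_le_trans)
  then have "alpha_hi G \<sigma>0 t x \<le> ereal K"
    unfolding alpha_hi_def mat_le_diag_part_scaleR_mat_1 using K_comp by (intro Inf_lower) auto
  moreover have "0 \<le> alpha_hi G \<sigma>0 t x" unfolding alpha_hi_def by (rule Inf_greatest) auto
  ultimately have b: "alpha_hi G \<sigma>0 t x = ereal b"
    unfolding b_def by (cases "alpha_hi G \<sigma>0 t x"; simp)+
  have hi: "?H y z \<gamma> $ i $ i \<le> b" if "\<gamma> \<in> Sym" for y z \<gamma> i
  proof -
    have "ereal (?H y z \<gamma> $ i $ i) \<le> alpha_hi G \<sigma>0 t x"
      unfolding alpha_hi_def mat_le_diag_part_scaleR_mat_1 using that by (intro Inf_greatest) auto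
    then show ?thesis by (simp add: b)
  qed
  have \<Lambda>: "\<Lambda> * a = b" using a0 by (simp add: \<Lambda>_def Lam_def b alo')
  have "0 < b" using a0 lo[OF Sym_0] hi[OF Sym_0] by (meson less_le_trans)
  then have \<Lambda>0: "0 < \<Lambda>" using \<Lambda> a0 by (metis zero_less_mult_pos2)
  have \<alpha>: "2 * P \<le> \<alpha>" unfolding \<alpha>_def using p \<theta>(2) by (intro alpha_p_ge) auto
  have c_eq: "c = sqrt (2 * P * \<Lambda> + \<alpha> - 2 * P)"
    by (simp add: c_def c_p_def \<Lambda>_def alpha_p_def \<alpha>_def \<theta>_def Let_def)
  have "0 \<le> 2 * P * \<Lambda>" using p \<Lambda>0 by simp
  \<comment> \<open>The root of a negative number is negative here, so squaring \<open>c\<close>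
    recovers the radicand only once its sign is known.\<close>
  then have r: "0 \<le> 2 * P * \<Lambda> + \<alpha> - 2 * P" using \<alpha> by linarith
  then have c2: "c\<^sup>2 = 2 * P * \<Lambda> + \<alpha> - 2 * P" and c: "0 < c"
    using c0 c_eq by (auto simp: order_less_le)
  have norm: "(2 * P * \<Lambda> + \<alpha> - 2 * P) * a = 1" using c0 by (simp add: a_def flip: c2)
  have "1 - P + P * real CARD('d) - 2 * P * real CARD('d) * \<Lambda> * a
    \<le> (1 - P) + (?H y z \<gamma> - (1 / 2) *\<^sub>R mat 1) \<bullet> xi_matrix P \<xi>"
  proof (rule xi_weight_bound)
    show "(2 * P * \<Lambda> + (P * (2 + 3 * \<theta>) - \<theta>) / (P * (1 + \<theta>)) - 2 * P) * a = 1"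
      using norm by (simp add: \<alpha>_def)
    show "(\<xi> $ i)\<^sup>2 = 0 \<or> (\<xi> $ i)\<^sup>2 = 1 / P" for i
      using set_xi_law[OF p(1) _ \<xi>, of i] p by (auto simp: power_divide)
    show "(\<Sum>i\<in>UNIV. ?H y z \<gamma> $ i $ i * (\<xi> $ i)\<^sup>2) \<le> (1 + \<theta>) * (\<xi> \<bullet> (?H y z \<gamma> *v \<xi>))"
      using lo[OF \<gamma>] a0 by (intro theta_quadratic[OF \<theta>(1) \<gamma>]) (meson less_imp_le less_le_trans)
  qed (use p \<theta> lo[OF \<gamma>] hi[OF \<gamma>] \<Lambda> in auto)
  moreover have "lambda_p G \<sigma>0 P t x * norm (matrix_inv (\<sigma>0 (t, x))) \<le>
      1 - P + P * real CARD('d) - 2 * P * real CARD('d) * \<Lambda> * a"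
  proof -
    let ?W = "1 - P + P * real CARD('d) - 2 * P * real CARD('d) * \<Lambda> * a"
    \<comment> \<open>With \<open>alpha_lo\<close> equal to 1 / c^2 the powers of c combine and
      \<open>lambda_p\<close> becomes the root of P times ?W over the norm of the inverse. Its
      positivity forces ?W \<ge> 0, which allows the factor \<open>sqrt P\<close> to be
      dropped.\<close>
    have "sqrt a = 1 / c" using c by (simp add: a_def real_sqrt_divide)
    then have "lambda_p G \<sigma>0 P t x = sqrt P * ((1 - P + P * real CARD('d)) * c - 2 * P * real CARD('d) * \<Lambda> / c)
       * (1 / c / norm (matrix_inv (\<sigma>0 (t, x))))"
      by (simp add: lambda_p_def Let_def alo' \<Lambda>_def c_def)
    also have "\<dots> = sqrt P * ?W / norm (matrix_inv (\<sigma>0 (t, x)))"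
      using c by (simp add: a_def field_simps power2_eq_square)
    finally have e: "lambda_p G \<sigma>0 P t x = sqrt P * ?W / norm (matrix_inv (\<sigma>0 (t, x)))" .
    then have n: "norm (matrix_inv (\<sigma>0 (t, x))) > 0" "0 < sqrt P * ?W"
      using lam by (auto simp: zero_less_divide_iff dest: order_less_le_trans[OF _ norm_ge_zero])
    then have "0 \<le> ?W" using p by (simp add: zero_less_mult_iff)
    moreover have "sqrt P \<le> 1" using p by simp
    ultimately have "sqrt P * ?W \<le> 1 * ?W" by (intro mult_right_mono)
    then show ?thesis using n unfolding e by simp
  qed
  ultimately show ?thesis by linarith
qed

text \<open>Transfers the factors of the inverse of \<open>\<sigma>0\<close> from \<open>K2\<close>
  to the derivative of the nonlinearity, where they form \<open>Gtilde\<close>.\<close>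

lemma inner_congruence:
  fixes A S N :: "real^'d^'d"
  shows "A \<bullet> (transpose S ** N ** S) = (S ** A ** transpose S) \<bullet> N"
proof -
  have "(transpose S ** N ** S) \<bullet> A = (transpose S ** N) \<bullet> (A ** transpose S)"
    by (rule inner_matrix_mult_right)
  also have "\<dots> = N \<bullet> (S ** (A ** transpose S))"
    by (simp add: inner_matrix_mult_left)
  finally show ?thesis by (simp add: inner_commute matrix_mul_assoc)
qed

text \<open>The mean value coefficients depend on \<phi> and \<psi> but not on \<xi>, so the
  increment is linear in the difference. Multiplying the weight by 1 - p clears the denominator of
  \<open>K2\<close>; the second-order part is then at least \<open>w\<close>, and
  \<open>small\<close> keeps the first- and zeroth-order part below it.\<close>

lemma T_op_mono:
  fixes G :: "'d::finite nonlinearity"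
  assumes diff: "nonlinearity_differentiable T G" and lip: "nonlinearity_lipschitz T G L"
    and sb: "scheme_bound T \<sigma>0 p k" and t: "0 \<le> t" "t \<le> T" and h: "0 < h"
    and w: "\<And>y z \<gamma> \<xi>. \<gamma> \<in> Sym \<Longrightarrow> \<xi> \<in> set_pmf (xi_law (p (t, x))) \<Longrightarrow>
      w \<le> (1 - p (t, x)) + (Gtilde G \<sigma>0 t x y z \<gamma> - (1 / 2) *\<^sub>R mat 1) \<bullet> xi_matrix (p (t, x)) \<xi>"
    and small: "h * L + sqrt h * (L * (k * sqrt (real CARD('d) * k))) \<le> w"
    and le: "\<And>\<xi>. \<xi> \<in> set_pmf (xi_law (p (t, x))) \<Longrightarrow>
      \<phi> (x + sqrt h *\<^sub>R (\<sigma>0 (t, x) *v \<xi>)) \<le> \<psi> (x + sqrt h *\<^sub>R (\<sigma>0 (t, x) *v \<xi>))"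
  shows "T_op G \<sigma>0 p t h \<phi> x \<le> T_op G \<sigma>0 p t h \<psi> x"
proof -
  define s where "s = \<sigma>0 (t, x)"
  define P where "P = p (t, x)"
  define S where "S = matrix_inv s"
  have "(t, x) \<in> strip T" using t by (simp add: strip_def)
  then have b: "invertible s" "0 < P" "P \<le> 1 / 3" "norm s \<le> k" "norm S \<le> k" "1 / P \<le> k"
    using sb by (auto simp: scheme_bound_def s_def P_def S_def)
  have P1: "P < 1" using b by simp
  have k: "0 \<le> k" using b(4) norm_ge_zero order_trans by blast
  have L: "0 \<le> L" using lip by (simp add: nonlinearity_lipschitz_def)
  have SS: "S ** s = mat 1" "s ** S = mat 1" using matrix_inv_mult[OF b(1)] by (simp_all add: S_def)
  have int: "integrable (measure_pmf (xi_law P)) f" for f :: "real^'d \<Rightarrow> 'z::{banach, second_countable_topology}"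
    by (rule xi_integrable[OF b(2) P1])
  define \<eta> where "\<eta> \<xi> = \<psi> (x + sqrt h *\<^sub>R (s *v \<xi>)) - \<phi> (x + sqrt h *\<^sub>R (s *v \<xi>))" for \<xi>
  obtain \<alpha> \<beta> y0 z0 \<gamma>0 where g: "\<gamma>0 \<in> Sym" "\<bar>\<alpha>\<bar> \<le> L" "norm \<beta> \<le> L"
    "G t x (D0 s P h \<psi> x) (D1 s P h \<psi> x) (D2 s P h \<psi> x) - G t x (D0 s P h \<phi> x) (D1 s P h \<phi> x) (D2 s P h \<phi> x)
      = \<alpha> * (D0 s P h \<psi> x - D0 s P h \<phi> x) + \<beta> \<bullet> (D1 s P h \<psi> x - D1 s P h \<phi> x) +
        G_gamma G t x y0 z0 \<gamma>0 \<bullet> (D2 s P h \<psi> x - D2 s P h \<phi> x)"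
    using nonlinearity_mean_value[OF diff lip t D2_Sym[OF b(2) P1] D2_Sym[OF b(2) P1]] by metis
  define A where "A = G_gamma G t x y0 z0 \<gamma>0 - (1 / 2) *\<^sub>R (s ** transpose s)"
  define W where "W \<xi> = 1 + h * (\<alpha> + \<beta> \<bullet> K1 s h \<xi> + A \<bullet> K2 s P h \<xi>)" for \<xi>
  have d0: "D0 s P h \<psi> x - D0 s P h \<phi> x = xi_mean P \<eta>"
    by (simp add: D0_def \<eta>_def[abs_def] int)
  have d1: "v \<bullet> (D1 s P h \<psi> x - D1 s P h \<phi> x) = xi_mean P (\<lambda>\<xi>. \<eta> \<xi> * (v \<bullet> K1 s h \<xi>))" for v
    unfolding D1_def Bochner_Integration.integral_diff[OF int int, symmetric]
      integral_inner_right[OF int, symmetric]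
    by (simp add: \<eta>_def inner_diff_right left_diff_distrib)
  have d2: "V \<bullet> (D2 s P h \<psi> x - D2 s P h \<phi> x) = xi_mean P (\<lambda>\<xi>. \<eta> \<xi> * (V \<bullet> K2 s P h \<xi>))" for V
    unfolding D2_def Bochner_Integration.integral_diff[OF int int, symmetric]
      integral_inner_right[OF int, symmetric]
    by (simp add: \<eta>_def inner_diff_right left_diff_distrib)
  have "T_op G \<sigma>0 p t h \<psi> x - T_op G \<sigma>0 p t h \<phi> x = (D0 s P h \<psi> x - D0 s P h \<phi> x) +
     h * ((G t x (D0 s P h \<psi> x) (D1 s P h \<psi> x) (D2 s P h \<psi> x) - G t x (D0 s P h \<phi> x) (D1 s P h \<phi> x) (D2 s P h \<phi> x))
        - 1 / 2 * ((s ** transpose s) \<bullet> (D2 s P h \<psi> x - D2 s P h \<phi> x)))"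
    unfolding T_op_def F_of_def s_def[symmetric] P_def[symmetric] inner_diff_right
    by (simp add: algebra_simps)
  also have "\<dots> = (D0 s P h \<psi> x - D0 s P h \<phi> x) + h * (\<alpha> * (D0 s P h \<psi> x - D0 s P h \<phi> x) +
      \<beta> \<bullet> (D1 s P h \<psi> x - D1 s P h \<phi> x) + A \<bullet> (D2 s P h \<psi> x - D2 s P h \<phi> x))"
    unfolding g(4) A_def inner_diff_left inner_scaleR_left by (simp add: algebra_simps)
  also have "\<dots> = xi_mean P (\<lambda>\<xi>. \<eta> \<xi> * W \<xi>)"
  proof -
    have "\<eta> \<xi> * W \<xi> = \<eta> \<xi> + h * (\<alpha> * \<eta> \<xi> + \<eta> \<xi> * (\<beta> \<bullet> K1 s h \<xi>) + \<eta> \<xi> * (A \<bullet> K2 s P h \<xi>))" for \<xi>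
      by (simp add: W_def algebra_simps)
    then show ?thesis unfolding d0 d1 d2 by (simp add: int)
  qed
  finally have e: "T_op G \<sigma>0 p t h \<psi> x - T_op G \<sigma>0 p t h \<phi> x = xi_mean P (\<lambda>\<xi>. \<eta> \<xi> * W \<xi>)" .
  have "0 \<le> W \<xi>" if \<xi>: "\<xi> \<in> set_pmf (xi_law P)" for \<xi>
  proof -
    \<comment> \<open>Conjugation sends the subtracted diffusion to the identity, whence the term
      with 1/2 in \<open>w\<close>.\<close>
    have "(S ** (s ** transpose s)) ** transpose S = mat 1"
    proof -
      have "(S ** (s ** transpose s)) ** transpose S = (S ** s) ** transpose (S ** s)"
        by (simp only: matrix_transpose_mul matrix_mul_assoc)
      then show ?thesis by (simp add: SS)
    qed
    then have HA: "S ** A ** transpose S = Gtilde G \<sigma>0 t x y0 z0 \<gamma>0 - (1 / 2) *\<^sub>R mat 1"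
      using linear_diff[OF linear_congruence[of 1 S "transpose S"]]
        linear_scale[OF linear_congruence[of 1 S "transpose S"]]
      by (simp add: A_def Gtilde_def S_def s_def)
    have "h * (A \<bullet> K2 s P h \<xi>) = 1 / (1 - P) * ((S ** A ** transpose S) \<bullet> xi_matrix P \<xi>)"
      using h P1 by (simp add: K2_xi_matrix inner_congruence S_def[symmetric])
    then have K2: "(1 - P) * (h * (A \<bullet> K2 s P h \<xi>)) = (S ** A ** transpose S) \<bullet> xi_matrix P \<xi>"
      using P1 by simp
    have "h * \<bar>\<alpha>\<bar> \<le> h * L" using h g(2) by (intro mult_left_mono) auto
    moreover have "h * \<bar>\<beta> \<bullet> K1 s h \<xi>\<bar> \<le> sqrt h * (L * (k * sqrt (real CARD('d) * k)))"
    proof -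
      have "real CARD('d) / P \<le> real CARD('d) * k"
        using mult_left_mono[OF b(6), of "real CARD('d)"] by simp
      then have "norm \<xi> \<le> sqrt (real CARD('d) * k)"
        using norm_xi_le[OF b(2) P1 \<xi>] real_sqrt_le_mono order_trans by blast
      then have "norm (transpose S *v \<xi>) \<le> k * sqrt (real CARD('d) * k)"
        using b(5) k by (intro order_trans[OF norm_matrix_vector_mult] mult_mono) (auto simp: norm_transpose)
      then have "\<bar>\<beta> \<bullet> (transpose S *v \<xi>)\<bar> \<le> L * (k * sqrt (real CARD('d) * k))"
        using g(3) L k by (intro order_trans[OF Cauchy_Schwarz_ineq2] mult_mono) auto
      then have "sqrt h * \<bar>\<beta> \<bullet> (transpose S *v \<xi>)\<bar> \<le> sqrt h * (L * (k * sqrt (real CARD('d) * k)))"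
        using h by (intro mult_left_mono) auto
      moreover have "h * \<bar>\<beta> \<bullet> K1 s h \<xi>\<bar> = h / sqrt h * \<bar>\<beta> \<bullet> (transpose S *v \<xi>)\<bar>"
        using h by (simp add: K1_def S_def abs_mult del: transpose_matrix_vector)
      then have "h * \<bar>\<beta> \<bullet> K1 s h \<xi>\<bar> = sqrt h * \<bar>\<beta> \<bullet> (transpose S *v \<xi>)\<bar>"
        using h by (simp only: real_div_sqrt less_imp_le)
      ultimately show ?thesis by simp
    qed
    moreover define u where "u = h * \<alpha> + h * (\<beta> \<bullet> K1 s h \<xi>)"
    moreover have "\<bar>u\<bar> \<le> h * \<bar>\<alpha>\<bar> + h * \<bar>\<beta> \<bullet> K1 s h \<xi>\<bar>"
      unfolding u_def using h abs_triangle_ineq[of "h * \<alpha>" "h * (\<beta> \<bullet> K1 s h \<xi>)"] by (simp add: abs_mult)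
    ultimately have u: "\<bar>u\<bar> \<le> w" using small by linarith
    have "(1 - P) * \<bar>u\<bar> \<le> 1 * \<bar>u\<bar>" using b(2) by (intro mult_right_mono) auto
    moreover have "\<bar>(1 - P) * u\<bar> = (1 - P) * \<bar>u\<bar>" using P1 by (simp add: abs_mult)
    ultimately have "\<bar>(1 - P) * u\<bar> \<le> w" using u by linarith
    moreover have "(1 - P) * W \<xi> = (1 - P) + (S ** A ** transpose S) \<bullet> xi_matrix P \<xi> + (1 - P) * u"
      unfolding W_def u_def K2[symmetric] by (simp add: algebra_simps)
    moreover have "w \<le> (1 - P) + (S ** A ** transpose S) \<bullet> xi_matrix P \<xi>"
      using w[OF g(1)] \<xi> by (simp add: HA P_def)
    ultimately have "0 \<le> (1 - P) * W \<xi>" by linarith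
    then show ?thesis using P1 by (simp add: zero_le_mult_iff)
  qed
  then have "0 \<le> xi_mean P (\<lambda>\<xi>. \<eta> \<xi> * W \<xi>)"
    using le by (intro integral_nonneg_AE AE_pmfI mult_nonneg_nonneg) (auto simp: \<eta>_def P_def s_def)
  then show ?thesis using e by simp
qed

text \<open>The radius C \<surd>h bounds the displacement \<surd>h \<open>\<sigma>0\<close> \<xi>,
  so an ordering within that distance of x suffices. All constants are uniform in (t, x).\<close>

lemma scheme_monotone:
  fixes G :: "'d::finite nonlinearity"
  assumes "0 < T" and diff: "nonlinearity_differentiable T G" and lip: "nonlinearity_lipschitz T G L"
    and adm: "admissible_pair T \<sigma>0 p" and M1: "M1 T G \<sigma>0" and M2: "M2 T G \<sigma>0 p"
  obtains k C h0 where "scheme_bound T \<sigma>0 p k" "0 \<le> C" "0 < h0"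
    "\<And>t h x \<phi> \<psi>. 0 \<le> t \<Longrightarrow> t \<le> T \<Longrightarrow> 0 < h \<Longrightarrow> h \<le> h0 \<Longrightarrow>
      (\<And>y. dist x y \<le> C * sqrt h \<Longrightarrow> \<phi> y \<le> \<psi> y) \<Longrightarrow> T_op G \<sigma>0 p t h \<phi> x \<le> T_op G \<sigma>0 p t h \<psi> x"
proof -
  have M2': "p (t, x) \<in> p_range G \<sigma>0 t x"
      "lambda_star T G \<sigma>0 / 2 \<le> ereal (lambda_p G \<sigma>0 (p (t, x)) t x)"
      "alpha_lo G \<sigma>0 t x = ereal (1 / (c_p G \<sigma>0 (p (t, x)) t x)\<^sup>2)" if "(t, x) \<in> strip T" for t x
    using M2 that unfolding M2_def by auto
  obtain k1 k2 k3 where k: "\<And>q. q \<in> strip T \<Longrightarrow> norm (\<sigma>0 q) \<le> k1"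
      "\<And>q. q \<in> strip T \<Longrightarrow> norm (matrix_inv (\<sigma>0 q)) \<le> k2" "\<And>q. q \<in> strip T \<Longrightarrow> norm (1 / p q) \<le> k3"
    using adm unfolding admissible_pair_def bounded_iff by (metis image_eqI)
  define k where "k = Max {1, k1, k2, k3}"
  have kk: "1 \<le> k" "k1 \<le> k" "k2 \<le> k" "k3 \<le> k" by (simp_all add: k_def)
  have sb: "scheme_bound T \<sigma>0 p k"
    unfolding scheme_bound_def
  proof safe
    fix t and x :: "real^'d" assume q: "(t, x) \<in> strip T"
    show "invertible (\<sigma>0 (t, x))" "0 < p (t, x)" using adm q by (auto simp: admissible_pair_def)
    show "p (t, x) \<le> 1 / 3" using M2'(1)[OF q] by (simp add: p_range_def Let_def)
    show "norm (\<sigma>0 (t, x)) \<le> k" "norm (matrix_inv (\<sigma>0 (t, x))) \<le> k" "1 / p (t, x) \<le> k"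
      using k[OF q] kk \<open>0 < p (t, x)\<close> by auto
  qed
  have ls: "0 < lambda_star T G \<sigma>0" using M1 by (simp add: M1_def)
  \<comment> \<open>As an extended infimum \<open>lambda_star\<close> could be infinite; (M2) at one
    point of the strip excludes this.\<close>
  have q0: "(0, 0) \<in> strip T" using \<open>0 < T\<close> by (simp add: strip_def)
  obtain l where l: "lambda_star T G \<sigma>0 = ereal l" "0 < l"
    using ls M2'(2)[OF q0] by (cases "lambda_star T G \<sigma>0") auto
  have lam: "l / 2 \<le> lambda_p G \<sigma>0 (p (t, x)) t x" if "(t, x) \<in> strip T" for t x
    using M2'(2)[OF that] l by simp
  have L: "0 \<le> L" using lip by (simp add: nonlinearity_lipschitz_def)
  let ?D = "real CARD('d)"
  \<comment> \<open>(M2) gives l / 2, and the norm of the inverse is at least 1 / k because the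
    norms of \<open>\<sigma>0\<close> and its inverse have product at least |I| \<ge> 1.\<close>
  define w where "w = l / 2 / k"
  define E where "E = L + L * (k * sqrt (?D * k)) + 1"
  have E: "1 \<le> E" using L kk by (simp add: E_def)
  have w: "0 < w" using l kk by (simp add: w_def)
  \<comment> \<open>For h at most 1 also h \<le> \<surd>h, so the lower-order terms are at most E
    \<surd>h, hence at most w.\<close>
  define h0 where "h0 = min 1 ((w / E)\<^sup>2)"
  show thesis
  proof (rule that[OF sb, of "k * sqrt (?D * k)" h0])
    show "0 \<le> k * sqrt (?D * k)" using kk by simp
    show "0 < h0" using w E by (simp add: h0_def)
    fix t h x and \<phi> \<psi> :: "real^'d \<Rightarrow> real"
    assume t: "0 \<le> t" "t \<le> T" and h: "0 < h" "h \<le> h0"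
      and le: "\<And>y. dist x y \<le> k * sqrt (?D * k) * sqrt h \<Longrightarrow> \<phi> y \<le> \<psi> y"
    have q: "(t, x) \<in> strip T" using t by (simp add: strip_def)
    note b = sb[unfolded scheme_bound_def, rule_format, OF q]
    show "T_op G \<sigma>0 p t h \<phi> x \<le> T_op G \<sigma>0 p t h \<psi> x"
    proof (rule T_op_mono[OF diff lip sb t h(1)])
      fix y z and \<gamma> :: "real^'d^'d" and \<xi> :: "real^'d" assume \<gamma>: "\<gamma> \<in> Sym" and \<xi>: "\<xi> \<in> set_pmf (xi_law (p (t, x)))"
      let ?S = "matrix_inv (\<sigma>0 (t, x))"
      have "norm (Gtilde G \<sigma>0 t x y z \<gamma>) \<le> (k * L) * k" if "\<gamma> \<in> Sym" for y z \<gamma>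
      proof -
        have "norm (G_gamma G t x y z \<gamma>) \<le> L"
          using nonlinearity_derivative[OF diff lip t that] by metis
        then show ?thesis
          unfolding Gtilde_def using b kk L
          by (intro order_trans[OF norm_matrix_mult] mult_mono) (auto simp: norm_transpose)
      qed
      then have "lambda_p G \<sigma>0 (p (t, x)) t x * norm ?S \<le>
          (1 - p (t, x)) + (Gtilde G \<sigma>0 t x y z \<gamma> - (1 / 2) *\<^sub>R mat 1) \<bullet> xi_matrix (p (t, x)) \<xi>"
        using M1 q lam[OF q] l(2) M2'[OF q] \<gamma> \<xi>
        by (intro weight_bound[where K = "k * L * k"]) (auto simp: M1_def)
      moreover have "w \<le> lambda_p G \<sigma>0 (p (t, x)) t x * norm ?S"
      proof -
        have "1 \<le> norm (mat 1 :: real^'d^'d)" by (simp add: norm_mat_1 Suc_leI)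
        also have "\<dots> \<le> norm (\<sigma>0 (t, x)) * norm ?S"
          using norm_matrix_mult[of "\<sigma>0 (t, x)" ?S] b by (simp add: matrix_inv_mult)
        also have "\<dots> \<le> k * norm ?S" using b by (intro mult_right_mono) auto
        finally have "1 / k \<le> norm ?S" using kk by (simp add: field_simps)
        then have "l / 2 * (1 / k) \<le> lambda_p G \<sigma>0 (p (t, x)) t x * norm ?S"
          using lam[OF q] l kk by (intro mult_mono) auto
        then show ?thesis by (simp add: w_def)
      qed
      ultimately show "w \<le> (1 - p (t, x)) + (Gtilde G \<sigma>0 t x y z \<gamma> - (1 / 2) *\<^sub>R mat 1) \<bullet> xi_matrix (p (t, x)) \<xi>"
        by linarith
    next
      have h1: "h \<le> 1" "h \<le> (w / E)\<^sup>2" using h by (auto simp: h0_def)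
      have "sqrt h \<le> w / E" using h1(2) w E by (intro real_le_lsqrt) auto
      then have "sqrt h * E \<le> w" using E by (simp add: field_simps)
      moreover have "h \<le> sqrt h"
        using h1 h by (intro real_le_rsqrt) (simp add: power2_eq_square mult_left_le)
      then have "h * L \<le> sqrt h * L" using L by (intro mult_right_mono)
      moreover have "sqrt h * E = sqrt h * L + sqrt h * (L * (k * sqrt (?D * k))) + sqrt h"
        by (simp add: E_def algebra_simps)
      moreover have "0 \<le> sqrt h" using h by simp
      ultimately show "h * L + sqrt h * (L * (k * sqrt (?D * k))) \<le> w" by linarith
    next
      fix \<xi> :: "real^'d" assume \<xi>: "\<xi> \<in> set_pmf (xi_law (p (t, x)))"
      have "?D / p (t, x) \<le> ?D * k" using b mult_left_mono[of "1 / p (t, x)" k ?D] by simp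
      then have "norm \<xi> \<le> sqrt (?D * k)"
        using norm_xi_le[OF _ _ \<xi>] b real_sqrt_le_mono order_trans by fastforce
      then have "norm (\<sigma>0 (t, x) *v \<xi>) \<le> k * sqrt (?D * k)"
        using b kk by (intro order_trans[OF norm_matrix_vector_mult] mult_mono) auto
      then show "\<phi> (x + sqrt h *\<^sub>R (\<sigma>0 (t, x) *v \<xi>)) \<le> \<psi> (x + sqrt h *\<^sub>R (\<sigma>0 (t, x) *v \<xi>))"
        using h by (intro le) (simp add: dist_norm mult.commute mult_right_mono)
    qed
  qed
qed

section \<open>Half-relaxed limits\<close>

text \<open>The upper limit as n grows and the argument tends to q jointly, written as an infimum of
  local eventual upper bounds. The value 0 off the strip lets two such limits be identified as
  functions.\<close>

definition half_relaxed_limit :: "real \<Rightarrow> (nat \<Rightarrow> 'd::finite spacetime \<Rightarrow> real) \<Rightarrow> 'd spacetime \<Rightarrow> real" where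
  "half_relaxed_limit T v q = (if q \<in> strip T
     then Inf {a. \<exists>N \<epsilon>. 0 < \<epsilon> \<and> (\<forall>n\<ge>N. \<forall>r\<in>strip T. dist r q < \<epsilon> \<longrightarrow> v n r \<le> a)} else 0)"

context
  fixes T B :: real and N0 :: nat and v :: "nat \<Rightarrow> 'd::finite spacetime \<Rightarrow> real"
  assumes bnd: "\<And>n r. N0 \<le> n \<Longrightarrow> r \<in> strip T \<Longrightarrow> \<bar>v n r\<bar> \<le> B"
begin

private lemma ge_minus_B:
  assumes "q \<in> strip T" "0 < \<epsilon>" "\<forall>n\<ge>N. \<forall>r\<in>strip T. dist r q < \<epsilon> \<longrightarrow> v n r \<le> a"
  shows "- B \<le> a"
proof -
  have "v (max N N0) q \<le> a" using assms by simp
  moreover have "\<bar>v (max N N0) q\<bar> \<le> B" using assms by (intro bnd) auto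
  ultimately show ?thesis by linarith
qed

private lemma upper_set:
  assumes "q \<in> strip T"
  defines "A \<equiv> {a. \<exists>N \<epsilon>. 0 < \<epsilon> \<and> (\<forall>n\<ge>N. \<forall>r\<in>strip T. dist r q < \<epsilon> \<longrightarrow> v n r \<le> a)}"
  shows "B \<in> A" "bdd_below A" "half_relaxed_limit T v q = Inf A"
proof -
  have "v n r \<le> B" if "N0 \<le> n" "r \<in> strip T" for n r using bnd[OF that] by linarith
  then show "B \<in> A" unfolding A_def by (intro CollectI exI[of _ N0] exI[of _ 1]) auto
  show "bdd_below A" unfolding A_def using ge_minus_B[OF assms(1)] by (intro bdd_belowI[of _ "- B"]) blast
  show "half_relaxed_limit T v q = Inf A" using assms(1) by (simp add: half_relaxed_limit_def A_def)
qed

lemma half_relaxed_limit_less: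
  assumes "q \<in> strip T" "half_relaxed_limit T v q < a"
  obtains \<epsilon> b N where "0 < \<epsilon>" "b < a" "\<And>n r. N \<le> n \<Longrightarrow> r \<in> strip T \<Longrightarrow> dist r q < \<epsilon> \<Longrightarrow> v n r \<le> b"
proof -
  obtain b where "b < a" "\<exists>N \<epsilon>. 0 < \<epsilon> \<and> (\<forall>n\<ge>N. \<forall>r\<in>strip T. dist r q < \<epsilon> \<longrightarrow> v n r \<le> b)"
    using cInf_lessD[OF _ assms(2)[unfolded upper_set(3)[OF assms(1)]]] upper_set(1)[OF assms(1)] by blast
  then show thesis using that by blast
qed

lemma half_relaxed_limit_le:
  assumes "q \<in> strip T" "0 < \<epsilon>" "\<And>n r. N \<le> n \<Longrightarrow> r \<in> strip T \<Longrightarrow> dist r q < \<epsilon> \<Longrightarrow> v n r \<le> a"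
  shows "half_relaxed_limit T v q \<le> a"
  unfolding upper_set(3)[OF assms(1)]
  by (rule cInf_lower[OF _ upper_set(2)[OF assms(1)]]) (use assms in blast)

lemma half_relaxed_limit_greater:
  assumes "q \<in> strip T" "a < half_relaxed_limit T v q" "0 < \<epsilon>"
  obtains n r where "N \<le> n" "r \<in> strip T" "dist r q < \<epsilon>" "a < v n r"
proof -
  have "\<exists>n\<ge>N. \<exists>r\<in>strip T. dist r q < \<epsilon> \<and> a < v n r"
    using half_relaxed_limit_le[OF assms(1,3), of N a] assms(2) by (meson not_le)
  then show thesis using that by blast
qed

lemma half_relaxed_limit_abs_le: "q \<in> strip T \<Longrightarrow> \<bar>half_relaxed_limit T v q\<bar> \<le> B"
proof -
  assume q: "q \<in> strip T"
  have "v n r \<le> B" if "N0 \<le> n" "r \<in> strip T" for n r using bnd[OF that] by linarith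
  then have "half_relaxed_limit T v q \<le> B" by (intro half_relaxed_limit_le[OF q zero_less_one]) auto
  moreover have "- B \<le> half_relaxed_limit T v q"
    unfolding upper_set(3)[OF q]
    by (rule cInf_greatest) (use upper_set(1)[OF q] ge_minus_B[OF q] in blast)+
  ultimately show ?thesis by linarith
qed

lemma half_relaxed_limit_usc: "usc_on (strip T) (half_relaxed_limit T v)"
  unfolding usc_on_def
proof (intro ballI allI impI)
  fix q a assume q: "q \<in> strip T" and "half_relaxed_limit T v q < a"
  then obtain N \<epsilon> b where b: "0 < \<epsilon>" "b < a" "\<And>n r. N \<le> n \<Longrightarrow> r \<in> strip T \<Longrightarrow> dist r q < \<epsilon> \<Longrightarrow> v n r \<le> b"
    by (rule half_relaxed_limit_less) blast
  have "half_relaxed_limit T v r < a" if r: "r \<in> strip T" "dist r q < \<epsilon> / 2" for r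
  proof -
    have "half_relaxed_limit T v r \<le> b"
    proof (rule half_relaxed_limit_le[OF r(1), of "\<epsilon> / 2" N])
      fix n r' assume "N \<le> n" "r' \<in> strip T" "dist r' r < \<epsilon> / 2"
      then show "v n r' \<le> b" using r(2) dist_triangle[of r' q r] by (intro b(3)) (auto simp: dist_commute)
    qed (use b in simp)
    then show ?thesis using b by simp
  qed
  then show "\<forall>\<^sub>F r in at q within strip T. half_relaxed_limit T v r < a"
    unfolding eventually_at using b(1) by (intro exI[of _ "\<epsilon> / 2"]) auto
qed

text \<open>A Dini-type covering argument: a pointwise strict bound for the limit becomes a bound on
  the whole compact set for all large n. It serves to localise near the touching point and to obtain
  uniform convergence.\<close>

lemma half_relaxed_limit_compact:
  assumes K: "compact K" "K \<subseteq> strip T" and f: "continuous_on K f"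
    and less: "\<And>q. q \<in> K \<Longrightarrow> half_relaxed_limit T v q < f q"
  shows "\<exists>N. \<forall>n\<ge>N. \<forall>q\<in>K. v n q < f q"
proof -
  have "\<exists>U N. open U \<and> q \<in> U \<and> (\<forall>n\<ge>N. \<forall>r\<in>U \<inter> K. v n r < f r)" if q: "q \<in> K" for q
  proof -
    obtain N \<epsilon> b where b: "0 < \<epsilon>" "b < f q" "\<And>n r. N \<le> n \<Longrightarrow> r \<in> strip T \<Longrightarrow> dist r q < \<epsilon> \<Longrightarrow> v n r \<le> b"
      by (rule half_relaxed_limit_less[OF subsetD[OF K(2) q] less[OF q]]) blast
    obtain d where d: "d > 0" "\<And>r. r \<in> K \<Longrightarrow> dist r q < d \<Longrightarrow> dist (f r) (f q) < f q - b"
      using f[unfolded continuous_on_iff, rule_format, OF q, of "f q - b"] b(2) by auto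
    have "v n r < f r" if "N \<le> n" "r \<in> ball q (min \<epsilon> d) \<inter> K" for n r
    proof -
      have "v n r \<le> b" using that K(2) by (intro b(3)) (auto simp: dist_commute)
      moreover have "dist (f r) (f q) < f q - b" using that by (intro d(2)) (auto simp: dist_commute)
      ultimately show ?thesis by (auto simp: dist_real_def)
    qed
    then show ?thesis using b(1) d(1) by (intro exI[of _ "ball q (min \<epsilon> d)"] exI[of _ N]) auto
  qed
  then obtain U N where U: "\<And>q. q \<in> K \<Longrightarrow> open (U q) \<and> q \<in> U q \<and> (\<forall>n\<ge>N q. \<forall>r\<in>U q \<inter> K. v n r < f r)"
    by metis
  obtain D where D: "D \<subseteq> K" "finite D" "K \<subseteq> (\<Union>q\<in>D. U q)"
    using compactE_image[OF K(1), of K U] U by blast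
  \<comment> \<open>The element 0 keeps the set nonempty when the subcover is empty.\<close>
  have "v n q < f q" if n: "Max (insert 0 (N ` D)) \<le> n" and q: "q \<in> K" for n q
  proof -
    obtain d where d: "d \<in> D" "q \<in> U d" using D(3) q by blast
    have "N d \<le> n" using n D(2) d(1) by (auto intro: order_trans[OF Max_ge])
    then show ?thesis using U[of d] d D(1) q by blast
  qed
  then show ?thesis by blast
qed

end

lemma half_relaxed_limit_minus_le:
  assumes bnd: "\<And>n r. N0 \<le> n \<Longrightarrow> r \<in> strip T \<Longrightarrow> \<bar>v n r\<bar> \<le> B" and q: "q \<in> strip T"
  shows "- half_relaxed_limit T (\<lambda>n r. - v n r) q \<le> half_relaxed_limit T v q"
proof (rule ccontr)
  assume "\<not> ?thesis"
  then have "half_relaxed_limit T v q < - half_relaxed_limit T (\<lambda>n r. - v n r) q" by simp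
  then obtain a where a: "half_relaxed_limit T v q < a" "a < - half_relaxed_limit T (\<lambda>n r. - v n r) q"
    using dense by blast
  obtain N \<epsilon> b where 1: "0 < \<epsilon>" "b < a" "\<And>n r. N \<le> n \<Longrightarrow> r \<in> strip T \<Longrightarrow> dist r q < \<epsilon> \<Longrightarrow> v n r \<le> b"
    using half_relaxed_limit_less[OF bnd q a(1)] by metis
  have "half_relaxed_limit T (\<lambda>n r. - v n r) q < - a" using a(2) by simp
  then obtain N' \<epsilon>' b' where 2: "0 < \<epsilon>'" "b' < - a"
      "\<And>n r. N' \<le> n \<Longrightarrow> r \<in> strip T \<Longrightarrow> dist r q < \<epsilon>' \<Longrightarrow> - v n r \<le> b'"
    using half_relaxed_limit_less[of N0 T "\<lambda>n r. - v n r" B q "- a"] bnd q by (auto; metis)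
  show False using 1(2) 2(2) 1(3)[of "max N N'" q] 2(3)[of "max N N'" q] 1(1) 2(1) q by simp
qed

section \<open>Convergence of monotone schemes\<close>

text \<open>These properties are abstracted from \<open>T_op\<close> in a form stable under changing
  the sign of the data and the solutions, so that the negated scheme is another instance with the
  same constants.\<close>

locale monotone_scheme =
  fixes T C h0 L B0 Lg :: real and G :: "'d::finite nonlinearity" and g :: "real^'d \<Rightarrow> real"
    and S :: "real \<Rightarrow> real \<Rightarrow> (real^'d \<Rightarrow> real) \<Rightarrow> real^'d \<Rightarrow> real"
    and v :: "nat \<Rightarrow> 'd spacetime \<Rightarrow> real"
  assumes T: "0 < T" and C: "0 \<le> C" and h0: "0 < h0"
    and lip: "nonlinearity_lipschitz T G L"
    and cont: "\<gamma> \<in> Sym \<Longrightarrow> continuous_on {0..T} (\<lambda>t. G t x y z \<gamma>)"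
    and G_bound: "0 \<le> t \<Longrightarrow> t \<le> T \<Longrightarrow> \<bar>G t x 0 0 0\<bar> \<le> B0"
    and g_bound: "\<bar>g x\<bar> \<le> B0" and g_lip: "\<bar>g x - g x'\<bar> \<le> Lg * norm (x - x')"
    and mono: "0 \<le> t \<Longrightarrow> t \<le> T \<Longrightarrow> 0 < h \<Longrightarrow> h \<le> h0 \<Longrightarrow>
      (\<And>y. dist x y \<le> C * sqrt h \<Longrightarrow> \<phi> y \<le> \<psi> y) \<Longrightarrow> S t h \<phi> x \<le> S t h \<psi> x"
    and const: "0 \<le> t \<Longrightarrow> t \<le> T \<Longrightarrow> 0 < h \<Longrightarrow> S t h (\<lambda>_. c) x = c + h * G t x c 0 0"
    and consistent: "smooth f \<Longrightarrow> 0 < \<delta> \<Longrightarrow> \<exists>h1>0. \<forall>t x h c. 0 \<le> t \<longrightarrow> t \<le> T \<longrightarrow> norm x \<le> R \<longrightarrow> 0 < h \<longrightarrow> h < h1 \<longrightarrow>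
      \<bar>S t h (\<lambda>y. f (t + h, y) + c) x - (f (t, x) + c +
        h * (dt f (t, x) + G t x (f (t, x) + c) (grad f (t, x)) (hess f (t, x))))\<bar> \<le> \<delta> * h"
    and v_T: "1 \<le> n \<Longrightarrow> v n (T, x) = g x"
    and v_step: "i \<in> {1..n} \<Longrightarrow> t \<in> {grid T n (i - 1)..<grid T n i} \<Longrightarrow>
      v n (t, x) = S t (grid T n i - t) (\<lambda>y. v n (grid T n i, y)) x"
begin

lemma L_nonneg: "0 \<le> L" using lip by (simp add: nonlinearity_lipschitz_def)

lemma B0_nonneg: "0 \<le> B0" using G_bound[of 0 0] T by simp

lemma grid_step: "grid T n (Suc i) = grid T n i + T / real n"
  by (simp add: grid_def algebra_simps add_divide_distrib)

lemma grid_last: "1 \<le> n \<Longrightarrow> grid T n n = T"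
  by (simp add: grid_def)

lemma grid_mono: "i \<le> j \<Longrightarrow> grid T n i \<le> grid T n j"
  using T by (simp add: grid_def mult_right_mono divide_right_mono)

text \<open>Covers full steps between grid points as well as partial ones from an off-grid time to
  the next grid point; the limit arguments see the recursion only through it.\<close>

definition step :: "nat \<Rightarrow> real \<Rightarrow> real \<Rightarrow> bool" where
  "step n t t' \<longleftrightarrow> 0 \<le> t \<and> t < t' \<and> t' \<le> T \<and> t' - t \<le> T / real n \<and>
     (\<forall>x. v n (t, x) = S t (t' - t) (\<lambda>y. v n (t', y)) x)"

lemma step_grid:
  assumes "i < n" "grid T n i \<le> t" "t < grid T n (Suc i)"
  shows "step n t (grid T n (Suc i))"
  unfolding step_def
proof (intro conjI allI)
  show "0 \<le> t" using assms(2) T by (intro order_trans[OF _ assms(2)]) (simp add: grid_def)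
  show "grid T n (Suc i) \<le> T" using grid_mono[of "Suc i" n n] grid_last[of n] assms(1) by simp
  show "grid T n (Suc i) - t \<le> T / real n" using assms(2) by (simp add: grid_step)
  show "v n (t, x) = S t (grid T n (Suc i) - t) (\<lambda>y. v n (grid T n (Suc i), y)) x" for x
    using assms by (intro v_step) auto
qed fact

lemma time_in_grid:
  assumes "1 \<le> n" "0 \<le> t" "t < T"
  obtains i where "i < n" "grid T n i \<le> t" "t < grid T n (Suc i)"
proof -
  define i where "i = (LEAST i. t < grid T n (Suc i))"
  have ex: "t < grid T n (Suc (n - 1))" using assms grid_last[of n] by simp
  have 1: "t < grid T n (Suc i)" unfolding i_def by (rule LeastI[of "\<lambda>i. t < grid T n (Suc i)", OF ex])
  have "i \<le> n - 1" unfolding i_def by (rule Least_le[of "\<lambda>i. t < grid T n (Suc i)", OF ex])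
  moreover have "grid T n i \<le> t"
  proof (cases i)
    case 0
    then show ?thesis using assms by (simp add: grid_def)
  next
    case (Suc j)
    then show ?thesis using not_less_Least[of j "\<lambda>i. t < grid T n (Suc i)"] by (simp add: i_def)
  qed
  ultimately show thesis using that[of i] 1 assms(1) by simp
qed

text \<open>Off the time grid the first step may be arbitrarily short, but the step after it is a full one.\<close>

lemma step_exists:
  assumes "1 \<le> n" "0 \<le> t" "t < T"
  obtains t' where "step n t t'" "t' < T \<Longrightarrow> step n t' (t' + T / real n)"
proof -
  obtain i where i: "i < n" "grid T n i \<le> t" "t < grid T n (Suc i)"
    by (rule time_in_grid[OF assms])
  show thesis
  proof (rule that[OF step_grid[OF i]])
    assume "grid T n (Suc i) < T"
    then have "Suc i < n" using grid_last[OF assms(1)] i(1) by (metis Suc_lessI less_irrefl)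
    then show "step n (grid T n (Suc i)) (grid T n (Suc i) + T / real n)"
      using step_grid[of "Suc i" n "grid T n (Suc i)"] T assms(1) by (simp only: grid_step[of n "Suc i"]) simp
  qed
qed

text \<open>Grid times are reached from T through full steps, any other time through one more
  partial step.\<close>

lemma backward_induct:
  assumes n: "1 \<le> n" and base: "P T" and ind: "\<And>t t'. step n t t' \<Longrightarrow> P t' \<Longrightarrow> P t"
    and t: "0 \<le> t" "t \<le> T"
  shows "P t"
proof -
  have gr: "P (grid T n i)" if "i \<le> n" for i
    using that
  proof (induction i rule: inc_induct)
    case base
    then show ?case using assms(2) grid_last[OF n] by simp
  next
    case (step i)
    then have "step n (grid T n i) (grid T n (Suc i))"
      using T n by (intro step_grid) (simp_all add: grid_step)
    then show ?case using step.IH by (rule ind)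
  qed
  show ?thesis
  proof (cases "t = T")
    case False
    then have "t < T" using t(2) by simp
    then obtain i where i: "i < n" "grid T n i \<le> t" "t < grid T n (Suc i)"
      by (rule time_in_grid[OF n t(1)])
    show ?thesis by (rule ind[OF step_grid[OF i] gr]) (use i(1) in simp)
  qed (use base in simp)
qed

lemma G_growth:
  assumes "0 \<le> t" "t \<le> T" "\<gamma> \<in> Sym"
  shows "\<bar>G t x y z \<gamma>\<bar> \<le> B0 + L * (\<bar>y\<bar> + norm z + norm \<gamma>)"
  using nonlinearity_lipschitzD[OF lip assms Sym_0, of x y z x 0 0] G_bound[OF assms(1,2), of x] by simp

lemma step_mono_le:
  assumes "step n t t'" "T / real n \<le> h0" "\<And>y. dist x y \<le> C * sqrt (t' - t) \<Longrightarrow> v n (t', y) \<le> \<psi> y"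
  shows "v n (t, x) \<le> S t (t' - t) \<psi> x"
  using assms unfolding step_def by (auto intro!: mono)

lemma step_mono_ge:
  assumes "step n t t'" "T / real n \<le> h0" "\<And>y. dist x y \<le> C * sqrt (t' - t) \<Longrightarrow> \<psi> y \<le> v n (t', y)"
  shows "S t (t' - t) \<psi> x \<le> v n (t, x)"
  using assms unfolding step_def by (auto intro!: mono)

text \<open>A discrete Gronwall bound. One step of length h takes a bound m to at most m + h (B0 + L
  m), and since B0 \<le> m this is at most m (1 + (L + 1) h).\<close>

definition stability_bound :: "real \<Rightarrow> real" where
  "stability_bound t = (B0 + 1) * exp ((L + 1) * (T - t))"

text \<open>The constants m and -m, with m the bound at the later time, act as barriers because
  \<open>S\<close> is explicit on constants.\<close>

lemma stable:
  assumes n: "1 \<le> n" "T / real n \<le> h0" and t: "0 \<le> t" "t \<le> T"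
  shows "\<bar>v n (t, x)\<bar> \<le> stability_bound t"
proof -
  have "\<forall>x. \<bar>v n (t, x)\<bar> \<le> stability_bound t"
  proof (rule backward_induct[OF n(1) _ _ t])
    show "\<forall>x. \<bar>v n (T, x)\<bar> \<le> stability_bound T"
      by (simp add: stability_bound_def v_T[OF n(1)] order_trans[OF g_bound])
  next
    fix t t' assume st: "step n t t'" and IH: "\<forall>x. \<bar>v n (t', x)\<bar> \<le> stability_bound t'"
    have t: "0 \<le> t" "t < t'" "t' \<le> T" using st by (auto simp: step_def)
    define h where "h = t' - t"
    let ?m = "stability_bound t'"
    have m: "B0 \<le> ?m" "0 \<le> ?m"
    proof -
      have "1 \<le> exp ((L + 1) * (T - t'))" using L_nonneg t by simp
      then have "(B0 + 1) * 1 \<le> ?m"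
        unfolding stability_bound_def using B0_nonneg by (intro mult_left_mono) auto
      then show "B0 \<le> ?m" "0 \<le> ?m" using B0_nonneg by auto
    qed
    have h: "0 < h" using t by (simp add: h_def)
    have "?m + h * (B0 + L * ?m) \<le> ?m * (1 + (L + 1) * h)"
      using mult_left_mono[OF m(1), of h] h by (simp add: algebra_simps)
    also have "\<dots> \<le> ?m * exp ((L + 1) * h)" using m by (intro mult_left_mono) auto
    also have "\<dots> = stability_bound t"
      by (simp add: stability_bound_def h_def algebra_simps flip: exp_add)
    finally have le: "?m + h * (B0 + L * ?m) \<le> stability_bound t" .
    show "\<forall>x. \<bar>v n (t, x)\<bar> \<le> stability_bound t"
    proof
      fix x
      have G: "\<bar>h * G t x c 0 0\<bar> \<le> h * (B0 + L * ?m)" if "\<bar>c\<bar> = ?m" for c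
        using G_growth[of t 0 x c 0] t Sym_0 h that by (simp add: abs_mult)
      have "v n (t, x) \<le> S t h (\<lambda>_. ?m) x" "S t h (\<lambda>_. - ?m) x \<le> v n (t, x)"
        unfolding h_def using IH by (auto intro!: step_mono_le[OF st n(2)] step_mono_ge[OF st n(2)] simp: abs_le_iff minus_le_iff)
      then show "\<bar>v n (t, x)\<bar> \<le> stability_bound t"
        using G[of ?m] G[of "- ?m"] m le t h by (simp add: const)
    qed
  qed
  then show ?thesis by blast
qed

definition N0 :: nat where "N0 = nat \<lceil>T / h0\<rceil> + 1"

definition B :: real where "B = stability_bound 0"

lemma N0_large: "N0 \<le> n \<Longrightarrow> 1 \<le> n" "N0 \<le> n \<Longrightarrow> T / real n \<le> h0"
proof -
  assume n: "N0 \<le> n"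
  show "1 \<le> n" using n by (simp add: N0_def)
  then have "T / h0 \<le> real n" using n unfolding N0_def by linarith
  then show "T / real n \<le> h0" using h0 \<open>1 \<le> n\<close> by (simp add: field_simps)
qed

lemma bounded_v: "N0 \<le> n \<Longrightarrow> r \<in> strip T \<Longrightarrow> \<bar>v n r\<bar> \<le> B"
proof -
  assume n: "N0 \<le> n" and "r \<in> strip T"
  then obtain t x where r: "r = (t, x)" "0 \<le> t" "t \<le> T" by (auto simp: strip_def)
  have "stability_bound t \<le> B"
    unfolding B_def stability_bound_def using B0_nonneg L_nonneg r by (auto intro!: mult_left_mono)
  then show "\<bar>v n r\<bar> \<le> B" using stable[OF N0_large[OF n] r(2,3), of x] r(1) by simp
qed

abbreviation "vbar \<equiv> half_relaxed_limit T v"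

text \<open>The sum bounds the space-time reach of one step: its length plus the radius of
  dependence.\<close>

lemma eventually_step_small: "0 < e \<Longrightarrow> \<exists>N\<ge>N0. \<forall>n\<ge>N. T / real n < e \<and> T / real n + C * sqrt (T / real n) < e"
proof -
  assume e: "0 < e"
  have "((\<lambda>n. T / real n) \<longlonglongrightarrow> 0)" by (rule lim_const_over_n)
  then have "(\<lambda>n. T / real n + C * sqrt (T / real n)) \<longlonglongrightarrow> 0 + C * sqrt 0"
    by (intro tendsto_intros)
  then have "\<forall>\<^sub>F n in sequentially. T / real n + C * sqrt (T / real n) < e"
    using e by (intro order_tendstoD) auto
  then obtain N where N: "\<forall>n\<ge>N. T / real n + C * sqrt (T / real n) < e"
    by (auto simp: eventually_sequentially)
  have "T / real n < e" if "T / real n + C * sqrt (T / real n) < e" for n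
  proof -
    have "0 \<le> C * sqrt (T / real n)" using C T by simp
    then show ?thesis using that by linarith
  qed
  then show ?thesis using N by (intro exI[of _ "max N N0"]) auto
qed


text \<open>Continuity in t is given only with the other arguments frozen; the uniform Lipschitz
  bound in those arguments upgrades it to joint continuity.\<close>

lemma G_tendsto:
  assumes t: "(\<tau> \<longlongrightarrow> t0) F" "\<forall>\<^sub>F w in F. \<tau> w \<in> {0..T}" and t0: "t0 \<in> {0..T}"
    and x: "(\<chi>' \<longlongrightarrow> x0) F" and y: "(Y \<longlongrightarrow> y0) F" and z: "(Z \<longlongrightarrow> z0) F"
    and \<gamma>: "(\<Gamma> \<longlongrightarrow> \<gamma>0) F" "\<And>w. \<Gamma> w \<in> Sym" "\<gamma>0 \<in> Sym"
  shows "((\<lambda>w. G (\<tau> w) (\<chi>' w) (Y w) (Z w) (\<Gamma> w)) \<longlongrightarrow> G t0 x0 y0 z0 \<gamma>0) F"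
proof -
  have 1: "((\<lambda>w. G (\<tau> w) x0 y0 z0 \<gamma>0) \<longlongrightarrow> G t0 x0 y0 z0 \<gamma>0) F"
    using continuous_on_tendsto_compose[OF cont[OF \<gamma>(3), of x0 y0 z0] t(1) t0 t(2)] .
  have 2: "((\<lambda>w. G (\<tau> w) (\<chi>' w) (Y w) (Z w) (\<Gamma> w) - G (\<tau> w) x0 y0 z0 \<gamma>0) \<longlongrightarrow> 0) F"
  proof (rule Lim_null_comparison)
    show "\<forall>\<^sub>F w in F. norm (G (\<tau> w) (\<chi>' w) (Y w) (Z w) (\<Gamma> w) - G (\<tau> w) x0 y0 z0 \<gamma>0) \<le>
       L * (norm (\<chi>' w - x0) + \<bar>Y w - y0\<bar> + norm (Z w - z0) + norm (\<Gamma> w - \<gamma>0))"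
      using t(2) by eventually_elim (use \<gamma> in \<open>auto intro!: nonlinearity_lipschitzD[OF lip]\<close>)
    have "((\<lambda>w. L * (norm (\<chi>' w - x0) + \<bar>Y w - y0\<bar> + norm (Z w - z0) + norm (\<Gamma> w - \<gamma>0))) \<longlongrightarrow>
       L * (norm (x0 - x0) + \<bar>y0 - y0\<bar> + norm (z0 - z0) + norm (\<gamma>0 - \<gamma>0))) F"
      by (intro tendsto_intros x y z \<gamma>)
    then show "((\<lambda>w. L * (norm (\<chi>' w - x0) + \<bar>Y w - y0\<bar> + norm (Z w - z0) + norm (\<Gamma> w - \<gamma>0))) \<longlongrightarrow> 0) F"
      by simp
  qed
  show ?thesis using tendsto_add[OF 2 1] by simp
qed

text \<open>Strictness persists for neighbouring points and small vertical shifts of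
  \<open>f\<close>; treating \<open>c\<close> as a further coordinate of the limit handles both at
  once.\<close>

lemma operator_nearby:
  assumes f: "smooth f" and q0: "0 \<le> t0" "t0 \<le> T"
    and less: "dt f (t0, x0) + G t0 x0 (f (t0, x0)) (grad f (t0, x0)) (hess f (t0, x0)) < c0"
  obtains d where "0 < d" "\<And>t x c. 0 \<le> t \<Longrightarrow> t \<le> T \<Longrightarrow> dist (t, x) (t0, x0) < d \<Longrightarrow> \<bar>c\<bar> < d \<Longrightarrow>
    dt f (t, x) + G t x (f (t, x) + c) (grad f (t, x)) (hess f (t, x)) < c0"
proof -
  let ?q0 = "((t0, x0), 0 :: real)"
  let ?F = "at ?q0 within strip T \<times> UNIV"
  have fst: "(fst \<longlongrightarrow> (t0, x0)) ?F"
    using tendsto_fst[OF tendsto_ident_at, of ?q0 "strip T \<times> UNIV"] by simp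
  have at: "(H \<longlongrightarrow> H (t0, x0)) (at (t0, x0))" if "continuous_on UNIV H"
    for H :: "'d spacetime \<Rightarrow> 'z::topological_space"
    using that by (simp add: continuous_on_def)
  have c: "((\<lambda>w. H (fst w)) \<longlongrightarrow> H (t0, x0)) ?F" if "continuous_on UNIV H"
    for H :: "'d spacetime \<Rightarrow> 'z::topological_space"
    using continuous_on_tendsto_compose[OF that fst] by simp
  have in_strip: "\<forall>\<^sub>F w in ?F. fst (fst w) \<in> {0..T}"
    by (auto simp: eventually_at_filter strip_def intro!: always_eventually)
  have "((\<lambda>w. dt f (fst w) + G (fst (fst w)) (snd (fst w)) (f (fst w) + snd w) (grad f (fst w)) (hess f (fst w)))
      \<longlongrightarrow> dt f (t0, x0) + G t0 x0 (f (t0, x0) + 0) (grad f (t0, x0)) (hess f (t0, x0))) ?F"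
  proof (intro tendsto_add G_tendsto in_strip)
    show "((\<lambda>w. fst (fst w)) \<longlongrightarrow> t0) ?F" "((\<lambda>w. snd (fst w)) \<longlongrightarrow> x0) ?F"
      using tendsto_fst[OF fst] tendsto_snd[OF fst] by simp_all
    show "(snd \<longlongrightarrow> 0) ?F"
      using tendsto_snd[OF tendsto_ident_at, of ?q0 "strip T \<times> UNIV"] by simp
  qed (use q0 f in \<open>auto intro!: c smooth_continuous continuous_on_grad continuous_on_hess smooth_dt hess_Sym\<close>)
  then have "\<forall>\<^sub>F w in ?F. dt f (fst w) + G (fst (fst w)) (snd (fst w)) (f (fst w) + snd w) (grad f (fst w)) (hess f (fst w)) < c0"
    using less by (intro order_tendstoD) auto
  then obtain d where d: "d > 0" "\<And>w. w \<in> strip T \<times> UNIV \<Longrightarrow> w \<noteq> ?q0 \<Longrightarrow> dist w ?q0 < d \<Longrightarrow>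
      dt f (fst w) + G (fst (fst w)) (snd (fst w)) (f (fst w) + snd w) (grad f (fst w)) (hess f (fst w)) < c0"
    unfolding eventually_at by blast
  show thesis
  proof (rule that[of "d / 2"])
    fix t x c assume t: "0 \<le> t" "t \<le> T" and near: "dist (t, x) (t0, x0) < d / 2" "\<bar>c\<bar> < d / 2"
    show "dt f (t, x) + G t x (f (t, x) + c) (grad f (t, x)) (hess f (t, x)) < c0"
    proof (cases "((t, x), c) = ?q0")
      case False
      have "dist ((t, x), c) ?q0 \<le> dist (t, x) (t0, x0) + dist c 0"
        unfolding dist_Pair_Pair[of "(t, x)"] by (rule sqrt_sum_squares_le_sum) auto
      then have "dist ((t, x), c) ?q0 < d" using near by simp
      then show ?thesis using d(2)[of "((t, x), c)"] False t by (simp add: strip_def)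
    qed (use less in auto)
  qed (use d in simp)
qed

text \<open>The perturbation by \<open>\<epsilon> |q - q\<^sub>0|\<^sup>2\<close> makes the maximum strict.  If the inequality failed, the
  supremum \<open>M\<close> of \<open>v n - \<psi>\<close> near \<open>q\<^sub>0\<close> would drop by a full step \<open>\<delta> T / n\<close> on the inner ball and
  stay below \<open>M\<close> on the outer annulus.\<close>

lemma half_relaxed_limit_subsolution_test:
  assumes q0: "0 \<le> t0" "t0 < T" and \<phi>: "smooth \<phi>" and touch: "vbar (t0, x0) = \<phi> (t0, x0)"
    and above: "\<And>q. q \<in> strip T \<Longrightarrow> vbar q \<le> \<phi> q"
  shows "- dt \<phi> (t0, x0) - G t0 x0 (\<phi> (t0, x0)) (grad \<phi> (t0, x0)) (hess \<phi> (t0, x0)) \<le> 0"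
proof (rule ccontr)
  let ?q0 = "(t0, x0)"
  define e0 where "e0 = - dt \<phi> ?q0 - G t0 x0 (\<phi> ?q0) (grad \<phi> ?q0) (hess \<phi> ?q0)"
  assume "\<not> ?thesis"
  then have e0: "0 < e0" by (simp add: e0_def)
  \<comment> \<open>The budget: one \<delta> is lost to the penalty, leaving a margin of 3 \<delta>
    at the touching point; 2 \<delta> survives nearby, and consistency costs one more.\<close>
  define \<delta> where "\<delta> = e0 / 4"
  have \<delta>: "0 < \<delta>" using e0 by (simp add: \<delta>_def)
  let ?I = "mat 1 :: real^'d^'d"
  define \<epsilon> where "\<epsilon> = \<delta> / (2 * L * norm ?I + 1)"
  have LI: "0 \<le> 2 * L * norm ?I" using L_nonneg by simp
  have \<epsilon>: "0 < \<epsilon>" "L * (2 * \<epsilon> * norm ?I) \<le> \<delta>"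
  proof -
    show "0 < \<epsilon>" using \<delta> LI unfolding \<epsilon>_def by (intro divide_pos_pos) linarith+
    have "\<epsilon> * (2 * L * norm ?I) \<le> \<epsilon> * (2 * L * norm ?I + 1)" using \<open>0 < \<epsilon>\<close> by simp
    also have "\<dots> = \<delta>" unfolding \<epsilon>_def using LI by (subst nonzero_eq_divide_eq[symmetric]) linarith+
    finally show "L * (2 * \<epsilon> * norm ?I) \<le> \<delta>" by (simp add: mult_ac)
  qed
  define \<psi> where "\<psi> = (\<lambda>q. \<phi> q + quad 0 0 \<epsilon> \<epsilon> ?q0 q)"
  have \<psi>: "smooth \<psi>" unfolding \<psi>_def by (intro smooth_add \<phi> smooth_quad)
  have quad: "quad 0 0 \<epsilon> \<epsilon> ?q0 q = \<epsilon> * (dist q ?q0)\<^sup>2" for q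
  proof -
    have "(dist (fst q, snd q) (t0, x0))\<^sup>2 = (fst q - t0)\<^sup>2 + (norm (snd q - x0))\<^sup>2"
      unfolding dist_Pair_Pair by (simp add: dist_real_def dist_norm[of _ x0])
    then show ?thesis by (simp add: quad_def algebra_simps)
  qed
  have \<psi>q0: "\<psi> ?q0 = \<phi> ?q0" by (simp add: \<psi>_def quad)
  have der: "dt \<psi> ?q0 = dt \<phi> ?q0" "grad \<psi> ?q0 = grad \<phi> ?q0" "hess \<psi> ?q0 = hess \<phi> ?q0 + (2 * \<epsilon>) *\<^sub>R mat 1"
    unfolding \<psi>_def by (simp_all add: dt_add grad_add hess_add \<phi> smooth_quad dt_quad grad_quad hess_quad)
  have "\<bar>G t0 x0 (\<phi> ?q0) (grad \<phi> ?q0) (hess \<psi> ?q0) - G t0 x0 (\<phi> ?q0) (grad \<phi> ?q0) (hess \<phi> ?q0)\<bar>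
      \<le> L * (norm (x0 - x0) + \<bar>\<phi> ?q0 - \<phi> ?q0\<bar> + norm (grad \<phi> ?q0 - grad \<phi> ?q0) + norm (hess \<psi> ?q0 - hess \<phi> ?q0))"
    using q0 by (intro nonlinearity_lipschitzD[OF lip] hess_Sym \<phi> \<psi>) auto
  also have "\<dots> = L * (2 * \<epsilon> * norm ?I)" using \<epsilon>(1) by (simp add: der)
  finally have "dt \<psi> ?q0 + G t0 x0 (\<psi> ?q0) (grad \<psi> ?q0) (hess \<psi> ?q0) \<le> - e0 + \<delta>"
    using \<epsilon>(2) unfolding \<psi>q0 der(1,2) e0_def by linarith
  then have "dt \<psi> ?q0 + G t0 x0 (\<psi> ?q0) (grad \<psi> ?q0) (hess \<psi> ?q0) < - 2 * \<delta>"
    using e0 by (simp add: \<delta>_def)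
  then obtain d where d: "0 < d" "\<And>t x c. 0 \<le> t \<Longrightarrow> t \<le> T \<Longrightarrow> dist (t, x) ?q0 < d \<Longrightarrow> \<bar>c\<bar> < d \<Longrightarrow>
      dt \<psi> (t, x) + G t x (\<psi> (t, x) + c) (grad \<psi> (t, x)) (hess \<psi> (t, x)) < - 2 * \<delta>"
    using operator_nearby[OF \<psi> q0(1)] q0(2) by (metis less_imp_le)
  \<comment> \<open>Inside the region of strict inequality, and with room for a second step before
    T.\<close>
  define r where "r = min (d / 2) ((T - t0) / 2)"
  have r: "0 < r" "r < d" "t0 + r < T" using d(1) q0 by (auto simp: r_def min_def field_simps)
  obtain h1 where h1: "h1 > 0" "\<And>t x h c. 0 \<le> t \<Longrightarrow> t \<le> T \<Longrightarrow> norm x \<le> norm x0 + r \<Longrightarrow> 0 < h \<Longrightarrow> h < h1 \<Longrightarrow>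
      \<bar>S t h (\<lambda>y. \<psi> (t + h, y) + c) x - (\<psi> (t, x) + c +
        h * (dt \<psi> (t, x) + G t x (\<psi> (t, x) + c) (grad \<psi> (t, x)) (hess \<psi> (t, x))))\<bar> \<le> \<delta> * h"
    using consistent[OF \<psi> \<delta>, of "norm x0 + r"] by blast
  \<comment> \<open>At distance r / 2 or more the penalty is at least \<epsilon> r^2 / 4, twice this
    value.\<close>
  define \<eta>1 where "\<eta>1 = \<epsilon> * r\<^sup>2 / 8"
  \<comment> \<open>A lower margin for \<open>M\<close>: above -\<open>\<eta>1\<close>, so that the
    annulus cannot carry the supremum, and above -d / 4, so that shifts by \<open>M\<close> stay
    admissible.\<close>
  define \<eta>2 where "\<eta>2 = min (d / 4) (\<eta>1 / 2)"
  have \<eta>: "0 < \<eta>1" "0 < \<eta>2" "\<eta>2 \<le> d / 4" "\<eta>2 \<le> \<eta>1 / 2"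
    using \<epsilon>(1) r(1) d(1) by (auto simp: \<eta>1_def \<eta>2_def)
  define K where "K = cball ?q0 r \<inter> strip T"
  have strip: "closed (strip T :: 'd spacetime set)" unfolding strip_def by (intro closed_Times) auto
  have K: "compact K" "K \<subseteq> strip T" using strip by (auto simp: K_def intro: compact_Int_closed)
  have cont\<psi>: "continuous_on X \<psi>" for X
    using smooth_continuous[OF \<psi>] by (rule continuous_on_subset) simp
  note hl = bounded_v
  obtain N1 where N1: "\<And>n q. N1 \<le> n \<Longrightarrow> q \<in> K - ball ?q0 (r / 2) \<Longrightarrow> v n q < \<psi> q - \<eta>1"
  proof -
    have "vbar q < \<psi> q - \<eta>1" if q: "q \<in> K - ball ?q0 (r / 2)" for q
    proof -
      have "(r / 2)\<^sup>2 \<le> (dist q ?q0)\<^sup>2" using q r(1) by (intro power_mono) (auto simp: dist_commute)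
      then have "\<epsilon> * (r / 2)\<^sup>2 \<le> \<epsilon> * (dist q ?q0)\<^sup>2" using \<epsilon>(1) by (intro mult_left_mono) auto
      then have "\<phi> q + 2 * \<eta>1 \<le> \<psi> q" by (simp add: \<psi>_def quad \<eta>1_def power_divide)
      then show ?thesis using above[of q] q K(2) \<eta>(1) by fastforce
    qed
    then have "\<exists>N. \<forall>n\<ge>N. \<forall>q\<in>K - ball ?q0 (r / 2). v n q < \<psi> q - \<eta>1"
      using K by (intro half_relaxed_limit_compact[OF hl] compact_diff continuous_intros cont\<psi>) auto
    then show thesis using that by blast
  qed
  obtain N2 where N2: "\<And>n q. N2 \<le> n \<Longrightarrow> q \<in> K \<Longrightarrow> v n q < \<psi> q + d / 4"
  proof -
    have "vbar q < \<psi> q + d / 4" if q: "q \<in> K" for q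
    proof -
      have "0 \<le> \<epsilon> * (dist q ?q0)\<^sup>2" using \<epsilon>(1) by simp
      then have "\<phi> q \<le> \<psi> q" by (simp add: \<psi>_def quad)
      then show ?thesis using above[of q] q K(2) d(1) by fastforce
    qed
    then have "\<exists>N. \<forall>n\<ge>N. \<forall>q\<in>K. v n q < \<psi> q + d / 4"
      using K by (intro half_relaxed_limit_compact[OF hl] continuous_intros cont\<psi>) auto
    then show thesis using that by blast
  qed
  obtain N3 where N3: "N0 \<le> N3" "\<And>n. N3 \<le> n \<Longrightarrow> T / real n < min (min h1 (r / 8)) (d / (4 * \<delta>))"
     "\<And>n. N3 \<le> n \<Longrightarrow> T / real n + C * sqrt (T / real n) < min (min h1 (r / 8)) (d / (4 * \<delta>))"
    using eventually_step_small[of "min (min h1 (r / 8)) (d / (4 * \<delta>))"] h1(1) r(1) d(1) \<delta> by auto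
  have q0s: "?q0 \<in> strip T" using q0 by (simp add: strip_def)
  obtain d2 where d2: "d2 > 0" "\<And>q. dist q ?q0 < d2 \<Longrightarrow> dist (\<psi> q) (\<psi> ?q0) < \<eta>2 / 2"
    using cont\<psi>[of UNIV] \<eta>(2) unfolding continuous_on_iff by (metis UNIV_I half_gt_zero)
  have less: "\<psi> ?q0 - \<eta>2 / 2 < vbar ?q0" using touch \<eta>(2) by (simp add: \<psi>q0)
  have "0 < min d2 (r / 2)" using d2(1) r(1) by simp
  then obtain n q1 where n: "max N1 (max N2 N3) \<le> n" and q1: "q1 \<in> strip T" "dist q1 ?q0 < min d2 (r / 2)"
      "\<psi> ?q0 - \<eta>2 / 2 < v n q1"
    using half_relaxed_limit_greater[OF hl q0s less, where N = "max N1 (max N2 N3)"] by blast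
  have nN: "N1 \<le> n" "N2 \<le> n" "N3 \<le> n" using n by auto
  have n1: "1 \<le> n" "T / real n \<le> h0" using N0_large N3(1) nN by (meson order_trans)+
  have q1K: "q1 \<in> K" using q1 r(1) by (auto simp: K_def dist_commute)
  have q1': "- \<eta>2 < v n q1 - \<psi> q1" using d2(2)[of q1] q1 unfolding dist_real_def by linarith
  \<comment> \<open>A supremum, possibly not attained; the contradiction must come from a uniform
    decrease rather than from a maximum point.\<close>
  define M where "M = (SUP q\<in>K. v n q - \<psi> q)"
  have le4: "v n q - \<psi> q \<le> d / 4" if "q \<in> K" for q using N2[OF nN(2) that] by linarith
  then have bdd: "bdd_above ((\<lambda>q. v n q - \<psi> q) ` K)" by (rule bdd_aboveI2)
  have M_le: "M \<le> d / 4" unfolding M_def by (rule cSUP_least) (use q1K le4 in blast)+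
  have M: "v n q \<le> \<psi> q + M" if "q \<in> K" for q
    using cSUP_upper[OF that bdd] by (simp add: M_def)
  have M_gr: "- \<eta>2 < M" using M[OF q1K] q1' by linarith
  define h where "h = T / real n"
  have h: "0 < h" "h < h1" "h < r / 8" "h + C * sqrt h < r / 8" "\<delta> * h < d / 4"
    using N3(2,3)[OF nN(3)] T n1 \<delta> by (auto simp: h_def field_simps)
  \<comment> \<open>The shift \<open>M'\<close> is a parameter because the estimate is used for
    \<open>M\<close> and then again for the improved bound \<open>M - \<delta> * h\<close>.\<close>
  have one_step: "v n (t, x) \<le> \<psi> (t, x) + M' - \<delta> * (t' - t)"
    if st: "step n t t'" and q: "dist (t, x) ?q0 < r" and M': "\<bar>M'\<bar> < d"
      and le: "\<And>y. dist (t', y) ?q0 \<le> dist (t, x) ?q0 + r / 8 \<Longrightarrow> v n (t', y) \<le> \<psi> (t', y) + M'" for t t' x M'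
  proof -
    let ?k = "t' - t"
    have t: "0 \<le> t" "t \<le> T" "0 < ?k" "?k \<le> h" using st by (auto simp: step_def h_def)
    have "v n (t, x) \<le> S t ?k (\<lambda>y. \<psi> (t', y) + M') x"
    proof (rule step_mono_le[OF st n1(2)], rule le)
      fix y assume y: "dist x y \<le> C * sqrt ?k"
      have "dist (t', y) ?q0 \<le> dist (t', y) (t, x) + dist (t, x) ?q0" by (rule dist_triangle)
      also have "dist (t', y) (t, x) \<le> dist t' t + dist y x"
        unfolding dist_Pair_Pair by (rule sqrt_sum_squares_le_sum) auto
      also have "dist t' t + dist y x \<le> h + C * sqrt h"
      proof (rule add_mono)
        show "dist t' t \<le> h" using t by (simp add: dist_real_def)
        have "C * sqrt ?k \<le> C * sqrt h" using t C by (intro mult_left_mono) auto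
        then show "dist y x \<le> C * sqrt h" using y by (simp add: dist_commute)
      qed
      finally show "dist (t', y) ?q0 \<le> dist (t, x) ?q0 + r / 8" using h by linarith
    qed
    also have "\<dots> \<le> \<psi> (t, x) + M' + ?k * (dt \<psi> (t, x) + G t x (\<psi> (t, x) + M') (grad \<psi> (t, x)) (hess \<psi> (t, x))) + \<delta> * ?k"
    proof -
      have "dist x x0 \<le> dist (t, x) ?q0" using dist_snd_le[of "(t, x)" ?q0] by simp
      then have "norm (x - x0) \<le> r" using q by (simp add: dist_norm)
      then have "norm x \<le> norm x0 + r" using norm_triangle_sub[of x x0] by linarith
      then show ?thesis using h1(2)[of t x ?k M'] t h by simp
    qed
    also have "?k * (dt \<psi> (t, x) + G t x (\<psi> (t, x) + M') (grad \<psi> (t, x)) (hess \<psi> (t, x))) \<le> ?k * (- 2 * \<delta>)"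
      using d(2)[of t x M'] t q r M' by (intro mult_left_mono) auto
    finally show ?thesis by (simp add: algebra_simps)
  qed
  have in_K: "(t', y) \<in> K" if "step n t t'" "dist (t', y) ?q0 \<le> r" for t t' y
    using that by (auto simp: K_def step_def strip_def dist_commute)
  have A: "v n (t, x) \<le> \<psi> (t, x) + M - \<delta> * (t' - t)"
    if st: "step n t t'" and q: "dist (t, x) ?q0 \<le> 3 * r / 4" for t t' x
  proof (rule one_step[OF st])
    show "dist (t, x) ?q0 < r" using q r(1) by linarith
    show "\<bar>M\<bar> < d" using M_le M_gr \<eta> d(1) by linarith
    fix y assume "dist (t', y) ?q0 \<le> dist (t, x) ?q0 + r / 8"
    then show "v n (t', y) \<le> \<psi> (t', y) + M" using q r(1) by (intro M in_K[OF st]) linarith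
  qed
  \<comment> \<open>From radius r / 2 the first step reaches at most 5 r / 8, where the following
    full step has already gained \<delta> h; from radius 3 r / 4 that step stays inside
    \<open>K\<close>.\<close>
  have "v n q - \<psi> q \<le> max (- \<eta>1) (M - \<delta> * h)" if qK: "q \<in> K" for q
  proof (cases "q \<in> ball ?q0 (r / 2)")
    case False
    then show ?thesis using N1[OF nN(1), of q] qK by simp
  next
    case True
    obtain t x where q: "q = (t, x)" by (cases q)
    have d': "dist (t, x) ?q0 < r / 2" using True by (simp add: q dist_commute)
    have "dist t t0 \<le> dist (t, x) ?q0" using dist_fst_le[of "(t, x)" ?q0] by simp
    then have "t < t0 + r / 2" using d' by (simp add: dist_real_def)
    then have t: "0 \<le> t" "t < T" "t + h < T" using qK r h by (auto simp: q K_def strip_def)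
    obtain t' where t': "step n t t'" "t' < T \<Longrightarrow> step n t' (t' + T / real n)"
      by (rule step_exists[OF n1(1) t(1,2)]) blast
    have "t' < T" using t'(1) t(3) by (auto simp: step_def h_def)
    then have st2: "step n t' (t' + h)" using t'(2) by (simp add: h_def)
    have "v n (t, x) \<le> \<psi> (t, x) + (M - \<delta> * h) - \<delta> * (t' - t)"
    proof (rule one_step[OF t'(1)])
      show "dist (t, x) ?q0 < r" using d' r(1) by linarith
      show "\<bar>M - \<delta> * h\<bar> < d" 
      proof -
        have "0 \<le> \<delta> * h" using \<delta> h by simp
        then show ?thesis using M_le M_gr \<eta> d(1) h(5) by linarith
      qed
      fix y assume "dist (t', y) ?q0 \<le> dist (t, x) ?q0 + r / 8"
      then show "v n (t', y) \<le> \<psi> (t', y) + (M - \<delta> * h)"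
        using A[OF st2, of y] d' r(1) by simp
    qed
    moreover have "0 \<le> \<delta> * (t' - t)" using \<delta> t'(1) by (simp add: step_def)
    ultimately show ?thesis by (simp add: q)
  qed
  then have "M \<le> max (- \<eta>1) (M - \<delta> * h)"
    using q1K by (subst (1) M_def) (intro cSUP_least, blast+)
  moreover have "0 < \<delta> * h" using \<delta> h by simp
  ultimately show False using M_gr \<eta> by linarith
qed

text \<open>The barrier \<open>g x\<^sub>0 + e + A |x - x\<^sub>0|\<^sup>2 + c (T - t)\<close> is a strict supersolution of the scheme for
  \<open>|x - x\<^sub>0| \<le> 1\<close> and \<open>c (T - t) \<le> 1\<close>; for \<open>|x - x\<^sub>0| \<ge> 1\<close> it exceeds the stability bound.\<close>

lemma half_relaxed_limit_terminal: "vbar (T, x0) \<le> g x0"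
proof (rule field_le_epsilon)
  fix e2 :: real assume "0 < e2"
  define e where "e = e2 / 2"
  have e: "0 < e" using \<open>0 < e2\<close> by (simp add: e_def)
  have Tq: "(T, x0) \<in> strip T" using T by (simp add: strip_def)
  have B: "0 \<le> B" using bounded_v[OF order_refl Tq] by linarith
  define A where "A = 2 * B + B0 + 1 + Lg\<^sup>2 / e"
  have "0 \<le> Lg\<^sup>2 / e" using e by simp
  then have A: "2 * B + B0 + 1 \<le> A" "Lg\<^sup>2 / e \<le> A" "0 < A" using B B0_nonneg by (auto simp: A_def)
  \<comment> \<open>Young's inequality replaces the Lipschitz cone, which is not smooth at its tip,
    by a paraboloid at the price of e.\<close>
  have lip_quad: "Lg * s \<le> e + A * s\<^sup>2" for s
  proof -
    define Q where "Q = Lg\<^sup>2 / e * s\<^sup>2"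
    have "0 \<le> (e - Lg * s)\<^sup>2" by simp
    then have "2 * e * (Lg * s) \<le> e\<^sup>2 + Lg\<^sup>2 * s\<^sup>2" by (simp add: power2_diff power_mult_distrib)
    then have "Lg * s \<le> (e\<^sup>2 + Lg\<^sup>2 * s\<^sup>2) / (2 * e)" using e by (simp add: field_simps)
    also have "\<dots> = e / 2 + Q / 2" using e by (simp add: Q_def field_simps power2_eq_square)
    finally have "Lg * s \<le> e / 2 + Q / 2" .
    moreover have "Q \<le> A * s\<^sup>2" unfolding Q_def using A by (intro mult_right_mono) auto
    moreover have "0 \<le> A * s\<^sup>2" using A by simp
    ultimately show ?thesis using e by linarith
  qed
  let ?I = "mat 1 :: real^'d^'d"
  \<comment> \<open>Bounds |G| along the barrier where |x - x0| \<le> 1 and c (T - t) \<le> 1. The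
    second restriction keeps \<open>C1\<close> independent of c, so that c = C1 + 1 is not circular;
    the extra 1 pays for the consistency error.\<close>
  define C1 where "C1 = B0 + L * ((B0 + e + A + 1) + 2 * A + 2 * A * norm ?I)"
  define c where "c = C1 + 1"
  have "0 \<le> L * ((B0 + e + A + 1) + 2 * A + 2 * A * norm ?I)"
    using L_nonneg B0_nonneg e A by (intro mult_nonneg_nonneg add_nonneg_nonneg) auto
  then have c: "0 < c" using B0_nonneg by (simp add: c_def C1_def)
  define \<psi> where "\<psi> = quad (g x0 + e + c * T) (- c) 0 A (T, x0)"
  have \<psi>: "smooth \<psi>" unfolding \<psi>_def by (rule smooth_quad)
  have \<psi>_eq: "\<psi> (t, x) = g x0 + e + c * (T - t) + A * (norm (x - x0))\<^sup>2" for t x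
    by (simp add: \<psi>_def quad_def algebra_simps)
  obtain h1 where h1: "h1 > 0" "\<And>t x h c. 0 \<le> t \<Longrightarrow> t \<le> T \<Longrightarrow> norm x \<le> norm x0 + 1 \<Longrightarrow> 0 < h \<Longrightarrow> h < h1 \<Longrightarrow>
      \<bar>S t h (\<lambda>y. \<psi> (t + h, y) + c) x - (\<psi> (t, x) + c +
        h * (dt \<psi> (t, x) + G t x (\<psi> (t, x) + c) (grad \<psi> (t, x)) (hess \<psi> (t, x))))\<bar> \<le> 1 * h"
    using consistent[OF \<psi> zero_less_one, of "norm x0 + 1"] by blast
  obtain N where N: "N0 \<le> N" "\<And>n. N \<le> n \<Longrightarrow> T / real n < h1"
    using eventually_step_small[OF h1(1)] by blast
  have barrier: "v n (t, x) \<le> \<psi> (t, x)" if n: "N \<le> n" and t: "0 \<le> t" "t \<le> T" "c * (T - t) \<le> 1" for n t x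
  proof -
    have n1: "N0 \<le> n" "1 \<le> n" "T / real n \<le> h0" using N0_large N(1) n by (meson order_trans)+
    have "c * (T - t) \<le> 1 \<longrightarrow> (\<forall>x. v n (t, x) \<le> \<psi> (t, x))"
    proof (rule backward_induct[OF n1(2) _ _ t(1,2)])
      show "c * (T - T) \<le> 1 \<longrightarrow> (\<forall>x. v n (T, x) \<le> \<psi> (T, x))"
      proof (intro impI allI)
        fix x
        have "g x \<le> g x0 + Lg * norm (x - x0)" using g_lip[of x x0] by linarith
        then show "v n (T, x) \<le> \<psi> (T, x)"
          using lip_quad[of "norm (x - x0)"] by (simp add: v_T[OF n1(2)] \<psi>_eq)
      qed
    next
      fix t t' assume st: "step n t t'" and IH: "c * (T - t') \<le> 1 \<longrightarrow> (\<forall>x. v n (t', x) \<le> \<psi> (t', x))"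
      have t: "0 \<le> t" "t < t'" "t' \<le> T" "t' - t \<le> T / real n" using st by (auto simp: step_def)
      show "c * (T - t) \<le> 1 \<longrightarrow> (\<forall>x. v n (t, x) \<le> \<psi> (t, x))"
      proof (intro impI allI)
        fix x assume ct: "c * (T - t) \<le> 1"
        have ct0: "0 \<le> c * (T - t)" using c t by simp
        show "v n (t, x) \<le> \<psi> (t, x)"
        proof (cases "norm (x - x0) \<le> 1")
          case False
          then have "A * 1 \<le> A * (norm (x - x0))\<^sup>2" using A by (intro mult_left_mono) auto
          moreover have "v n (t, x) \<le> B" using bounded_v[OF n1(1), of "(t, x)"] t by (simp add: strip_def)
          moreover have "- B0 \<le> g x0" using g_bound[of x0] by linarith
          ultimately show ?thesis using A ct0 e B unfolding \<psi>_eq by linarith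
        next
          case True
          let ?h = "t' - t"
          let ?Z = "dt \<psi> (t, x) + G t x (\<psi> (t, x)) (grad \<psi> (t, x)) (hess \<psi> (t, x))"
          have "c * (T - t') \<le> c * (T - t)" using c t by (intro mult_left_mono) auto
          then have "v n (t, x) \<le> S t ?h (\<lambda>y. \<psi> (t', y)) x"
            using IH ct by (intro step_mono_le[OF st n1(3)]) auto
          also have "\<dots> \<le> \<psi> (t, x) + ?h * ?Z + ?h"
          proof -
            have "norm x \<le> norm x0 + 1" using norm_triangle_sub[of x x0] True by linarith
            then show ?thesis using h1(2)[of t x ?h 0] t N(2)[OF n] by simp
          qed
          also have "?h * ?Z \<le> ?h * (- 1)"
          proof (rule mult_left_mono)
            have A1: "A * (norm (x - x0))\<^sup>2 \<le> A * 1" "0 \<le> A * (norm (x - x0))\<^sup>2"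
              using True A by (auto intro!: mult_left_mono power_le_one)
            have "\<bar>\<psi> (t, x)\<bar> \<le> B0 + e + A + 1"
              using g_bound[of x0] A1 ct ct0 e unfolding \<psi>_eq by linarith
            moreover have "norm (grad \<psi> (t, x)) \<le> 2 * A"
              using True A by (simp add: \<psi>_def grad_quad)
            moreover have "norm (hess \<psi> (t, x)) = 2 * A * norm ?I"
              using A by (simp add: \<psi>_def hess_quad)
            ultimately have "L * (\<bar>\<psi> (t, x)\<bar> + norm (grad \<psi> (t, x)) + norm (hess \<psi> (t, x)))
              \<le> L * ((B0 + e + A + 1) + 2 * A + 2 * A * norm ?I)"
              using L_nonneg by (intro mult_left_mono add_mono) auto
            moreover have "dt \<psi> (t, x) = - c" by (simp add: \<psi>_def dt_quad)
            ultimately show "?Z \<le> - 1"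
              using G_growth[OF t(1) _ hess_Sym[OF \<psi>], of x "\<psi> (t, x)" "grad \<psi> (t, x)"  "(t, x)"] t
              by (simp add: c_def C1_def)
          qed (use t in simp)
          finally show ?thesis by simp
        qed
      qed
    qed
    then show ?thesis using t by blast
  qed
  have "vbar (T, x0) \<le> g x0 + 2 * e"
  proof -
    have "isCont \<psi> (T, x0)"
      using smooth_continuous[OF \<psi>] by (simp add: continuous_on_eq_continuous_at)
    then obtain d where d: "d > 0" "\<And>q. dist q (T, x0) < d \<Longrightarrow> dist (\<psi> q) (\<psi> (T, x0)) < e"
      unfolding continuous_at_eps_delta using e by metis
    \<comment> \<open>The time window 1 / c does not depend on n, so the barrier holds on a fixed
      neighbourhood of the terminal point; continuity of \<psi> costs the second e.\<close>
    show ?thesis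
    proof (rule half_relaxed_limit_le[OF bounded_v Tq, where \<epsilon> = "min d (1 / c)" and N = N])
      fix n r assume n: "N \<le> n" and r: "r \<in> strip T" "dist r (T, x0) < min d (1 / c)"
      obtain t x where tx: "r = (t, x)" "0 \<le> t" "t \<le> T" using r(1) by (auto simp: strip_def)
      have "dist t T \<le> dist r (T, x0)" using dist_fst_le[of r "(T, x0)"] tx by simp
      then have "T - t \<le> 1 / c" using r tx by (simp add: dist_real_def)
      then have "c * (T - t) \<le> 1" using c by (simp add: field_simps)
      then have "v n r \<le> \<psi> r" using barrier[OF n tx(2,3)] tx by simp
      moreover have "dist (\<psi> r) (\<psi> (T, x0)) < e" using r by (intro d) auto
      moreover have "\<psi> (T, x0) = g x0 + e" by (simp add: \<psi>_eq)
      ultimately show "v n r \<le> g x0 + 2 * e" by (simp add: dist_real_def)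
    qed (use d c in auto)
  qed
  then show "vbar (T, x0) \<le> g x0 + e2" by (simp add: e_def)
qed

lemma half_relaxed_limit_subsol: "visc_subsol T G g vbar"
  unfolding visc_subsol_def
proof (intro conjI allI impI)
  show "usc_on (strip T) vbar" by (rule half_relaxed_limit_usc[OF bounded_v])
  show "vbar (T, x) \<le> g x" for x by (rule half_relaxed_limit_terminal)
  fix t x \<phi>
  assume a: "0 \<le> t \<and> t < T \<and> smooth \<phi> \<and> vbar (t, x) - \<phi> (t, x) = 0 \<and> (\<forall>q\<in>strip T. vbar q - \<phi> q \<le> 0)"
  show "- dt \<phi> (t, x) - G t x (\<phi> (t, x)) (grad \<phi> (t, x)) (hess \<phi> (t, x)) \<le> 0"
    by (rule half_relaxed_limit_subsolution_test) (use a in auto)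
qed

end

section \<open>Supersolutions by duality\<close>

text \<open>The nonlinearity of the equation satisfied by -u, which exchanges sub- and
  supersolutions.\<close>

definition dual_nonlinearity :: "'d::finite nonlinearity \<Rightarrow> 'd nonlinearity" where
  "dual_nonlinearity G t x y z \<gamma> = - G t x (- y) (- z) (- \<gamma>)"

lemma Sym_minus: "- A \<in> Sym \<longleftrightarrow> A \<in> Sym"
  by (simp add: Sym_def transpose_def vec_eq_iff)

text \<open>Negating both the argument and the result of \<open>S\<close> reverses the order twice,
  so monotonicity survives. Consistency for f and c follows from that for -f and -c, and all
  constants are unchanged.\<close>

lemma (in monotone_scheme) dual_scheme:
  "monotone_scheme T C h0 L B0 Lg (dual_nonlinearity G) (\<lambda>x. - g x)
     (\<lambda>t h \<phi> x. - S t h (\<lambda>y. - \<phi> y) x) (\<lambda>n q. - v n q)"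
proof
  show "nonlinearity_lipschitz T (dual_nonlinearity G) L"
    unfolding nonlinearity_lipschitz_def
  proof (intro conjI L_nonneg ballI allI)
    fix t x y z \<gamma> x' y' z' \<gamma>'
    assume t: "t \<in> {0..T}" and S: "\<gamma> \<in> (Sym :: (real^'d^'d) set)" "\<gamma>' \<in> (Sym :: (real^'d^'d) set)"
    have "\<bar>G t x' (- y') (- z') (- \<gamma>') - G t x (- y) (- z) (- \<gamma>)\<bar> \<le>
       L * (norm (x' - x) + \<bar>- y' - - y\<bar> + norm (- z' - - z) + norm (- \<gamma>' - - \<gamma>))"
      using t S by (intro nonlinearity_lipschitzD[OF lip]) (auto simp: Sym_minus)
    then show "\<bar>dual_nonlinearity G t x y z \<gamma> - dual_nonlinearity G t x' y' z' \<gamma>'\<bar> \<le>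
       L * (norm (x - x') + \<bar>y - y'\<bar> + norm (z - z') + norm (\<gamma> - \<gamma>'))"
      by (simp add: dual_nonlinearity_def norm_minus_commute[of x] add.commute)
  qed
  show "continuous_on {0..T} (\<lambda>t. dual_nonlinearity G t x y z \<gamma>)" if "\<gamma> \<in> Sym" for x y z \<gamma>
    unfolding dual_nonlinearity_def using that by (intro continuous_intros cont) (simp add: Sym_minus)
  show "\<bar>dual_nonlinearity G t x 0 0 0\<bar> \<le> B0" if "0 \<le> t" "t \<le> T" for t x
    using G_bound[OF that] by (simp add: dual_nonlinearity_def)
  show "\<bar>- g x\<bar> \<le> B0" for x using g_bound by simp
  show "\<bar>- g x - - g x'\<bar> \<le> Lg * norm (x - x')" for x x'
    using g_lip[of x x'] by (simp add: abs_minus_commute)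
  show "- S t h (\<lambda>y. - \<phi> y) x \<le> - S t h (\<lambda>y. - \<psi> y) x"
    if "0 \<le> t" "t \<le> T" "0 < h" "h \<le> h0" "\<And>y. dist x y \<le> C * sqrt h \<Longrightarrow> \<phi> y \<le> \<psi> y" for t h x \<phi> \<psi>
    using mono[OF that(1-4), of x "\<lambda>y. - \<psi> y" "\<lambda>y. - \<phi> y"] that(5) by simp
  show "- S t h (\<lambda>y. - c) x = c + h * dual_nonlinearity G t x c 0 0"
    if "0 \<le> t" "t \<le> T" "0 < h" for t h x c
    using const[OF that, of "- c" x] by (simp add: dual_nonlinearity_def)
  show "\<exists>h1>0. \<forall>t x h c. 0 \<le> t \<longrightarrow> t \<le> T \<longrightarrow> norm x \<le> R \<longrightarrow> 0 < h \<longrightarrow> h < h1 \<longrightarrow>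
      \<bar>- S t h (\<lambda>y. - (f (t + h, y) + c)) x - (f (t, x) + c +
        h * (dt f (t, x) + dual_nonlinearity G t x (f (t, x) + c) (grad f (t, x)) (hess f (t, x))))\<bar> \<le> \<delta> * h"
    if f: "smooth f" and \<delta>: "0 < \<delta>" for f \<delta> R
  proof -
    obtain h1 where h1: "h1 > 0" "\<And>t x h c. 0 \<le> t \<Longrightarrow> t \<le> T \<Longrightarrow> norm x \<le> R \<Longrightarrow> 0 < h \<Longrightarrow> h < h1 \<Longrightarrow>
      \<bar>S t h (\<lambda>y. - f (t + h, y) + c) x - (- f (t, x) + c +
        h * (- dt f (t, x) + G t x (- f (t, x) + c) (- grad f (t, x)) (- hess f (t, x))))\<bar> \<le> \<delta> * h"
      using consistent[OF smooth_minus[OF f] \<delta>, of R] unfolding dt_minus[OF f] grad_minus[OF f] hess_minus[OF f]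
      by blast
    show ?thesis
    proof (intro exI[of _ h1] conjI h1(1) allI impI)
      fix t h c :: real and x :: "real^'d"
      assume a: "0 \<le> t" "t \<le> T" "norm x \<le> R" "0 < h" "h < h1"
      have "- S t h (\<lambda>y. - (f (t + h, y) + c)) x - (f (t, x) + c +
          h * (dt f (t, x) + dual_nonlinearity G t x (f (t, x) + c) (grad f (t, x)) (hess f (t, x)))) =
        - (S t h (\<lambda>y. - f (t + h, y) + - c) x - (- f (t, x) + - c +
          h * (- dt f (t, x) + G t x (- f (t, x) + - c) (- grad f (t, x)) (- hess f (t, x)))))"
        by (simp add: dual_nonlinearity_def algebra_simps)
      then show "\<bar>- S t h (\<lambda>y. - (f (t + h, y) + c)) x - (f (t, x) + c +
          h * (dt f (t, x) + dual_nonlinearity G t x (f (t, x) + c) (grad f (t, x)) (hess f (t, x))))\<bar> \<le> \<delta> * h"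
        using h1(2)[OF a, of "- c"] by (simp only: abs_minus_cancel)
    qed
  qed
  show "- v n (T, x) = - g x" if "1 \<le> n" for n x using v_T[OF that] by simp
  show "- v n (t, x) = - S t (grid T n i - t) (\<lambda>y. - (- v n (grid T n i, y))) x"
    if "i \<in> {1..n}" "t \<in> {grid T n (i - 1)..<grid T n i}" for n i t x
    using v_step[OF that, of x] by simp
qed (use T C h0 in auto)

lemma visc_supersol_dual:
  assumes "visc_subsol T (dual_nonlinearity G) (\<lambda>x. - g x) w"
  shows "visc_supersol T G g (\<lambda>q. - w q)"
  unfolding visc_supersol_def
proof (intro conjI allI impI)
  note w = assms[unfolded visc_subsol_def]
  show "lsc_on (strip T) (\<lambda>q. - w q)"
    unfolding lsc_on_def
  proof (intro ballI allI impI)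
    fix q a assume "q \<in> strip T" "a < - w q"
    then have "\<forall>\<^sub>F r in at q within strip T. w r < - a"
      using w unfolding usc_on_def by (metis less_minus_iff)
    then show "\<forall>\<^sub>F r in at q within strip T. a < - w r" by eventually_elim simp
  qed
  show "g x \<le> - w (T, x)" for x using w by (metis le_minus_iff)
  fix t x \<phi>
  assume a: "0 \<le> t \<and> t < T \<and> smooth \<phi> \<and> - w (t, x) - \<phi> (t, x) = 0 \<and> (\<forall>q\<in>strip T. 0 \<le> - w q - \<phi> q)"
  then have \<phi>: "smooth \<phi>" by simp
  have "- dt (\<lambda>q. - \<phi> q) (t, x) - dual_nonlinearity G t x (- \<phi> (t, x)) (grad (\<lambda>q. - \<phi> q) (t, x))
      (hess (\<lambda>q. - \<phi> q) (t, x)) \<le> 0"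
    using a smooth_minus[OF \<phi>] by (intro w[THEN conjunct2, THEN conjunct2, rule_format]) (auto simp: algebra_simps)
  then show "0 \<le> - dt \<phi> (t, x) - G t x (\<phi> (t, x)) (grad \<phi> (t, x)) (hess \<phi> (t, x))"
    by (simp add: dt_minus grad_minus hess_minus \<phi> dual_nonlinearity_def)
qed

lemma usc_lsc_continuous_on: "usc_on S u \<Longrightarrow> lsc_on S u \<Longrightarrow> continuous_on S u"
  unfolding continuous_on_def usc_on_def lsc_on_def by (auto intro: order_tendstoI)

text \<open>Once the two half-relaxed limits agree, the limit is both upper and lower
  semicontinuous, hence continuous. Only then can it, shifted by e, serve as the continuous bound in
  \<open>half_relaxed_limit_compact\<close>, which from both sides gives uniform convergence on
  compact sets.\<close>

theorem (in monotone_scheme) converges: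
  assumes "S4 T G g"
  shows "\<exists>u. bounded (u ` strip T) \<and> visc_sol T G g u \<and>
           (\<forall>w. bounded (w ` strip T) \<and> visc_sol T G g w \<longrightarrow> (\<forall>q\<in>strip T. w q = u q)) \<and>
           (\<forall>K. compact K \<and> K \<subseteq> strip T \<longrightarrow> uniform_limit K v u sequentially)"
proof -
  interpret dual: monotone_scheme T C h0 L B0 Lg "dual_nonlinearity G" "\<lambda>x. - g x"
     "\<lambda>t h \<phi> x. - S t h (\<lambda>y. - \<phi> y) x" "\<lambda>n q. - v n q"
    by (rule dual_scheme)
  define w where "w = half_relaxed_limit T (\<lambda>n q. - v n q)"
  have sub: "visc_subsol T G g vbar" by (rule half_relaxed_limit_subsol)
  have super: "visc_supersol T G g (\<lambda>q. - w q)"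
    unfolding w_def by (rule visc_supersol_dual[OF dual.half_relaxed_limit_subsol])
  have bv: "bounded (vbar ` strip T)"
    unfolding bounded_iff using half_relaxed_limit_abs_le[OF bounded_v] by (intro exI[of _ B]) auto
  have bw: "bounded ((\<lambda>q. - w q) ` strip T)"
    unfolding bounded_iff w_def
    using half_relaxed_limit_abs_le[OF dual.bounded_v] by (intro exI[of _ dual.B]) auto
  \<comment> \<open>Comparison gives one inequality and boundedness the elementary other one; off
    the strip both sides are 0.\<close>
  have "vbar q = - w q" for q
  proof (cases "q \<in> strip T")
    case True
    have "vbar q \<le> - w q" using assms[unfolded S4_def] sub super bv bw True by blast
    moreover have "- w q \<le> vbar q"
      unfolding w_def by (rule half_relaxed_limit_minus_le[OF bounded_v True])
    ultimately show ?thesis by simp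
  qed (simp add: w_def half_relaxed_limit_def)
  then have eq: "(\<lambda>q. - w q) = vbar" by auto
  have sol: "visc_sol T G g vbar" using sub super by (simp add: visc_sol_def eq)
  have cont: "continuous_on (strip T) vbar"
    using sub super unfolding eq visc_subsol_def visc_supersol_def by (intro usc_lsc_continuous_on) auto
  have "\<forall>q\<in>strip T. u q = vbar q" if "bounded (u ` strip T)" "visc_sol T G g u" for u
    using assms[unfolded S4_def] that sol bv unfolding visc_sol_def by (meson order_antisym)
  moreover have "uniform_limit K v vbar sequentially" if K: "compact K" "K \<subseteq> strip T" for K
  proof (rule uniform_limitI)
    fix e :: real assume e: "0 < e"
    have c: "continuous_on K vbar" using cont K(2) by (rule continuous_on_subset)
    have w: "half_relaxed_limit T (\<lambda>n q. - v n q) q = - vbar q" for q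
      using fun_cong[OF eq, of q] by (simp add: w_def)
    have "\<exists>N. \<forall>n\<ge>N. \<forall>q\<in>K. v n q < vbar q + e"
      using e by (intro half_relaxed_limit_compact[OF bounded_v K] continuous_intros c) auto
    moreover have "\<exists>N. \<forall>n\<ge>N. \<forall>q\<in>K. - v n q < - vbar q + e"
      using e by (intro half_relaxed_limit_compact[OF dual.bounded_v K] continuous_intros c) (auto simp: w)
    ultimately obtain N1 N2 where N1: "\<And>n q. N1 \<le> n \<Longrightarrow> q \<in> K \<Longrightarrow> v n q < vbar q + e"
      and N2: "\<And>n q. N2 \<le> n \<Longrightarrow> q \<in> K \<Longrightarrow> - v n q < - vbar q + e" by blast
    have "\<forall>q\<in>K. dist (v n q) (vbar q) < e" if "max N1 N2 \<le> n" for n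
    proof
      fix q assume q: "q \<in> K"
      have "N1 \<le> n" "N2 \<le> n" using that by auto
      then show "dist (v n q) (vbar q) < e"
        using N1[of n q] N2[of n q] q unfolding dist_real_def by linarith
    qed
    then show "\<forall>\<^sub>F n in sequentially. \<forall>q\<in>K. dist (v n q) (vbar q) < e"
      by (rule eventually_sequentiallyI)
  qed
  ultimately show ?thesis using bv sol by blast
qed

lemma S2_nonlinearity_lipschitz:
  assumes "S2 T G g" "0 \<le> T"
  obtains L where "nonlinearity_lipschitz T G L"
proof -
  obtain L where L: "\<And>t. t \<in> {0..T} \<Longrightarrow>
      L-lipschitz_on (UNIV \<times> UNIV \<times> UNIV \<times> Sym) (\<lambda>(x, y, z, \<gamma>). G t x y z \<gamma>)"
    using assms unfolding S2_def by blast
  have L0: "0 \<le> L" using lipschitz_on_nonneg[OF L[of 0]] assms(2) by simp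
  have "\<bar>G t x y z \<gamma> - G t x' y' z' \<gamma>'\<bar> \<le> L * (norm (x - x') + \<bar>y - y'\<bar> + norm (z - z') + norm (\<gamma> - \<gamma>'))"
    if "t \<in> {0..T}" "\<gamma> \<in> Sym" "\<gamma>' \<in> Sym" for t x y z \<gamma> x' y' z' \<gamma>'
  proof -
    have "\<bar>G t x y z \<gamma> - G t x' y' z' \<gamma>'\<bar> \<le> L * dist (x, y, z, \<gamma>) (x', y', z', \<gamma>')"
      using lipschitz_onD[OF L[OF that(1)], of "(x, y, z, \<gamma>)" "(x', y', z', \<gamma>')"] that(2,3)
      by (simp add: dist_real_def)
    also have "dist (x, y, z, \<gamma>) (x', y', z', \<gamma>') \<le> dist x x' + (dist y y' + (dist z z' + dist \<gamma> \<gamma>'))"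
      unfolding dist_Pair_Pair
      by (intro order_trans[OF sqrt_sum_squares_le_sum] add_mono order_refl) auto
    finally show ?thesis using L0 by (simp add: dist_norm mult_left_mono add.assoc)
  qed
  then show thesis using that L0 unfolding nonlinearity_lipschitz_def by blast
qed

theorem theorem3p12:
  fixes T :: real
    and G :: "'d::finite nonlinearity"
    and g :: "real^'d \<Rightarrow> real"
    and \<sigma>0 :: "'d spacetime \<Rightarrow> real^'d^'d"
    and p :: "'d spacetime \<Rightarrow> real"
    and uh :: "nat \<Rightarrow> 'd spacetime \<Rightarrow> real"
  assumes "T > 0"
    and "nonlinearity_differentiable T G"
    and "S1 T G g" and "S2 T G g" and "S3 T G" and "S4 T G g"
    and "admissible_pair T \<sigma>0 p"
    and "M1 T G \<sigma>0" and "M2 T G \<sigma>0 p"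
    and "\<And>n. n \<ge> 1 \<Longrightarrow> is_scheme T G g \<sigma>0 p n (uh n)"
  shows "\<exists>u. bounded (u ` strip T) \<and> visc_sol T G g u \<and>
           (\<forall>v. bounded (v ` strip T) \<and> visc_sol T G g v \<longrightarrow> (\<forall>q\<in>strip T. v q = u q)) \<and>
           (\<forall>K. compact K \<and> K \<subseteq> strip T \<longrightarrow> uniform_limit K uh u sequentially)"
proof -
  obtain L where lip: "nonlinearity_lipschitz T G L"
    using S2_nonlinearity_lipschitz[OF assms(4)] assms(1) by (metis less_imp_le)
  obtain Lg where Lg: "Lg-lipschitz_on UNIV g" using assms(4) unfolding S2_def by blast
  obtain b1 b2 where b: "\<And>t x. (t, x) \<in> strip T \<Longrightarrow> \<bar>G t x 0 0 0\<bar> \<le> b1" "\<And>x. \<bar>g x\<bar> \<le> b2"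
  proof -
    obtain b1 where b1: "\<forall>y\<in>(\<lambda>(t, x). G t x 0 0 0) ` strip T. norm y \<le> b1"
      using assms(3) unfolding S1_def bounded_iff by blast
    obtain b2 where b2: "\<forall>y\<in>range g. norm y \<le> b2"
      using assms(3) unfolding S1_def bounded_iff by blast
    have "\<bar>G t x 0 0 0\<bar> \<le> b1" if "(t, x) \<in> strip T" for t x
      using b1[rule_format, OF imageI[OF that]] by simp
    then show thesis using b2 by (intro that[of b1 b2]) auto
  qed
  obtain k C h0 where sb: "scheme_bound T \<sigma>0 p k" and C: "0 \<le> C" "0 < h0"
    and mono: "\<And>t h x \<phi> \<psi>. 0 \<le> t \<Longrightarrow> t \<le> T \<Longrightarrow> 0 < h \<Longrightarrow> h \<le> h0 \<Longrightarrow>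
      (\<And>y. dist x y \<le> C * sqrt h \<Longrightarrow> \<phi> y \<le> \<psi> y) \<Longrightarrow> T_op G \<sigma>0 p t h \<phi> x \<le> T_op G \<sigma>0 p t h \<psi> x"
    using scheme_monotone[OF assms(1,2) lip assms(7-9)] by blast
  \<comment> \<open>A single constant has to bound both \<open>G\<close> at zero arguments and
    \<open>g\<close>, hence the maximum.\<close>
  interpret monotone_scheme T C h0 L "max b1 b2" Lg G g "T_op G \<sigma>0 p" uh
  proof
    show "continuous_on {0..T} (\<lambda>t. G t x y z \<gamma>)" if "\<gamma> \<in> Sym" for x y z \<gamma>
      using assms(4) that unfolding S2_def by blast
    show "\<bar>G t x 0 0 0\<bar> \<le> max b1 b2" if "0 \<le> t" "t \<le> T" for t x
      using b(1)[of t x] that by (simp add: strip_def)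
    show "\<bar>g x\<bar> \<le> max b1 b2" for x using b(2)[of x] by simp
    show "\<bar>g x - g x'\<bar> \<le> Lg * norm (x - x')" for x x'
      using lipschitz_onD[OF Lg, of x x'] by (simp add: dist_norm)
    show "\<exists>h1>0. \<forall>t x h c. 0 \<le> t \<longrightarrow> t \<le> T \<longrightarrow> norm x \<le> R \<longrightarrow> 0 < h \<longrightarrow> h < h1 \<longrightarrow>
      \<bar>T_op G \<sigma>0 p t h (\<lambda>y. f (t + h, y) + c) x - (f (t, x) + c +
        h * (dt f (t, x) + G t x (f (t, x) + c) (grad f (t, x)) (hess f (t, x))))\<bar> \<le> \<delta> * h"
      if "smooth f" "0 < \<delta>" for f \<delta> R
      using T_op_consistent[OF sb lip that, of R] by metis
    show "uh n (T, x) = g x" if "1 \<le> n" for n x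
      using assms(10)[OF that] by (simp add: is_scheme_def)
    show "uh n (t, x) = T_op G \<sigma>0 p t (grid T n i - t) (\<lambda>y. uh n (grid T n i, y)) x"
      if "i \<in> {1..n}" "t \<in> {grid T n (i - 1)..<grid T n i}" for n i t x
      using assms(10)[of n] that unfolding is_scheme_def by auto
  qed (use assms(1) C lip mono T_op_const[OF sb] in auto)
  show ?thesis by (rule converges[OF assms(6)])
qed

end
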